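(* Let $p$ be a prime, $i,j$ non-negative integers and $\varepsilon\in\{0,1\}$. The map $$\tilde\mu_{2i+\varepsilon}^{2i(p-1)+\varepsilon,j}\colon E_{2i+\varepsilon}^{2i(p-1)+\varepsilon}\mathcal A_p\otimes(\mathcal A_p/F_{2i-j+\varepsilon+1}\mathcal A_p)^j\to E_{2i-j+\varepsilon}^{2i(p-1)+j+\varepsilon}\mathcal A_p$$ induced by the product of $\mathcal A_p$ is an isomorphism.
   Context: Let $p$ be a prime and $\mathcal A_p$ the mod $p$ Steenrod algebra ($\mathcal A_p^k$ its degree-$k$ part). The excess filtration: $F_i\mathcal A_p$ is the span of admissible monomials $\beta^{\varepsilon_0}\wp^{i_1}\beta^{\varepsilon_1}\cdots\wp^{i_n}\beta^{\varepsilon_n}$ ($\varepsilon_s\in\{0,1\}$, $i_s\ge pi_{s+1}+\varepsilon_s$) with excess $\sum_{s=0}^n\varepsilon_s+2\sum_{s=1}^n(i_s-pi_{s+1}-\varepsilon_s)\ge i$ (with $i_{n+1}=0$) if $p$ is odd, resp. of admissible $Sq^{j_1}\cdots Sq^{j_n}$ ($j_s\ge2j_{s+1}$) with excess $\sum_s(j_s-2j_{s+1})\ge i$ if $p=2$; $F_i\mathcal A_p=\mathcal A_p$ for $i\le0$. $E_i^k\mathcal A_p=(F_i\mathcal A_p)^k/(F_{i+1}\mathcal A_p)^k$. Since each $F_i\mathcal A_p$ is a left ideal and $F_i\mathcal A_p\cdot\mathcal A_p^j\subset F_{i-j}\mathcal A_p$, the product induces well-defined maps $\tilde\mu_i^{k,j}\colon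 E_i^k\mathcal A_p\otimes(\mathcal A_p/F_{i-j+1}\mathcal A_p)^j\to E_{i-j}^{k+j}\mathcal A_p$, $[a]\otimes[b]\mapsto[ab]$. *)

theory Defs
  imports Main "HOL-Library.Poly_Mapping" "HOL-Computational_Algebra.Primes"
begin

text \<open>Generators of the free associative algebra: B is the Bockstein beta,
  P n is the reduced power P^n (for p = 2 it stands for Sq^n).
  Elements of the free Z-algebra on these generators are finitely supported
  integer combinations of words.  The Steenrod algebra A_p is the quotient of
  this free algebra by the two-sided ideal steen_ideal p generated by p, the
  relation P^0 = 1, (for p = 2) B = Sq^1, (for p odd) beta^2 = 0, and the
  Adem relations.  We never form the quotient type; instead all statements
  are phrased on representatives.\<close>

datatype gen = B | P nat

type_synonym falg = "gen list \<Rightarrow>\<^sub>0 int"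

definition wmono :: "gen list \<Rightarrow> falg" where
  "wmono w = Poly_Mapping.single w 1"

definition cmono :: "int \<Rightarrow> gen list \<Rightarrow> falg" where
  "cmono c w = Poly_Mapping.single w c"

definition fmul :: "falg \<Rightarrow> falg \<Rightarrow> falg" where
  "fmul f g = (\<Sum>u\<in>Poly_Mapping.keys f. \<Sum>v\<in>Poly_Mapping.keys g.
       Poly_Mapping.single (u @ v) (Poly_Mapping.lookup f u * Poly_Mapping.lookup g v))"

definition cb :: "int \<Rightarrow> int \<Rightarrow> int" where
  "cb n k = (if n < 0 \<or> k < 0 then 0 else int (nat n choose nat k))"

fun gdeg :: "nat \<Rightarrow> gen \<Rightarrow> nat" where
  "gdeg p B = 1"
| "gdeg p (P n) = (if p = 2 then n else 2 * n * (p - 1))"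

definition wdeg :: "nat \<Rightarrow> gen list \<Rightarrow> nat" where
  "wdeg p w = sum_list (map (gdeg p) w)"

definition homog :: "nat \<Rightarrow> nat \<Rightarrow> falg \<Rightarrow> bool" where
  "homog p k x \<longleftrightarrow> (\<forall>w\<in>Poly_Mapping.keys x. wdeg p w = k)"

definition adem2 :: "nat \<Rightarrow> nat \<Rightarrow> falg" where
  "adem2 a b = wmono [P a, P b] -
     (\<Sum>c\<in>{0..a div 2}. cmono (cb (int b - int c - 1) (int a - 2 * int c)) [P (a + b - c), P c])"

definition ademP :: "nat \<Rightarrow> nat \<Rightarrow> nat \<Rightarrow> falg" where
  "ademP p a b = wmono [P a, P b] -
     (\<Sum>t\<in>{0..a div p}. cmono ((-1) ^ (a + t) *
         cb ((int p - 1) * (int b - int t) - 1) (int a - int p * int t)) [P (a + b - t), P t])"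

definition ademPB :: "nat \<Rightarrow> nat \<Rightarrow> nat \<Rightarrow> falg" where
  "ademPB p a b = wmono [P a, B, P b] -
     (\<Sum>t\<in>{0..a div p}. cmono ((-1) ^ (a + t) *
         cb ((int p - 1) * (int b - int t)) (int a - int p * int t)) [B, P (a + b - t), P t]) -
     (\<Sum>t\<in>{0..a div p}. cmono ((-1) ^ (a + t + 1) *
         cb ((int p - 1) * (int b - int t) - 1) (int a - int p * int t - 1)) [P (a + b - t), B, P t])"

definition steen_rels :: "nat \<Rightarrow> falg set" where
  "steen_rels p =
     {wmono [P 0] - wmono []} \<union>
     (if p = 2 then
        {wmono [B] - wmono [P 1]} \<union> {adem2 a b | a b. 0 < a \<and> a < 2 * b}
      else
        {wmono [B, B]} \<union> {ademP p a b | a b. 0 < a \<and> 0 < b \<and> a < p * b}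
          \<union> {ademPB p a b | a b. 0 < a \<and> 0 < b \<and> a \<le> p * b})"

inductive_set steen_ideal :: "nat \<Rightarrow> falg set" for p :: nat where
  rel: "r \<in> steen_rels p \<Longrightarrow> r \<in> steen_ideal p"
| char: "frag_cmul (int p) x \<in> steen_ideal p"
| add: "x \<in> steen_ideal p \<Longrightarrow> y \<in> steen_ideal p \<Longrightarrow> x + y \<in> steen_ideal p"
| lmul: "x \<in> steen_ideal p \<Longrightarrow> fmul y x \<in> steen_ideal p"
| rmul: "x \<in> steen_ideal p \<Longrightarrow> fmul x y \<in> steen_ideal p"

inductive_set zspan :: "falg set \<Rightarrow> falg set" for S :: "falg set" where
  zero: "0 \<in> zspan S"
| step: "x \<in> zspan S \<Longrightarrow> m \<in> S \<Longrightarrow> x + frag_cmul c m \<in> zspan S"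

definition adm2 :: "nat list \<Rightarrow> bool" where
  "adm2 js \<longleftrightarrow> (\<forall>s<length js. 1 \<le> js ! s) \<and>
     (\<forall>s. Suc s < length js \<longrightarrow> 2 * js ! Suc s \<le> js ! s)"

definition nxt :: "nat list \<Rightarrow> nat \<Rightarrow> nat" where
  "nxt js s = (if Suc s < length js then js ! Suc s else 0)"

definition excess2 :: "nat list \<Rightarrow> int" where
  "excess2 js = (\<Sum>s<length js. int (js ! s) - 2 * int (nxt js s))"

definition word2 :: "nat list \<Rightarrow> gen list" where
  "word2 js = map P js"

text \<open>p odd: beta^e0 P^(i_1) beta^(e_1) ... P^(i_n) beta^(e_n), given by e0 and the
  list of pairs (i_s, e_s); e's in {0,1}, i_s \<ge> 1, i_s \<ge> p i_(s+1) + e_s.\<close>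
definition admP :: "nat \<Rightarrow> nat \<Rightarrow> (nat \<times> nat) list \<Rightarrow> bool" where
  "admP p e0 ps \<longleftrightarrow> e0 \<le> 1 \<and> (\<forall>s<length ps. snd (ps ! s) \<le> 1 \<and> 1 \<le> fst (ps ! s)) \<and>
     (\<forall>s. Suc s < length ps \<longrightarrow> p * fst (ps ! Suc s) + snd (ps ! s) \<le> fst (ps ! s))"

definition nxtP :: "(nat \<times> nat) list \<Rightarrow> nat \<Rightarrow> nat" where
  "nxtP ps s = (if Suc s < length ps then fst (ps ! Suc s) else 0)"

definition excessP :: "nat \<Rightarrow> nat \<Rightarrow> (nat \<times> nat) list \<Rightarrow> int" where
  "excessP p e0 ps = int e0 + (\<Sum>s<length ps. int (snd (ps ! s))) +
     2 * (\<Sum>s<length ps. int (fst (ps ! s)) - int p * int (nxtP ps s) - int (snd (ps ! s)))"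

definition wordP :: "nat \<Rightarrow> (nat \<times> nat) list \<Rightarrow> gen list" where
  "wordP e0 ps = replicate e0 B @ concat (map (\<lambda>(i, e). P i # replicate e B) ps)"

definition adm_exc :: "nat \<Rightarrow> int \<Rightarrow> falg set" where
  "adm_exc p i = (if p = 2 then {wmono (word2 js) | js. adm2 js \<and> i \<le> excess2 js}
     else {wmono (wordP e0 ps) | e0 ps. admP p e0 ps \<and> i \<le> excessP p e0 ps})"

definition Fset :: "nat \<Rightarrow> int \<Rightarrow> falg set" where
  "Fset p i = (if i \<le> 0 then UNIV
     else {x. \<exists>y\<in>zspan (adm_exc p i). x - y \<in> steen_ideal p})"

definition Fdeg :: "nat \<Rightarrow> int \<Rightarrow> nat \<Rightarrow> falg set" where
  "Fdeg p i k = {x \<in> Fset p i. homog p k x}"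

definition Adeg :: "nat \<Rightarrow> nat \<Rightarrow> falg set" where
  "Adeg p k = {x. homog p k x}"

text \<open>The tensor product (U/U') \<otimes> (V/V') is the free abelian group on U \<times> V
  modulo the subgroup tens_rel generated by the bilinearity relations and the
  pairs with first entry in U' or second entry in V'.  (For F_p-vector spaces
  the tensor product over Z coincides with the one over F_p.)\<close>
inductive_set tens_rel :: "falg set \<Rightarrow> falg set \<Rightarrow> falg set \<Rightarrow> falg set \<Rightarrow> (falg \<times> falg \<Rightarrow>\<^sub>0 int) set"
  for U U' V V' :: "falg set" where
  zero: "0 \<in> tens_rel U U' V V'"
| addl: "a \<in> U \<Longrightarrow> a' \<in> U \<Longrightarrow> b \<in> V \<Longrightarrow>
     frag_of (a + a', b) - frag_of (a, b) - frag_of (a', b) \<in> tens_rel U U' V V'"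
| addr: "a \<in> U \<Longrightarrow> b \<in> V \<Longrightarrow> b' \<in> V \<Longrightarrow>
     frag_of (a, b + b') - frag_of (a, b) - frag_of (a, b') \<in> tens_rel U U' V V'"
| subl: "a \<in> U' \<Longrightarrow> a \<in> U \<Longrightarrow> b \<in> V \<Longrightarrow> frag_of (a, b) \<in> tens_rel U U' V V'"
| subr: "a \<in> U \<Longrightarrow> b \<in> V' \<Longrightarrow> b \<in> V \<Longrightarrow> frag_of (a, b) \<in> tens_rel U U' V V'"
| add: "x \<in> tens_rel U U' V V' \<Longrightarrow> y \<in> tens_rel U U' V V' \<Longrightarrow> x + y \<in> tens_rel U U' V V'"
| cmul: "x \<in> tens_rel U U' V V' \<Longrightarrow> frag_cmul c x \<in> tens_rel U U' V V'"

definition tmul :: "(falg \<times> falg \<Rightarrow>\<^sub>0 int) \<Rightarrow> falg" where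
  "tmul s = (\<Sum>q\<in>Poly_Mapping.keys s. frag_cmul (Poly_Mapping.lookup s q) (fmul (fst q) (snd q)))"

end

(* Write M = p c + e and let a = beta^e P^c (with a = Sq^c, e = 0 for p = 2) be the admissible
   monomial spanning the first factor.  For an admissible w = beta^e' P^c' ... put m(w) = p c' + e';
   then excess + degree is 2 m(w) (just m(w) for p = 2), so the excess filtration in a fixed degree
   is the filtration by m.  Left multiplication by a is a bijection from the admissible b with
   m(b) <= c onto the admissible w with m(w) = M, and if m(b) > c then the Adem relations rewrite
   a b into admissible monomials with m > M.  So the map sends a basis to a basis once admissible
   monomials are known to be linearly independent modulo the Adem relations.

   Independence is detected on tensor powers of the free unstable module on a class x of degree
   one, with basis x, y, y^p, y^(p^2), ...  There P^a P^b is a combination of the Milnor basis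
   elements P(N, Q) with binomial coefficients, so the Adem relations reduce to a single binomial
   congruence, obtained by extracting a coefficient from
   (1 - z)^(-(p-1)a-1) ((1 - z)^(p-1) + z^p)^(a+b). *)

theory Submission
  imports Defs "HOL-Number_Theory.Cong" "HOL-Computational_Algebra.Formal_Power_Series"
begin

section \<open>The Adem binomial identity\<close>

unbundle fps_syntax

text \<open>The algebra is given by relations, so independence of the admissible monomials is the
  point that rewriting cannot supply: it takes a representation on which all Adem relations are
  checked. Most admissible monomials vanish on a single copy of the module, hence the tensor powers.
  There the Cartan formula distributes an operation over the entries, a recursion on lists treats
  one entry at a time, and a product of two reduced powers raises an entry at most twice. Scalars
  stay integers and p belongs to the ideal, so every identity is a congruence modulo p. Independence
  enters twice: in injectivity, and in the description of the filtration in one degree, since an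
  element of a filtration step is a priori congruent to a combination of admissible monomials of
  mixed degrees. The numbers in the statement make the first factor extremal: 2i + \<epsilon> is the
  excess of \<beta>^\<epsilon> P^i (of Sq^(2i+\<epsilon>) for p = 2), and no other admissible
  monomial of the same degree has an excess as large. Hence every tensor has the form a \<otimes>
  b.\<close>

lemma prime_dvd_prime_power_choose:
  fixes p :: nat
  assumes "prime p" "0 < k" "k < p ^ r"
  shows "p dvd (p ^ r choose k)"
proof (rule ccontr)
  assume "\<not> p dvd (p ^ r choose k)"
  then have "coprime (p ^ r) (p ^ r choose k)"
    using assms(1) by (simp add: prime_imp_coprime)
  moreover have "p ^ r dvd k * (p ^ r choose k)"
    using assms(2,3) times_binomial_minus1_eq[of k "p ^ r"] by simp
  ultimately have "p ^ r dvd k"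
    by (simp add: coprime_dvd_mult_left_iff)
  with assms(2,3) show False
    by (auto dest: dvd_imp_le)
qed

text \<open>Modulo p, (1 + z)^(p^r) is 1 + z^(p^r); Vandermonde's identity reads off the coefficient
  of z^k in (1 + z)^(N + p^r).\<close>

lemma choose_add_prime_power_cong:
  fixes p :: nat
  assumes "prime p"
  shows "[(N + p ^ r choose k) = (N choose k) + (if p ^ r \<le> k then N choose (k - p ^ r) else 0)] (mod p)"
proof -
  let ?q = "p ^ r"
  let ?f = "\<lambda>j. (?q choose j) * (N choose (k - j))"
  have q: "0 < ?q" using assms by (simp add: prime_gt_0_nat)
  have z: "[?f j = (if j = 0 then N choose k else if j = ?q then N choose (k - ?q) else 0)] (mod p)" for j
  proof -
    consider "j = 0" | "j = ?q" "j \<noteq> 0" | "0 < j" "j < ?q" | "?q < j" by linarith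
    then show ?thesis
    proof cases
      case 3
      then have "p dvd ?f j" using prime_dvd_prime_power_choose[OF assms] by simp
      with 3 show ?thesis by (simp add: cong_0_iff)
    next
      case 4 then show ?thesis using q by (simp add: binomial_eq_0)
    qed (use q in auto)
  qed
  have "(N + ?q choose k) = (\<Sum>j\<le>k. ?f j)"
    using vandermonde[of ?q N k] by (simp add: add.commute)
  also have "[(\<Sum>j\<le>k. ?f j) = (\<Sum>j\<le>k. if j = 0 then N choose k else if j = ?q then N choose (k - ?q) else 0)] (mod p)"
    by (rule cong_sum) (rule z)
  also have "(\<Sum>j\<le>k. if j = 0 then N choose k else if j = ?q then N choose (k - ?q) else 0)
      = (\<Sum>j\<le>k. if j = 0 then N choose k else 0) + (\<Sum>j\<le>k. if j = ?q then N choose (k - ?q) else 0)"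
    unfolding sum.distrib[symmetric] using q by (intro sum.cong) auto
  also have "\<dots> = (N choose k) + (if ?q \<le> k then N choose (k - ?q) else 0)"
    by (simp add: sum.delta)
  finally show ?thesis .
qed

text \<open>The condition 0 \<le> N matters: \<open>cb\<close> is 0 for a negative upper entry, so
  that N = -1, r = 0, k = 0 would give 1 on the left and 0 on the right.\<close>

lemma cb_add_prime_power_cong:
  assumes "prime p" "0 \<le> N"
  shows "[cb (N + int (p ^ r)) k = cb N k + cb N (k - int (p ^ r))] (mod int p)"
proof (cases "k < 0")
  case True
  moreover have "k - int (p ^ r) < 0" using True by (smt (verit) of_nat_0_le_iff)
  ultimately show ?thesis by (simp add: cb_def)
next
  case False
  obtain n where n: "N = int n" using assms(2) nonneg_int_cases by blast
  obtain l where l: "k = int l" using False nonneg_int_cases[of k] by auto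
  have e1: "N + int (p ^ r) = int (n + p ^ r)" using n by simp
  have "cb (N + int (p ^ r)) k = int (n + p ^ r choose l)"
    unfolding e1 l cb_def by (simp only: nat_int of_nat_less_0_iff) simp
  moreover have "cb N k = int (n choose l)"
    unfolding n l cb_def by simp
  moreover have "cb N (k - int (p ^ r)) = int (if p ^ r \<le> l then n choose (l - p ^ r) else 0)"
  proof (cases "p ^ r \<le> l")
    case True
    then have e2: "k - int (p ^ r) = int (l - p ^ r)" using l by (simp only: of_nat_diff)
    show ?thesis unfolding e2 n cb_def
      by (simp only: nat_int of_nat_less_0_iff True if_True if_False simp_thms)
  next
    case False
    then have "k - int (p ^ r) < 0" using l by (simp only: of_nat_less_iff)
    then show ?thesis using False by (simp add: cb_def)
  qed
  ultimately show ?thesis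
    using choose_add_prime_power_cong[OF assms(1), of n r l]
    by (metis cong_int_iff of_nat_add)
qed

section \<open>The power series (1 - z)^(-s-1) and congruences between integer power series\<close>

definition geo :: "nat \<Rightarrow> int fps" where
  "geo s = Abs_fps (\<lambda>l. int (s + l choose l))"

lemma geo_Suc: "(1 - fps_X) * geo (Suc s) = geo s"
proof (rule fps_ext)
  fix l
  show "((1 - fps_X) * geo (Suc s)) $ l = geo s $ l"
    by (cases l) (simp_all add: geo_def left_diff_distrib fps_X_mult_nth)
qed

lemma geo_0: "(1 - fps_X) * geo 0 = 1"
  by (rule fps_ext) (simp add: geo_def left_diff_distrib fps_X_mult_nth)

lemma power_mult_geo: "(1 - fps_X) ^ Suc s * geo s = 1"
proof (induction s)
  case 0
  then show ?case by (simp add: geo_0)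
next
  case (Suc s)
  have "(1 - fps_X) ^ Suc (Suc s) * geo (Suc s) = (1 - fps_X) ^ Suc s * ((1 - fps_X) * geo (Suc s))"
    by (simp add: mult_ac)
  then show ?case using Suc by (simp only: geo_Suc)
qed

lemma geo_mult_power: "m \<le> s \<Longrightarrow> geo s * (1 - fps_X) ^ m = geo (s - m)"
proof (induction m)
  case (Suc m)
  then have "geo s * (1 - fps_X) ^ Suc m = (1 - fps_X) * geo (Suc (s - Suc m))"
    by (simp add: mult_ac Suc_diff_Suc)
  then show ?case by (simp only: geo_Suc)
qed simp

text \<open>The exponent of 1 - z is large enough to cancel the pole and leave a polynomial;
  \<open>geo_mult_power\<close> covers the range in which a pole remains.\<close>

lemma geo_mult_power': "geo s * (1 - fps_X) ^ (Suc s + m) = (1 - fps_X) ^ m"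
proof -
  have "geo s * (1 - fps_X) ^ (Suc s + m) = ((1 - fps_X) ^ Suc s * geo s) * (1 - fps_X) ^ m"
    unfolding power_add by (simp only: mult_ac)
  then show ?thesis by (simp only: power_mult_geo) simp
qed

lemma fps_one_minus_X_power_nth: "((1 - fps_X) ^ m :: int fps) $ k = (- 1) ^ k * int (m choose k)"
proof (induction m arbitrary: k)
  case 0
  then show ?case by (cases k) auto
next
  case (Suc m)
  show ?case
    by (cases k) (simp_all add: left_diff_distrib fps_X_mult_nth Suc algebra_simps)
qed

text \<open>Divisibility by the constant series p is congruence of all coefficients, in a form to
  which the divisibility rules of a ring apply directly.\<close>

definition cong_fps :: "nat \<Rightarrow> int fps \<Rightarrow> int fps \<Rightarrow> bool" where
  "cong_fps p f g \<longleftrightarrow> fps_const (int p) dvd f - g"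

lemma cong_fps_nth: "cong_fps p f g \<Longrightarrow> [f $ k = g $ k] (mod int p)"
  unfolding cong_fps_def cong_iff_dvd_diff
  by (metis dvd_def fps_mult_left_const_nth fps_sub_nth)

lemma cong_fps_mult: "cong_fps p f g \<Longrightarrow> cong_fps p (h * f) (h * g)"
  unfolding cong_fps_def by (metis dvd_mult right_diff_distrib)

lemma cong_fps_power: "cong_fps p f g \<Longrightarrow> cong_fps p (f ^ n) (g ^ n)"
proof (induction n)
  case (Suc n)
  have "f ^ Suc n - g ^ Suc n = f * (f ^ n - g ^ n) + (f - g) * g ^ n"
    by (simp add: algebra_simps)
  with Suc show ?case unfolding cong_fps_def by (metis dvd_add dvd_mult dvd_mult2)
qed (simp add: cong_fps_def)

text \<open>For odd p the numbers p t and t have the same parity; for p = 2 signs are invisible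
  modulo 2.\<close>

lemma minus_one_power_cong:
  assumes "prime p" "p * t \<le> a"
  shows "[(- 1) ^ (a - p * t) = (- 1 :: int) ^ (a + t)] (mod int p)"
proof (cases "p = 2")
  case True
  then show ?thesis
    by (cases "even a"; cases "even t") (use assms(2) in \<open>auto simp: cong_def minus_one_power_iff\<close>)
next
  case False
  then have "odd p" using assms(1) by (metis primes_dvd_imp_eq two_is_prime_nat)
  then have "even (a - p * t) \<longleftrightarrow> even (a + t)" using assms(2) by auto
  then show ?thesis by (simp add: minus_one_power_iff)
qed

text \<open>The two sides differ by (1 - z)^p + z^p - 1, which is zero modulo p by the Frobenius
  map.\<close>

lemma prime_one_minus_X_cong:
  assumes "prime p"
  shows "cong_fps p ((1 - fps_X) ^ (p - 1) + fps_X ^ p) (1 + fps_X * (1 - fps_X) ^ (p - 1))"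
proof -
  have p: "0 < p" using assms by (simp add: prime_gt_0_nat)
  have "((1 - fps_X) ^ (p - 1) + fps_X ^ p) - (1 + fps_X * (1 - fps_X) ^ (p - 1))
      = (1 - fps_X) ^ p + fps_X ^ p - (1 :: int fps)" (is "?d = _")
    using p by (cases p) (simp_all add: algebra_simps)
  moreover have "int p dvd ((1 - fps_X) ^ p + fps_X ^ p - (1 :: int fps)) $ k" for k
  proof -
    consider "k = 0" | "k = p" "k \<noteq> 0" | "0 < k" "k < p" | "p < k" by linarith
    then show ?thesis
    proof cases
      case 2
      \<comment> \<open>The coefficient of z^p is (-1)^p + 1, which is 0 for odd p and 2 for p =
        2.\<close>
      have "[(- 1) ^ p = (- 1 :: int)] (mod int p)"
        using minus_one_power_cong[OF assms, of 1 p]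
        by (cases "p = 2") (auto simp: cong_def minus_one_power_iff assms prime_odd_nat)
      then show ?thesis using 2
        by (simp add: fps_one_minus_X_power_nth cong_iff_dvd_diff)
    next
      case 3
      then have "p dvd (p choose k)" using assms prime_dvd_prime_power_choose[of p k 1] by simp
      then have "int p dvd int (p choose k)" by (simp only: of_nat_dvd_iff)
      then show ?thesis using 3
        by (simp add: fps_one_minus_X_power_nth)
    qed (use p in \<open>auto simp: fps_one_minus_X_power_nth binomial_eq_0\<close>)
  qed
  ultimately have k: "int p dvd ?d $ k" for k by (simp only:)
  have "?d = fps_const (int p) * Abs_fps (\<lambda>k. ?d $ k div int p)"
    by (rule fps_ext) (simp only: fps_mult_left_const_nth fps_nth_Abs_fps dvd_mult_div_cancel[OF k])
  then show ?thesis unfolding cong_fps_def by (metis dvd_triv_left)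
qed

text \<open>The factor l cancels from l C(pl, l) = p l C(pl - 1, l - 1).\<close>

lemma choose_prime_mult: "prime p \<Longrightarrow> 0 < l \<Longrightarrow> p dvd (p * l choose l)"
  using times_binomial_minus1_eq[of l "p * l"] by (metis dvd_triv_left mult.assoc mult.left_commute mult_cancel_left neq0_conv)

text \<open>Both sides are the coefficient of \<open>z^a\<close> in \<open>(1 - z)^(-(p-1)a-1) ((1 - z)^(p-1) + z^p)^(a+b)\<close>,
  expanded once as it stands and once after replacing \<open>(1 - z)^(p-1) + z^p\<close> by \<open>1 + z (1 - z)^(p-1)\<close>, to which it is
  congruent; in the second expansion only the term \<open>m = a\<close> survives modulo \<open>p\<close>.\<close>
theorem adem_binomial_nat:
  assumes p: "prime p" and ab: "a < p * b"
  shows "[int (a + b choose a) = (\<Sum>t\<in>{0..a div p}. (- 1) ^ (a + t) *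
      int ((p - 1) * (b - t) - 1 choose (a - p * t)) * int (a + b choose t))] (mod int p)"
proof -
  have p2: "2 \<le> p" using p by (simp add: prime_ge_2_nat)
  define n where "n = a + b"
  define Y :: "int fps" where "Y = 1 - fps_X"
  \<comment> \<open>The exponent is chosen for the second expansion: the coefficient of z^(a-m) in
    (1 - z)^(-(p-1)(a-m)-1) is C(p(a-m), a-m), which p divides for m < a.\<close>
  define Gs where "Gs = geo ((p - 1) * a)"
  have "cong_fps p (Gs * (Y ^ (p - 1) + fps_X ^ p) ^ n) (Gs * (1 + fps_X * Y ^ (p - 1)) ^ n)"
    unfolding Y_def by (intro cong_fps_mult cong_fps_power prime_one_minus_X_cong p)
  from cong_fps_nth[OF this, of a]
  have main: "[(Gs * (Y ^ (p - 1) + fps_X ^ p) ^ n) $ a = (Gs * (1 + fps_X * Y ^ (p - 1)) ^ n) $ a] (mod int p)" .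
  \<comment> \<open>Here a < p b enters: every t of the sum lies below b, so the subtraction in (p -
    1)(b - t) - 1 is not truncated.\<close>
  have tb: "t < b" if "t \<le> a div p" for t
  proof -
    have "p * t \<le> a" using that p2 by (metis le_trans mult_le_mono2 times_div_less_eq_dividend)
    then show ?thesis using ab p2 by (metis le_less_trans mult_less_cancel1)
  qed
  have "Gs * (Y ^ (p - 1) + fps_X ^ p) ^ n = (\<Sum>t\<le>n. of_nat (n choose t) * (fps_X ^ (p * t) * (Gs * Y ^ ((p - 1) * (n - t)))))"
    unfolding add.commute[of "Y ^ (p - 1)"] binomial_ring sum_distrib_left
    by (intro sum.cong refl) (simp add: power_mult[symmetric] mult_ac)
  then have "(Gs * (Y ^ (p - 1) + fps_X ^ p) ^ n) $ a
      = (\<Sum>t\<le>n. if p * t \<le> a then int (n choose t) * (Gs * Y ^ ((p - 1) * (n - t))) $ (a - p * t) else 0)"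
    by (auto simp: fps_sum_nth fps_mult_of_nat_nth fps_X_power_mult_nth intro!: sum.cong)
  also have "\<dots> = (\<Sum>t\<in>{0..a div p}. int (n choose t) * (Gs * Y ^ ((p - 1) * (n - t))) $ (a - p * t))"
  proof (rule sum.mono_neutral_cong_right)
    show "{0..a div p} \<subseteq> {..n}" using div_le_dividend[of a p] unfolding n_def by (auto intro: trans_le_add1)
    show "\<forall>t\<in>{..n} - {0..a div p}. (if p * t \<le> a then int (n choose t) * (Gs * Y ^ ((p - 1) * (n - t))) $ (a - p * t) else 0) = 0"
      using p2 by (auto simp: less_eq_div_iff_mult_less_eq mult.commute)
  qed (use p2 in \<open>auto simp: less_eq_div_iff_mult_less_eq mult.commute\<close>)
  also have "\<dots> = (\<Sum>t\<in>{0..a div p}. int (n choose t) * ((- 1) ^ (a - p * t) * int ((p - 1) * (b - t) - 1 choose (a - p * t))))"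
  proof (intro sum.cong refl)
    fix t assume "t \<in> {0..a div p}"
    then have "t < b" using tb by simp
    then have "n - t = a + (b - t)" unfolding n_def by simp
    then have "(p - 1) * (n - t) = (p - 1) * a + (p - 1) * (b - t)"
      by (simp only: add_mult_distrib2)
    \<comment> \<open>Since n = a + b, the pole of \<open>Gs\<close> uses up (p - 1) a + 1 of the
      exponent and (p - 1)(b - t) - 1 is left.\<close>
    also have "\<dots> = Suc ((p - 1) * a) + ((p - 1) * (b - t) - 1)"
      using \<open>t < b\<close> p2 by (cases "(p - 1) * (b - t)") auto
    finally have e: "(p - 1) * (n - t) = \<dots>" .
    show "int (n choose t) * (Gs * Y ^ ((p - 1) * (n - t))) $ (a - p * t)
      = int (n choose t) * ((- 1) ^ (a - p * t) * int ((p - 1) * (b - t) - 1 choose (a - p * t)))"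
      unfolding e Gs_def Y_def geo_mult_power' fps_one_minus_X_power_nth ..
  qed
  finally have l1: "(Gs * (Y ^ (p - 1) + fps_X ^ p) ^ n) $ a = \<dots>" .
  have l2: "[(\<Sum>t\<in>{0..a div p}. int (n choose t) * ((- 1) ^ (a - p * t) * int ((p - 1) * (b - t) - 1 choose (a - p * t))))
     = (\<Sum>t\<in>{0..a div p}. int (n choose t) * ((- 1) ^ (a + t) * int ((p - 1) * (b - t) - 1 choose (a - p * t))))] (mod int p)"
    using p2 by (intro cong_sum cong_mult cong_refl minus_one_power_cong[OF p])
      (auto simp: less_eq_div_iff_mult_less_eq mult.commute)
  have "Gs * (1 + fps_X * Y ^ (p - 1)) ^ n = (\<Sum>m\<le>n. of_nat (n choose m) * (fps_X ^ m * (Gs * Y ^ ((p - 1) * m))))"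
    unfolding add.commute[of "1 :: int fps"] binomial_ring sum_distrib_left
    by (intro sum.cong refl) (simp add: power_mult[symmetric] power_mult_distrib mult_ac)
  then have "(Gs * (1 + fps_X * Y ^ (p - 1)) ^ n) $ a
      = (\<Sum>m\<le>n. if m \<le> a then int (n choose m) * (Gs * Y ^ ((p - 1) * m)) $ (a - m) else 0)"
    by (auto simp: fps_sum_nth fps_mult_of_nat_nth fps_X_power_mult_nth intro!: sum.cong)
  also have "\<dots> = (\<Sum>m\<le>n. if m \<le> a then int (n choose m) * int (p * (a - m) choose (a - m)) else 0)"
  proof (intro sum.cong refl if_cong)
    fix m assume m: "m \<le> a"
    then have "(p - 1) * m \<le> (p - 1) * a" by simp
    then have "Gs * Y ^ ((p - 1) * m) = geo ((p - 1) * (a - m))"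
      unfolding Gs_def Y_def by (simp add: geo_mult_power diff_mult_distrib2)
    moreover have "(p - 1) * (a - m) + (a - m) = p * (a - m)"
      using p2 by (metis Suc_diff_1 add.commute mult_Suc not_numeral_le_zero zero_less_iff_neq_zero)
    ultimately show "int (n choose m) * (Gs * Y ^ ((p - 1) * m)) $ (a - m) = int (n choose m) * int (p * (a - m) choose (a - m))"
      by (simp add: geo_def)
  qed
  finally have r1: "(Gs * (1 + fps_X * Y ^ (p - 1)) ^ n) $ a = \<dots>" .
  have r2: "[(\<Sum>m\<le>n. if m \<le> a then int (n choose m) * int (p * (a - m) choose (a - m)) else 0)
      = (\<Sum>m\<le>n. if m = a then int (n choose m) else 0)] (mod int p)"
  proof (rule cong_sum)
    fix m
    show "[(if m \<le> a then int (n choose m) * int (p * (a - m) choose (a - m)) else 0)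
      = (if m = a then int (n choose m) else 0)] (mod int p)"
    proof (cases "m < a")
      case True
      then have "int p dvd int (p * (a - m) choose (a - m))"
        unfolding of_nat_dvd_iff using choose_prime_mult[OF p, of "a - m"] by simp
      then show ?thesis using True by (simp add: cong_0_iff)
    qed auto
  qed
  have "(\<Sum>m\<le>n. if m = a then int (n choose m) else 0) = int (n choose a)"
    by (simp add: n_def)
  with main l1 l2 r1 r2 show ?thesis
    unfolding n_def by (smt (verit, best) cong_sym cong_trans mult.commute mult.assoc sum.cong)
qed

section \<open>The operations on functionals\<close>

text \<open>A list of naturals is a basis vector of a tensor power of the module with basis
  \<open>x, y, y^p, \<dots>\<close>: the entry \<open>0\<close> stands for the exterior class \<open>x\<close> and \<open>Suc k\<close> for \<open>y^(p^k)\<close>.  The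
  operations below are the transposes, acting on functionals, so that no finite support has to be
  tracked; as a consequence the leftmost letter of a word acts first.  The exponent of \<open>opP\<close> is an
  integer because it becomes negative in the recursion; then the operation is zero.\<close>
fun opP :: "nat \<Rightarrow> int \<Rightarrow> (nat list \<Rightarrow> int) \<Rightarrow> nat list \<Rightarrow> int" where
  "opP p a \<phi> [] = (if a = 0 then \<phi> [] else 0)"
| "opP p a \<phi> (0 # t) = opP p a (\<lambda>u. \<phi> (0 # u)) t"
| "opP p a \<phi> (Suc h # t) = opP p a (\<lambda>u. \<phi> (Suc h # u)) t
     + opP p (a - int (p ^ h)) (\<lambda>u. \<phi> (Suc (Suc h) # u)) t"

text \<open>The transpose of the derivation with \<beta> x = y and \<beta> y^(p^h) = 0; the entry 1
  is y, and the minus sign comes from moving \<beta> past an odd class.\<close>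

fun opB :: "(nat list \<Rightarrow> int) \<Rightarrow> nat list \<Rightarrow> int" where
  "opB \<phi> [] = 0"
| "opB \<phi> (0 # t) = \<phi> (1 # t) - opB (\<lambda>u. \<phi> (0 # u)) t"
| "opB \<phi> (Suc h # t) = opB (\<lambda>u. \<phi> (Suc h # u)) t"

text \<open>Isolated so that sums, differences and divisibility are treated once for
  \<open>opP\<close>, \<open>opB\<close> and \<open>act\<close>.\<close>

definition lin_op :: "((nat list \<Rightarrow> int) \<Rightarrow> nat list \<Rightarrow> int) \<Rightarrow> bool" where
  "lin_op F \<longleftrightarrow> (\<forall>\<phi> \<psi> f. F (\<lambda>u. \<phi> u + \<psi> u) f = F \<phi> f + F \<psi> f) \<and>
     (\<forall>c \<phi> f. F (\<lambda>u. c * \<phi> u) f = c * F \<phi> f)"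

lemma lin_op_add: "lin_op F \<Longrightarrow> F (\<lambda>u. \<phi> u + \<psi> u) f = F \<phi> f + F \<psi> f"
  by (simp add: lin_op_def)

lemma lin_op_scale: "lin_op F \<Longrightarrow> F (\<lambda>u. c * \<phi> u) f = c * F \<phi> f"
  by (simp add: lin_op_def)

lemma lin_op_zero: "lin_op F \<Longrightarrow> F (\<lambda>u. 0) f = 0"
  using lin_op_scale[of F 0 "\<lambda>_. 0" f] by simp

lemma lin_op_diff: "lin_op F \<Longrightarrow> F (\<lambda>u. \<phi> u - \<psi> u) f = F \<phi> f - F \<psi> f"
  using lin_op_add[of F \<phi> "\<lambda>u. - 1 * \<psi> u" f] lin_op_scale[of F "- 1" \<psi> f] by simp

lemma lin_op_sum:
  assumes "lin_op F" "finite A"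
  shows "F (\<lambda>u. \<Sum>i\<in>A. c i * \<phi> i u) f = (\<Sum>i\<in>A. c i * F (\<phi> i) f)"
  using assms(2)
proof (induction A)
  case (insert x A)
  then show ?case
    using lin_op_add[OF assms(1), of "\<lambda>u. c x * \<phi> x u" "\<lambda>u. \<Sum>i\<in>A. c i * \<phi> i u" f]
    by (simp add: lin_op_scale[OF assms(1)])
qed (simp add: lin_op_zero assms(1))

lemma lin_op_dvd:
  assumes "lin_op F" "\<And>u. m dvd \<phi> u"
  shows "m dvd F \<phi> f"
  using lin_op_scale[OF assms(1), of m "\<lambda>u. \<phi> u div m" f] assms(2) by simp

lemma opP_add: "opP p a (\<lambda>u. \<phi> u + \<psi> u) = (\<lambda>f. opP p a \<phi> f + opP p a \<psi> f)"
proof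
  show "opP p a (\<lambda>u. \<phi> u + \<psi> u) f = opP p a \<phi> f + opP p a \<psi> f" for f
    by (induction p a \<phi> f arbitrary: \<psi> rule: opP.induct) simp_all
qed

lemma opP_scale: "opP p a (\<lambda>u. c * \<phi> u) = (\<lambda>f. c * opP p a \<phi> f)"
proof
  show "opP p a (\<lambda>u. c * \<phi> u) f = c * opP p a \<phi> f" for f
    by (induction p a \<phi> f rule: opP.induct) (simp_all add: distrib_left)
qed

lemma opB_add: "opB (\<lambda>u. \<phi> u + \<psi> u) = (\<lambda>f. opB \<phi> f + opB \<psi> f)"
proof
  show "opB (\<lambda>u. \<phi> u + \<psi> u) f = opB \<phi> f + opB \<psi> f" for f
    by (induction \<phi> f arbitrary: \<psi> rule: opB.induct) simp_all
qed

lemma opB_scale: "opB (\<lambda>u. c * \<phi> u) = (\<lambda>f. c * opB \<phi> f)"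
proof
  show "opB (\<lambda>u. c * \<phi> u) f = c * opB \<phi> f" for f
    by (induction \<phi> f rule: opB.induct) (simp_all add: right_diff_distrib)
qed

lemma lin_op_opP: "lin_op (opP p a)"
  by (simp add: lin_op_def opP_add opP_scale)

lemma lin_op_opB: "lin_op opB"
  by (simp add: lin_op_def opB_add opB_scale)

lemma opP_diff: "opP p a (\<lambda>u. \<phi> u - \<psi> u) = (\<lambda>f. opP p a \<phi> f - opP p a \<psi> f)"
  by (rule ext) (rule lin_op_diff[OF lin_op_opP])

lemma opB_diff: "opB (\<lambda>u. \<phi> u - \<psi> u) = (\<lambda>f. opB \<phi> f - opB \<psi> f)"
  by (rule ext) (rule lin_op_diff[OF lin_op_opB])

lemma opP_negative: "a < 0 \<Longrightarrow> opP p a \<phi> f = 0"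
proof (induction p a \<phi> f rule: opP.induct)
  case (3 p a \<phi> h t)
  have "a - int (p ^ h) < 0" using 3(3) of_nat_0_le_iff[of "p ^ h"] by linarith
  with 3 show ?case by simp
qed simp_all

lemma opP_zero:
  assumes "0 < p"
  shows "opP p 0 \<phi> f = \<phi> f"
proof (induction f arbitrary: \<phi>)
  case (Cons h t)
  have "opP p (0 - int (p ^ k)) \<psi> t = 0" for k \<psi>
    by (rule opP_negative) (use assms in simp)
  with Cons show ?case by (cases h) simp_all
qed simp

text \<open>A single entry cannot be hit twice, and the sign in \<open>opB\<close> cancels the two
  orders in which two exterior entries can be hit.\<close>

lemma opB_opB: "opB (opB \<phi>) f = 0"
  by (induction \<phi> f rule: opB.induct) (simp_all add: opB_diff)

text \<open>For p = 2 the letter \<open>B\<close> is read as Sq^1, as the relation between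
  \<open>B\<close> and \<open>P 1\<close> demands.\<close>

fun act :: "nat \<Rightarrow> gen list \<Rightarrow> (nat list \<Rightarrow> int) \<Rightarrow> nat list \<Rightarrow> int" where
  "act p [] \<phi> = \<phi>"
| "act p (P a # w) \<phi> = act p w (opP p (int a) \<phi>)"
| "act p (B # w) \<phi> = act p w (if p = 2 then opP p 1 \<phi> else opB \<phi>)"

lemma act_append: "act p (u @ v) \<phi> = act p v (act p u \<phi>)"
  by (induction p u \<phi> rule: act.induct) auto

lemma lin_op_act: "lin_op (act p w)"
proof -
  have "act p w (\<lambda>u. \<phi> u + \<psi> u) f = act p w \<phi> f + act p w \<psi> f" for \<phi> \<psi> f
    by (cases "p = 2"; induction p w \<phi> arbitrary: \<psi> rule: act.induct) (simp_all add: opP_add opB_add)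
  moreover have "act p w (\<lambda>u. c * \<phi> u) f = c * act p w \<phi> f" for c \<phi> f
    by (cases "p = 2"; induction p w \<phi> rule: act.induct) (simp_all add: opP_scale opB_scale)
  ultimately show ?thesis by (simp add: lin_op_def)
qed

text \<open>\<open>opT p c\<close> is the sum over \<open>N\<close> and \<open>Q\<close> of \<open>c N Q\<close> times the Milnor basis element \<open>P(N, Q)\<close>, which
  raises a set of entries of total weight \<open>N\<close> by one and a disjoint set of total weight \<open>Q\<close> by two.
  In \<open>opTB\<close> additionally one exterior entry becomes \<open>1\<close> (coefficients \<open>c\<close>) or \<open>2\<close> (coefficients \<open>d\<close>).\<close>
fun opT :: "nat \<Rightarrow> (int \<Rightarrow> int \<Rightarrow> int) \<Rightarrow> (nat list \<Rightarrow> int) \<Rightarrow> nat list \<Rightarrow> int" where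
  "opT p c \<phi> [] = c 0 0 * \<phi> []"
| "opT p c \<phi> (0 # t) = opT p c (\<lambda>u. \<phi> (0 # u)) t"
| "opT p c \<phi> (Suc h # t) = opT p c (\<lambda>u. \<phi> (Suc h # u)) t
     + opT p (\<lambda>N Q. c (N + int (p ^ h)) Q) (\<lambda>u. \<phi> (Suc (Suc h) # u)) t
     + opT p (\<lambda>N Q. c N (Q + int (p ^ h))) (\<lambda>u. \<phi> (Suc (Suc (Suc h)) # u)) t"

fun opTB :: "nat \<Rightarrow> (int \<Rightarrow> int \<Rightarrow> int) \<Rightarrow> (int \<Rightarrow> int \<Rightarrow> int) \<Rightarrow> (nat list \<Rightarrow> int) \<Rightarrow> nat list \<Rightarrow> int" where
  "opTB p c d \<phi> [] = 0"
| "opTB p c d \<phi> (0 # t) = opT p c (\<lambda>u. \<phi> (1 # u)) t + opT p d (\<lambda>u. \<phi> (2 # u)) t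
     - opTB p c d (\<lambda>u. \<phi> (0 # u)) t"
| "opTB p c d \<phi> (Suc h # t) = opTB p c d (\<lambda>u. \<phi> (Suc h # u)) t
     + opTB p (\<lambda>N Q. c (N + int (p ^ h)) Q) (\<lambda>N Q. d (N + int (p ^ h)) Q) (\<lambda>u. \<phi> (Suc (Suc h) # u)) t
     + opTB p (\<lambda>N Q. c N (Q + int (p ^ h))) (\<lambda>N Q. d N (Q + int (p ^ h))) (\<lambda>u. \<phi> (Suc (Suc (Suc h)) # u)) t"

text \<open>The recursion evaluates the coefficients only at sums of powers of p, hence at
  nonnegative arguments. This is why binomial congruences with nonnegative upper entry
  suffice.\<close>

lemma opT_cong:
  assumes "\<And>N Q. 0 \<le> N \<Longrightarrow> 0 \<le> Q \<Longrightarrow> [c N Q = d N Q] (mod m)"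
  shows "[opT p c \<phi> f = opT p d \<phi> f] (mod m)"
  using assms
proof (induction p c \<phi> f arbitrary: d rule: opT.induct)
  case (1 p c \<phi>)
  then show ?case by (simp add: cong_mult)
next
  case (3 p c \<phi> h t)
  show ?case unfolding opT.simps
    by (intro cong_add 3) (use 3(4) in auto)
qed simp

lemma opTB_cong:
  assumes "\<And>N Q. 0 \<le> N \<Longrightarrow> 0 \<le> Q \<Longrightarrow> [c N Q = c' N Q] (mod m)"
    and "\<And>N Q. 0 \<le> N \<Longrightarrow> 0 \<le> Q \<Longrightarrow> [d N Q = d' N Q] (mod m)"
  shows "[opTB p c d \<phi> f = opTB p c' d' \<phi> f] (mod m)"
  using assms
proof (induction p c d \<phi> f arbitrary: c' d' rule: opTB.induct)
  case (2 p c d \<phi> t)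
  show ?case unfolding opTB.simps
    by (intro cong_add cong_diff 2 opT_cong) (use 2(2,3) in auto)
next
  case (3 p c d \<phi> h t)
  show ?case unfolding opTB.simps
    by (intro cong_add 3) (use 3(4,5) in auto)
qed simp

lemma opT_add: "opT p (\<lambda>N Q. c N Q + d N Q) \<phi> f = opT p c \<phi> f + opT p d \<phi> f"
  by (induction p c \<phi> f arbitrary: d rule: opT.induct) (simp_all add: distrib_right)

lemma opT_scale: "opT p (\<lambda>N Q. k * c N Q) \<phi> f = k * opT p c \<phi> f"
  by (induction p c \<phi> f rule: opT.induct) (auto simp: algebra_simps)

lemma opTB_add: "opTB p (\<lambda>N Q. c N Q + c' N Q) (\<lambda>N Q. d N Q + d' N Q) \<phi> f
    = opTB p c d \<phi> f + opTB p c' d' \<phi> f"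
  by (induction p c d \<phi> f arbitrary: c' d' rule: opTB.induct) (simp_all add: opT_add)

lemma opTB_scale: "opTB p (\<lambda>N Q. k * c N Q) (\<lambda>N Q. k * d N Q) \<phi> f = k * opTB p c d \<phi> f"
  by (induction p c d \<phi> f rule: opTB.induct) (auto simp: opT_scale algebra_simps)

lemma opT_sum:
  assumes "finite A"
  shows "opT p (\<lambda>N Q. \<Sum>i\<in>A. k i * c i N Q) \<phi> f = (\<Sum>i\<in>A. k i * opT p (c i) \<phi> f)"
  using assms
proof (induction A)
  case empty
  show ?case using opT_scale[of p 0 "\<lambda>_ _. 0"] by simp
qed (simp add: opT_add opT_scale)

lemma opTB_sum:
  assumes "finite A"
  shows "opTB p (\<lambda>N Q. \<Sum>i\<in>A. k i * c i N Q) (\<lambda>N Q. \<Sum>i\<in>A. k i * d i N Q) \<phi> f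
     = (\<Sum>i\<in>A. k i * opTB p (c i) (d i) \<phi> f)"
  using assms
proof (induction A)
  case empty
  show ?case using opTB_scale[of p 0 "\<lambda>_ _. 0" "\<lambda>_ _. 0"] by simp
qed (simp add: opTB_add opTB_scale)

text \<open>Milnor's product formula: P^a P^b is the sum over Q of C(N, a - p Q) P(N, Q) with N = a
  + b - (p + 1) Q. The arguments are integers because a and b may become negative in the
  recursion.\<close>

definition milnor_coeff :: "nat \<Rightarrow> int \<Rightarrow> int \<Rightarrow> int \<Rightarrow> int \<Rightarrow> int" where
  "milnor_coeff p a b N Q = (if N + (int p + 1) * Q = a + b then cb N (a - int p * Q) else 0)"

text \<open>An entry of weight p^h that is raised once is raised by one of the two factors, which
  takes p^h from b or from a.\<close>

lemma milnor_coeff_shift_N: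
  assumes "prime p" "0 \<le> N"
  shows "[milnor_coeff p a (b - int (p ^ h)) N Q + milnor_coeff p (a - int (p ^ h)) b N Q = milnor_coeff p a b (N + int (p ^ h)) Q] (mod int p)"
  using cong_sym[OF cb_add_prime_power_cong[OF assms, of h "a - int p * Q"]]
  by (simp add: milnor_coeff_def algebra_simps)

text \<open>An entry raised twice goes from y^(p^h) to y^(p^(h+1)) by P^b and one level further by
  P^a, which takes p^h from b and p^(h+1) from a.\<close>

lemma milnor_coeff_shift_Q: "milnor_coeff p (a - int (p ^ Suc h)) (b - int (p ^ h)) = (\<lambda>N Q. milnor_coeff p a b N (Q + int (p ^ h)))"
  by (intro ext) (simp add: milnor_coeff_def algebra_simps)

lemma milnor_coeff_shift_Q': "milnor_coeff p (a - int (p ^ Suc h) - 1) (b - int (p ^ h)) = (\<lambda>N Q. milnor_coeff p (a - 1) b N (Q + int (p ^ h)))"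
  using milnor_coeff_shift_Q[of p "a - 1" h b] cancel_ab_semigroup_add_class.diff_right_commute[of a 1] by simp

lemma milnor_coeff_shift_N':
  assumes "prime p" "0 \<le> N"
  shows "[milnor_coeff p (a - 1) (b - int (p ^ h)) N Q + milnor_coeff p (a - int (p ^ h) - 1) b N Q = milnor_coeff p (a - 1) b (N + int (p ^ h)) Q] (mod int p)"
  using milnor_coeff_shift_N[OF assms, of "a - 1" b h] cancel_ab_semigroup_add_class.diff_right_commute[of a 1] by simp

text \<open>By the Cartan formula each entry is treated separately; of the four ways in which the
  two operations can act on it, the two that raise it once are merged by
  \<open>milnor_coeff_shift_N\<close>. On functionals the operator of P^a is the inner one.\<close>

lemma opP_opP:
  assumes "prime p"
  shows "[opP p b (opP p a \<phi>) f = opT p (milnor_coeff p a b) \<phi> f] (mod int p)"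
proof (induction f arbitrary: a b \<phi>)
  case Nil
  show ?case
  proof (cases "a = 0")
    case False
    then have "cb 0 a = 0" by (simp add: cb_def)
    then show ?thesis using False by (simp add: milnor_coeff_def)
  qed (simp add: milnor_coeff_def cb_def)
next
  case (Cons x t)
  show ?case
  proof (cases x)
    case 0
    show ?thesis unfolding 0 opP.simps opT.simps by (rule Cons)
  next
    case (Suc h)
    let ?q = "int (p ^ h)"
    let ?\<phi>1 = "\<lambda>u. \<phi> (Suc h # u)" and ?\<phi>2 = "\<lambda>u. \<phi> (Suc (Suc h) # u)" and ?\<phi>3 = "\<lambda>u. \<phi> (Suc (Suc (Suc h)) # u)"
    have e: "opP p b (opP p a \<phi>) (x # t) = opP p b (opP p a ?\<phi>1) t
        + (opP p (b - ?q) (opP p a ?\<phi>2) t + opP p b (opP p (a - ?q) ?\<phi>2) t)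
        + opP p (b - ?q) (opP p (a - int (p ^ Suc h)) ?\<phi>3) t"
      unfolding Suc by (simp add: opP_add opB_add)
    have c1: "[(opP p b (opP p a ?\<phi>1) t
        + (opP p (b - ?q) (opP p a ?\<phi>2) t + opP p b (opP p (a - ?q) ?\<phi>2) t)
        + opP p (b - ?q) (opP p (a - int (p ^ Suc h)) ?\<phi>3) t) = opT p (milnor_coeff p a b) ?\<phi>1 t + (opT p (milnor_coeff p a (b - ?q)) ?\<phi>2 t + opT p (milnor_coeff p (a - ?q) b) ?\<phi>2 t)
        + opT p (milnor_coeff p (a - int (p ^ Suc h)) (b - ?q)) ?\<phi>3 t] (mod int p)"
      by (rule cong_add[OF cong_add[OF Cons cong_add[OF Cons Cons]] Cons])
    have c2: "[opT p (milnor_coeff p a b) ?\<phi>1 t + (opT p (milnor_coeff p a (b - ?q)) ?\<phi>2 t + opT p (milnor_coeff p (a - ?q) b) ?\<phi>2 t)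
        + opT p (milnor_coeff p (a - int (p ^ Suc h)) (b - ?q)) ?\<phi>3 t
      = opT p (milnor_coeff p a b) ?\<phi>1 t + opT p (\<lambda>N Q. milnor_coeff p a b (N + ?q) Q) ?\<phi>2 t
        + opT p (\<lambda>N Q. milnor_coeff p a b N (Q + ?q)) ?\<phi>3 t] (mod int p)"
      unfolding opT_add[symmetric] milnor_coeff_shift_Q
      by (rule cong_add[OF cong_add[OF cong_refl opT_cong] cong_refl]) (rule milnor_coeff_shift_N[OF assms])
    show ?thesis unfolding e unfolding Suc opT.simps by (rule cong_trans[OF c1 c2])
  qed
qed

text \<open>Between P^b and P^a an exterior entry becomes y. After that P^a leaves it alone or
  raises it to y^p at the cost of 1, whence a - 1 in the second coefficient.\<close>

lemma opP_opB_opP: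
  assumes "prime p"
  shows "[opP p b (opB (opP p a \<phi>)) f = opTB p (milnor_coeff p a b) (milnor_coeff p (a - 1) b) \<phi> f] (mod int p)"
proof (induction f arbitrary: a b \<phi>)
  case Nil
  then show ?case by simp
next
  case (Cons x t)
  show ?case
  proof (cases x)
    case 0
    have e: "opP p b (opB (opP p a \<phi>)) (x # t) = opP p b (opP p a (\<lambda>u. \<phi> (1 # u))) t
        + opP p b (opP p (a - 1) (\<lambda>u. \<phi> (2 # u))) t - opP p b (opB (opP p a (\<lambda>u. \<phi> (0 # u)))) t"
      unfolding 0 by (simp add: opP_add opB_add opP_diff numeral_2_eq_2)
    have c1: "[(opP p b (opP p a (\<lambda>u. \<phi> (1 # u))) t
        + opP p b (opP p (a - 1) (\<lambda>u. \<phi> (2 # u))) t - opP p b (opB (opP p a (\<lambda>u. \<phi> (0 # u)))) t) = opT p (milnor_coeff p a b) (\<lambda>u. \<phi> (1 # u)) t + opT p (milnor_coeff p (a - 1) b) (\<lambda>u. \<phi> (2 # u)) t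
        - opTB p (milnor_coeff p a b) (milnor_coeff p (a - 1) b) (\<lambda>u. \<phi> (0 # u)) t] (mod int p)"
      by (rule cong_diff[OF cong_add[OF opP_opP[OF assms] opP_opP[OF assms]] Cons])
    show ?thesis unfolding e unfolding 0 opTB.simps by (rule c1)
  next
    case (Suc h)
    let ?q = "int (p ^ h)"
    let ?\<phi>1 = "\<lambda>u. \<phi> (Suc h # u)" and ?\<phi>2 = "\<lambda>u. \<phi> (Suc (Suc h) # u)" and ?\<phi>3 = "\<lambda>u. \<phi> (Suc (Suc (Suc h)) # u)"
    let ?T = "\<lambda>a b. opTB p (milnor_coeff p a b) (milnor_coeff p (a - 1) b)"
    have e: "opP p b (opB (opP p a \<phi>)) (x # t) = opP p b (opB (opP p a ?\<phi>1)) t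
        + (opP p (b - ?q) (opB (opP p a ?\<phi>2)) t + opP p b (opB (opP p (a - ?q) ?\<phi>2)) t)
        + opP p (b - ?q) (opB (opP p (a - int (p ^ Suc h)) ?\<phi>3)) t"
      unfolding Suc by (simp add: opP_add opB_add)
    have c1: "[(opP p b (opB (opP p a ?\<phi>1)) t
        + (opP p (b - ?q) (opB (opP p a ?\<phi>2)) t + opP p b (opB (opP p (a - ?q) ?\<phi>2)) t)
        + opP p (b - ?q) (opB (opP p (a - int (p ^ Suc h)) ?\<phi>3)) t) = ?T a b ?\<phi>1 t + (?T a (b - ?q) ?\<phi>2 t + ?T (a - ?q) b ?\<phi>2 t)
        + ?T (a - int (p ^ Suc h)) (b - ?q) ?\<phi>3 t] (mod int p)"
      by (rule cong_add[OF cong_add[OF Cons cong_add[OF Cons Cons]] Cons])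
    have c2: "[?T a b ?\<phi>1 t + (?T a (b - ?q) ?\<phi>2 t + ?T (a - ?q) b ?\<phi>2 t)
        + ?T (a - int (p ^ Suc h)) (b - ?q) ?\<phi>3 t
      = ?T a b ?\<phi>1 t + opTB p (\<lambda>N Q. milnor_coeff p a b (N + ?q) Q) (\<lambda>N Q. milnor_coeff p (a - 1) b (N + ?q) Q) ?\<phi>2 t
        + opTB p (\<lambda>N Q. milnor_coeff p a b N (Q + ?q)) (\<lambda>N Q. milnor_coeff p (a - 1) b N (Q + ?q)) ?\<phi>3 t] (mod int p)"
      unfolding opTB_add[symmetric] milnor_coeff_shift_Q milnor_coeff_shift_Q'
      by (rule cong_add[OF cong_add[OF cong_refl opTB_cong] cong_refl])
        (rule milnor_coeff_shift_N[OF assms] milnor_coeff_shift_N'[OF assms], assumption)+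
    show ?thesis unfolding e unfolding Suc opTB.simps by (rule cong_trans[OF c1 c2])
  qed
qed

text \<open>On vectors \<beta> comes last, so the new y meets no reduced power and the second
  coefficient is 0.\<close>

lemma opP_opP_opB:
  assumes "prime p"
  shows "[opP p b (opP p a (opB \<phi>)) f = opTB p (milnor_coeff p a b) (\<lambda>N Q. 0) \<phi> f] (mod int p)"
proof (induction f arbitrary: a b \<phi>)
  case Nil
  then show ?case by simp
next
  case (Cons x t)
  show ?case
  proof (cases x)
    case 0
    have z: "opT p (\<lambda>N Q. 0) (\<lambda>u. \<phi> (2 # u)) t = 0"
      using opT_scale[of p 0 "\<lambda>_ _. 0"] by simp
    have e: "opP p b (opP p a (opB \<phi>)) (x # t) = opP p b (opP p a (\<lambda>u. \<phi> (1 # u))) t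
        - opP p b (opP p a (opB (\<lambda>u. \<phi> (0 # u)))) t"
      unfolding 0 by (simp add: opP_diff)
    have c1: "[(opP p b (opP p a (\<lambda>u. \<phi> (1 # u))) t
        - opP p b (opP p a (opB (\<lambda>u. \<phi> (0 # u)))) t) = opT p (milnor_coeff p a b) (\<lambda>u. \<phi> (1 # u)) t
        - opTB p (milnor_coeff p a b) (\<lambda>N Q. 0) (\<lambda>u. \<phi> (0 # u)) t] (mod int p)"
      by (rule cong_diff[OF opP_opP[OF assms] Cons])
    show ?thesis unfolding e unfolding 0 opTB.simps z add_0_right by (rule c1)
  next
    case (Suc h)
    let ?q = "int (p ^ h)"
    let ?\<phi>1 = "\<lambda>u. \<phi> (Suc h # u)" and ?\<phi>2 = "\<lambda>u. \<phi> (Suc (Suc h) # u)" and ?\<phi>3 = "\<lambda>u. \<phi> (Suc (Suc (Suc h)) # u)"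
    let ?T = "\<lambda>a b. opTB p (milnor_coeff p a b) (\<lambda>N Q. 0)"
    have e: "opP p b (opP p a (opB \<phi>)) (x # t) = opP p b (opP p a (opB ?\<phi>1)) t
        + (opP p (b - ?q) (opP p a (opB ?\<phi>2)) t + opP p b (opP p (a - ?q) (opB ?\<phi>2)) t)
        + opP p (b - ?q) (opP p (a - int (p ^ Suc h)) (opB ?\<phi>3)) t"
      unfolding Suc by (simp add: opP_add opB_add)
    have c1: "[(opP p b (opP p a (opB ?\<phi>1)) t
        + (opP p (b - ?q) (opP p a (opB ?\<phi>2)) t + opP p b (opP p (a - ?q) (opB ?\<phi>2)) t)
        + opP p (b - ?q) (opP p (a - int (p ^ Suc h)) (opB ?\<phi>3)) t) = ?T a b ?\<phi>1 t + (?T a (b - ?q) ?\<phi>2 t + ?T (a - ?q) b ?\<phi>2 t)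
        + ?T (a - int (p ^ Suc h)) (b - ?q) ?\<phi>3 t] (mod int p)"
      by (rule cong_add[OF cong_add[OF Cons cong_add[OF Cons Cons]] Cons])
    have c2: "[?T a b ?\<phi>1 t + (?T a (b - ?q) ?\<phi>2 t + ?T (a - ?q) b ?\<phi>2 t)
        + ?T (a - int (p ^ Suc h)) (b - ?q) ?\<phi>3 t
      = ?T a b ?\<phi>1 t + opTB p (\<lambda>N Q. milnor_coeff p a b (N + ?q) Q) (\<lambda>N Q. 0) ?\<phi>2 t
        + opTB p (\<lambda>N Q. milnor_coeff p a b N (Q + ?q)) (\<lambda>N Q. 0) ?\<phi>3 t] (mod int p)"
      unfolding opTB_add[symmetric] milnor_coeff_shift_Q
      by (rule cong_add[OF cong_add[OF cong_refl opTB_cong] cong_refl]) (simp_all only: milnor_coeff_shift_N[OF assms] cong_refl add_0)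
    show ?thesis unfolding e unfolding Suc opTB.simps by (rule cong_trans[OF c1 c2])
  qed
qed

section \<open>Adem relations between the Milnor coefficients\<close>

lemma sign_shift_cong:
  assumes "prime p"
  shows "[(- 1) ^ (m + (p + 1) * k) = (- 1 :: int) ^ m] (mod int p)"
proof (cases "p = 2")
  case True
  then show ?thesis by (cases "even m"; cases "even k") (auto simp: cong_def)
next
  case False
  then have "odd p" using assms by (metis primes_dvd_imp_eq two_is_prime_nat)
  then show ?thesis by (simp add: power_add minus_one_power_iff)
qed

lemma cb_of_nat: "cb (int n) (int k) = int (n choose k)"
  by (simp add: cb_def)

lemma cb_Pascal: "0 < n \<Longrightarrow> cb n k = cb (n - 1) k + cb (n - 1) (k - 1)"
proof (cases "k < 0")
  case False
  assume "0 < n"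
  obtain m where m: "n = int (Suc m)" using \<open>0 < n\<close> by (metis gr0_conv_Suc zero_less_imp_eq_int)
  show ?thesis
  proof (cases "k = 0")
    case True
    then show ?thesis unfolding m by (simp add: cb_def)
  next
    case False
    then obtain l where l: "k = int (Suc l)" using \<open>\<not> k < 0\<close> by (metis linorder_neqE_linordered_idom gr0_conv_Suc zero_less_imp_eq_int)
    have e: "n - 1 = int m" "k - 1 = int l" using m l by auto
    show ?thesis unfolding e unfolding m l cb_of_nat by simp
  qed
qed (simp add: cb_def)

lemma cb_eq_0: "n < k \<Longrightarrow> cb n k = 0"
  by (auto simp: cb_def)

lemma milnor_coeff_eq_0: "N + (int p + 1) * Q \<noteq> a + b \<Longrightarrow> milnor_coeff p a b N Q = 0"
  by (simp add: milnor_coeff_def)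

text \<open>Replacing a, b, t by a - p Q, b - Q, t - Q preserves a < p b and reduces the claim to Q
  = 0, which is \<open>adem_binomial_nat\<close>. If a < p Q, both sides vanish.\<close>

lemma adem_milnor_coeff:
  assumes p: "prime p" and ab: "a < p * b" and NQ: "0 \<le> N" "0 \<le> Q"
  shows "[milnor_coeff p (int a) (int b) N Q = (\<Sum>t\<in>{0..a div p}. ((- 1) ^ (a + t) *
      cb ((int p - 1) * (int b - int t) - 1) (int a - int p * int t)) * milnor_coeff p (int (a + b - t)) (int t) N Q)] (mod int p)"
    (is "[_ = sum ?g _] (mod _)")
proof -
  have p2: "2 \<le> p" using p by (simp add: prime_ge_2_nat)
  have tb: "t < b" if "t \<le> a div p" for t
  proof -
    have "p * t \<le> a" using that p2 by (metis le_trans mult_le_mono2 times_div_less_eq_dividend)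
    then show ?thesis using ab p2 by (metis le_less_trans mult_less_cancel1)
  qed
  then have stb: "int (a + b - t) = int a + int b - int t" if "t \<le> a div p" for t
    using that by (fastforce simp: of_nat_diff)
  show ?thesis
  proof (cases "N + (int p + 1) * Q = int a + int b")
    case False
    then have "?g t = 0" if "t \<in> {0..a div p}" for t
      using stb[of t] that by (subst milnor_coeff_eq_0) auto
    then have "sum ?g {0..a div p} = 0" by (rule sum.neutral[OF ballI])
    then show ?thesis using False by (simp add: milnor_coeff_eq_0)
  next
    case N: True
    obtain q where q: "Q = int q" using NQ(2) nonneg_int_cases by blast
    have PPt: "milnor_coeff p (int (a + b - t)) (int t) N Q = cb N (int a + int b - int t - int p * Q)"
      if "t \<le> a div p" for t
      using stb[OF that] N by (simp add: milnor_coeff_def)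
    show ?thesis
    proof (cases "a < p * q")
      case True
      have "?g t = 0" if "t \<in> {0..a div p}" for t
      proof -
        have "t < q"
          using that True p2 by (metis atLeastAtMost_iff div_less_iff_less_mult le_less_trans mult.commute not_numeral_le_zero zero_less_iff_neq_zero)
        then have "N < int a + int b - int t - int p * Q" using N q by (simp add: algebra_simps)
        then have "cb N (int a + int b - int t - int p * Q) = 0" by (rule cb_eq_0)
        then show ?thesis using that PPt[of t] by (simp only: atLeastAtMost_iff mult_zero_right)
      qed
      then have "sum ?g {0..a div p} = 0" by (rule sum.neutral[OF ballI])
      moreover have "int a - int p * Q < 0" using True q by (simp flip: of_nat_mult)
      then have "milnor_coeff p (int a) (int b) N Q = 0" by (simp add: milnor_coeff_def cb_def)
      ultimately show ?thesis by simp
    next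
      case False
      define a' where "a' = a - p * q"
      define b' where "b' = b - q"
      have a: "a = a' + p * q" using False by (simp add: a'_def)
      have "q < b" using False ab p2 by (metis le_less_trans mult_less_cancel1 not_less)
      then have b: "b = b' + q" by (simp add: b'_def)
      have N': "N = int (a' + b')" using N unfolding a b q by (simp add: algebra_simps)
      have ab': "a' < p * b'" using ab unfolding a b by (simp add: algebra_simps)
      have "a div p = a' div p + q" unfolding a using p2 by simp
      then have "sum ?g {0..a div p} = sum ?g {0..a' div p + q}" by simp
      \<comment> \<open>For t < Q the lower binomial entry a + b - t - p Q exceeds N = a + b - (p +
        1) Q.\<close>
      also have "\<dots> = sum ?g {0 + q..a' div p + q}"
      proof (rule sum.mono_neutral_right)
        show "\<forall>t\<in>{0..a' div p + q} - {0 + q..a' div p + q}. ?g t = 0"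
        proof
          fix t assume t: "t \<in> {0..a' div p + q} - {0 + q..a' div p + q}"
          then have "N < int a + int b - int t - int p * Q" using N q by (auto simp: algebra_simps)
          then have "cb N (int a + int b - int t - int p * Q) = 0" by (rule cb_eq_0)
          then show "?g t = 0" using t PPt[of t] \<open>a div p = a' div p + q\<close> by simp
        qed
      qed auto
      also have "\<dots> = (\<Sum>t\<in>{0..a' div p}. ?g (t + q))"
        by (rule sum.shift_bounds_cl_nat_ivl)
      finally have s: "sum ?g {0..a div p} = \<dots>" .
      have c: "[(\<Sum>t\<in>{0..a' div p}. (- 1) ^ (a' + t) *
        int ((p - 1) * (b' - t) - 1 choose (a' - p * t)) * int (a' + b' choose t)) = (\<Sum>t\<in>{0..a' div p}. ?g (t + q))] (mod int p)"
      proof (rule cong_sum)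
        fix t assume "t \<in> {0..a' div p}"
        then have t: "t \<le> a' div p" by simp
        then have pt: "p * t \<le> a'" using p2 by (metis le_trans mult_le_mono2 times_div_less_eq_dividend)
        then have tb': "t < b'" using ab' p2 by (metis le_less_trans mult_less_cancel1)
        then have "t \<le> a' + b'" by simp
        have "0 < (p - 1) * (b' - t)" using p2 tb' by simp
        then have "int ((p - 1) * (b' - t) - 1) = int ((p - 1) * (b' - t)) - 1"
          by linarith
        also have "\<dots> = (int p - 1) * (int b - int (t + q)) - 1"
          using p2 tb' unfolding b by (simp add: of_nat_diff)
        finally have e1: "(int p - 1) * (int b - int (t + q)) - 1 = int ((p - 1) * (b' - t) - 1)" by (rule sym)
        have e2: "int a - int p * int (t + q) = int (a' - p * t)"
          using pt unfolding a by (simp add: of_nat_diff algebra_simps)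
        have e3: "int a + int b - int (t + q) - int p * Q = int (a' + b' - t)"
          using \<open>t \<le> a' + b'\<close> unfolding a b q by (simp add: of_nat_diff algebra_simps)
        have tq: "t + q \<le> a div p" using t \<open>a div p = a' div p + q\<close> by simp
        have "?g (t + q) = (- 1) ^ (a + (t + q)) * int ((p - 1) * (b' - t) - 1 choose (a' - p * t)) * int (a' + b' choose t)"
          unfolding PPt[OF tq] unfolding e1 e2 e3 N' cb_of_nat using binomial_symmetric[OF \<open>t \<le> a' + b'\<close>] by simp
        moreover have "a + (t + q) = a' + t + (p + 1) * q" unfolding a by simp
        then have "[(- 1) ^ (a' + t) = (- 1 :: int) ^ (a + (t + q))] (mod int p)"
          using cong_sym[OF sign_shift_cong[OF p]] by metis
        ultimately show "[(- 1) ^ (a' + t) * int ((p - 1) * (b' - t) - 1 choose (a' - p * t)) * int (a' + b' choose t) = ?g (t + q)] (mod int p)"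
          by (metis cong_mult cong_refl)
      qed
      have "int a - int p * Q = int a'" unfolding a q by simp
      then have "milnor_coeff p (int a) (int b) N Q = int (a' + b' choose a')"
        using N by (simp add: milnor_coeff_def N' cb_of_nat del: of_nat_add)
      then show ?thesis
        using cong_trans[OF adem_binomial_nat[OF p ab'] c] s by simp
    qed
  qed
qed

text \<open>Pascal's rule combines the two binomials in front of the same Milnor coefficient into
  the one of the relation without \<beta>. At the boundary a = p b it fails for t = b; there the
  terms with t < b vanish and t = b returns the left-hand side, up to a sign that is 1 modulo
  p.\<close>

lemma adem_milnor_coeff_B1:
  assumes p: "prime p" and ab: "0 < a" "0 < b" "a \<le> p * b" and NQ: "0 \<le> N" "0 \<le> Q"
  shows "[milnor_coeff p (int a) (int b) N Q =
     (\<Sum>t\<in>{0..a div p}. ((- 1) ^ (a + t) *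
        cb ((int p - 1) * (int b - int t)) (int a - int p * int t)) * milnor_coeff p (int (a + b - t)) (int t) N Q)
   + (\<Sum>t\<in>{0..a div p}. ((- 1) ^ (a + t + 1) *
        cb ((int p - 1) * (int b - int t) - 1) (int a - int p * int t - 1)) * milnor_coeff p (int (a + b - t)) (int t) N Q)] (mod int p)"
    (is "[?L = ?R] (mod _)")
proof -
  have p2: "2 \<le> p" using p by (simp add: prime_ge_2_nat)
  let ?P = "\<lambda>t. milnor_coeff p (int (a + b - t)) (int t) N Q"
  let ?c = "\<lambda>t. cb ((int p - 1) * (int b - int t)) (int a - int p * int t)
    - cb ((int p - 1) * (int b - int t) - 1) (int a - int p * int t - 1)"
  have R: "?R = (\<Sum>t\<in>{0..a div p}. ((- 1) ^ (a + t) * ?c t) * ?P t)"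
    unfolding sum.distrib[symmetric] by (intro sum.cong refl) (simp add: algebra_simps)
  have c: "?c t = cb ((int p - 1) * (int b - int t) - 1) (int a - int p * int t)" if "t < b" for t
    using cb_Pascal[of "(int p - 1) * (int b - int t)"] that p2 by simp
  show ?thesis
  proof (cases "a < p * b")
    case True
    have "t < b" if "t \<in> {0..a div p}" for t
    proof -
      have "t \<le> a div p" using that by simp
      then have "p * t \<le> a" using p2 by (metis le_trans mult_le_mono2 times_div_less_eq_dividend)
      then show ?thesis using True p2 by (metis le_less_trans mult_less_cancel1)
    qed
    then have "?R = (\<Sum>t\<in>{0..a div p}. ((- 1) ^ (a + t) *
      cb ((int p - 1) * (int b - int t) - 1) (int a - int p * int t)) * ?P t)"
      unfolding R by (intro sum.cong refl) (simp only: c)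
    then show ?thesis using adem_milnor_coeff[OF p True NQ] by simp
  next
    case False
    then have a: "a = p * b" using ab(3) by simp
    then have d: "a div p = b" using p2 by simp
    have "?R = (\<Sum>t\<in>{b}. ((- 1) ^ (a + t) * ?c t) * ?P t)"
      unfolding R unfolding d
    proof (rule sum.mono_neutral_right)
      show "\<forall>t\<in>{0..b} - {b}. ((- 1) ^ (a + t) * ?c t) * ?P t = 0"
      proof
        fix t assume "t \<in> {0..b} - {b}"
        then have t: "t < b" by auto
        have "(int p - 1) * (int b - int t) - 1 < int a - int p * int t"
          using t unfolding a by (simp add: algebra_simps)
        then show "((- 1) ^ (a + t) * ?c t) * ?P t = 0" using c[OF t] cb_eq_0 by simp
      qed
    qed auto
    also have "\<dots> = (- 1) ^ (a + b) * ?L"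
      unfolding a by (simp add: cb_def)
    finally have "?R = (- 1) ^ (a + b) * ?L" .
    moreover have "[(- 1) ^ (a + b) = (1 :: int)] (mod int p)"
      using sign_shift_cong[OF p, of 0 b] by (simp add: a add.commute)
    then have "[(- 1) ^ (a + b) * ?L = 1 * ?L] (mod int p)" by (rule cong_mult[OF _ cong_refl])
    ultimately show ?thesis by (simp add: cong_sym)
  qed
qed

text \<open>Raising the new y to y^p costs 1, so this is the relation without \<beta> for a - 1 and
  b; from a \<le> p b it gets its strict inequality.\<close>

lemma adem_milnor_coeff_B2:
  assumes p: "prime p" and ab: "0 < a" "0 < b" "a \<le> p * b" and NQ: "0 \<le> N" "0 \<le> Q"
  shows "[milnor_coeff p (int a - 1) (int b) N Q =
     (\<Sum>t\<in>{0..a div p}. ((- 1) ^ (a + t + 1) *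
        cb ((int p - 1) * (int b - int t) - 1) (int a - int p * int t - 1)) * milnor_coeff p (int (a + b - t) - 1) (int t) N Q)] (mod int p)"
    (is "[_ = sum ?g _] (mod _)")
proof -
  have p2: "2 \<le> p" using p by (simp add: prime_ge_2_nat)
  obtain m where m: "a = Suc m" using ab(1) gr0_conv_Suc by blast
  have mb: "m < p * b" using ab m by simp
  let ?h = "\<lambda>t. ((- 1) ^ (m + t) *
      cb ((int p - 1) * (int b - int t) - 1) (int m - int p * int t)) * milnor_coeff p (int (m + b - t)) (int t) N Q"
  \<comment> \<open>If p divides a, the range for a has one more term than the range for a - 1, and
    the lower binomial entry of that term is -1.\<close>
  have "sum ?g {0..a div p} = sum ?g {0..m div p}"
  proof (rule sum.mono_neutral_right)
    show "{0..m div p} \<subseteq> {0..a div p}" unfolding m by (auto intro: le_trans div_le_mono)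
    show "\<forall>t\<in>{0..a div p} - {0..m div p}. ?g t = 0"
    proof
      fix t assume "t \<in> {0..a div p} - {0..m div p}"
      then have "m div p < t" by auto
      then have "m < p * t" using p2 by (simp add: div_less_iff_less_mult mult.commute)
      then have "int a - int p * int t - 1 < 0" unfolding m by (simp flip: of_nat_mult)
      then show "?g t = 0" by (simp add: cb_def)
    qed
  qed simp
  also have "\<dots> = sum ?h {0..m div p}"
  proof (intro sum.cong refl)
    fix t assume "t \<in> {0..m div p}"
    then have "t \<le> m" using div_le_dividend[of m p] le_trans by (meson atLeastAtMost_iff)
    then have "int (a + b - t) - 1 = int (m + b - t)" unfolding m by (simp add: of_nat_diff)
    moreover have "int a - int p * int t - 1 = int m - int p * int t" unfolding m by simp
    ultimately show "?g t = ?h t" by (simp only:) (simp add: m)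
  qed
  finally show ?thesis using adem_milnor_coeff[OF p mb NQ] m by simp
qed

section \<open>The Steenrod ideal acts trivially\<close>

definition pairing :: "('a \<Rightarrow> int) \<Rightarrow> ('a \<Rightarrow>\<^sub>0 int) \<Rightarrow> int" where
  "pairing F x = (\<Sum>w\<in>Poly_Mapping.keys x. Poly_Mapping.lookup x w * F w)"

text \<open>The integers are identified with the free abelian group on \<open>unit\<close>, which
  makes the additivity of \<open>frag_extend\<close> available.\<close>

lemma pairing_eq_lookup_frag_extend:
  "pairing F x = Poly_Mapping.lookup (frag_extend (\<lambda>w. frag_cmul (F w) (frag_of ())) x) ()"
  unfolding pairing_def frag_extend_def lookup_sum by simp

lemma pairing_frag_of [simp]: "pairing F (frag_of w) = F w"
  by (simp add: pairing_eq_lookup_frag_extend)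

lemma pairing_cmul [simp]: "pairing F (frag_cmul c x) = c * pairing F x"
  by (simp add: pairing_eq_lookup_frag_extend frag_extend_cmul)

lemma pairing_add [simp]: "pairing F (x + y) = pairing F x + pairing F y"
  by (simp add: pairing_eq_lookup_frag_extend frag_extend_add lookup_add)

lemma pairing_diff [simp]: "pairing F (x - y) = pairing F x - pairing F y"
  by (simp add: pairing_eq_lookup_frag_extend frag_extend_diff lookup_minus)

lemma pairing_zero [simp]: "pairing F 0 = 0"
  by (simp add: pairing_def)

lemma pairing_sum [simp]: "pairing F (\<Sum>i\<in>I. g i) = (\<Sum>i\<in>I. pairing F (g i))"
  by (induction I rule: infinite_finite_induct) simp_all

lemma pairing_dvd: "(\<And>w. m dvd F w) \<Longrightarrow> m dvd pairing F x"
  unfolding pairing_def by (intro dvd_sum dvd_mult) blast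

lemma pairing_swap: "pairing (\<lambda>u. pairing (\<lambda>v. F u v) y) x = pairing (\<lambda>v. pairing (\<lambda>u. F u v) x) y"
proof -
  have "pairing (\<lambda>u. pairing (\<lambda>v. F u v) y) x = (\<Sum>u\<in>Poly_Mapping.keys x. \<Sum>v\<in>Poly_Mapping.keys y.
      Poly_Mapping.lookup x u * (Poly_Mapping.lookup y v * F u v))"
    by (simp add: pairing_def sum_distrib_left)
  also have "\<dots> = (\<Sum>v\<in>Poly_Mapping.keys y. \<Sum>u\<in>Poly_Mapping.keys x.
      Poly_Mapping.lookup x u * (Poly_Mapping.lookup y v * F u v))"
    by (rule sum.swap)
  also have "\<dots> = pairing (\<lambda>v. pairing (\<lambda>u. F u v) x) y"
    unfolding pairing_def sum_distrib_left by (intro sum.cong refl) (simp only: mult.left_commute)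
  finally show ?thesis .
qed

lemma lin_op_pairing:
  assumes "lin_op G"
  shows "G (\<lambda>f. pairing (\<lambda>u. F u f) x) f = pairing (\<lambda>u. G (F u) f) x"
  unfolding pairing_def by (rule lin_op_sum[OF assms finite_keys])

lemma wmono_eq_frag_of: "wmono w = frag_of w"
  by (simp add: wmono_def)

lemma cmono_eq: "cmono c w = frag_cmul c (frag_of w)"
  unfolding cmono_def by (intro poly_mapping_eqI) (simp add: lookup_single)

text \<open>As a bilinear extension of concatenation the product inherits its laws from
  \<open>frag_extend\<close>.\<close>

lemma fmul_eq_frag_extend:
  "fmul f g = frag_extend (\<lambda>u. frag_extend (\<lambda>v. frag_of (u @ v)) g) f"
proof -
  have "Poly_Mapping.single w (a * b) = frag_cmul a (frag_cmul b (frag_of w))" for a b and w :: "gen list"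
    by (intro poly_mapping_eqI) (simp add: lookup_single)
  then show ?thesis
    by (simp add: fmul_def frag_extend_def frag_cmul_sum)
qed

lemma fmul_frag_of: "fmul (frag_of u) (frag_of v) = frag_of (u @ v)"
  by (simp add: fmul_eq_frag_extend)

lemma fmul_add_left: "fmul (x + y) z = fmul x z + fmul y z"
  by (simp add: fmul_eq_frag_extend frag_extend_add)

lemma fmul_diff_left: "fmul (x - y) z = fmul x z - fmul y z"
  by (simp add: fmul_eq_frag_extend frag_extend_diff)

lemma fmul_cmul_left: "fmul (frag_cmul c x) z = frag_cmul c (fmul x z)"
  by (simp add: fmul_eq_frag_extend frag_extend_cmul)

lemma fmul_zero_left [simp]: "fmul 0 z = 0"
  by (simp add: fmul_eq_frag_extend)

lemma fmul_zero_right [simp]: "fmul z 0 = 0"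
  by (simp add: fmul_eq_frag_extend frag_extend_eq_0)

lemma fmul_add_right: "fmul z (x + y) = fmul z x + fmul z y"
proof -
  have "fmul z (x + y) = (\<Sum>i\<in>Poly_Mapping.keys z. frag_cmul (Poly_Mapping.lookup z i) (frag_extend (\<lambda>v. frag_of (i @ v)) x)
     + frag_cmul (Poly_Mapping.lookup z i) (frag_extend (\<lambda>v. frag_of (i @ v)) y))"
    unfolding fmul_eq_frag_extend frag_extend_add frag_extend_def[of "\<lambda>u. _ u + _ u"] frag_cmul_distrib2 ..
  then show ?thesis by (simp add: sum.distrib fmul_eq_frag_extend frag_extend_def[of _ z])
qed

lemma frag_cmul_diff_distrib2: "frag_cmul c (x - y) = frag_cmul c x - frag_cmul c y"
  by (rule poly_mapping_eqI) (simp add: lookup_minus right_diff_distrib)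

lemma fmul_cmul_right: "fmul z (frag_cmul c x) = frag_cmul c (fmul z x)"
  using subset_UNIV
  by (induction z rule: frag_induction)
    (simp_all add: fmul_eq_frag_extend frag_extend_cmul frag_extend_diff frag_cmul_diff_distrib2)

lemma fmul_minus_right: "fmul z (- x) = - fmul z x"
  using fmul_cmul_right[of z "- 1" x] by simp

lemma fmul_diff_right: "fmul z (x - y) = fmul z x - fmul z y"
  using fmul_add_right[of z x "- y"] by (simp add: fmul_minus_right)

lemma fmul_sum_left: "fmul (\<Sum>i\<in>I. g i) z = (\<Sum>i\<in>I. fmul (g i) z)"
  by (induction I rule: infinite_finite_induct) (simp_all add: fmul_add_left)

lemma pairing_fmul: "pairing F (fmul x y) = pairing (\<lambda>u. pairing (\<lambda>v. F (u @ v)) y) x"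
  using subset_UNIV
proof (induction x rule: frag_induction)
  case (one u)
  have "pairing F (fmul (frag_of u) y) = pairing (\<lambda>v. F (u @ v)) y"
    using subset_UNIV by (induction y rule: frag_induction) (simp_all add: fmul_frag_of fmul_diff_right)
  then show ?case by simp
qed (simp_all add: fmul_diff_left)

text \<open>Valid for every prime: both sides are expanded in the Milnor basis, where the relation
  is a congruence between coefficients.\<close>

lemma act_adem2:
  assumes p: "prime p" and ab: "a < p * b"
  shows "[act p [P a, P b] \<phi> f = (\<Sum>t\<in>{0..a div p}. (- 1) ^ (a + t) *
      cb ((int p - 1) * (int b - int t) - 1) (int a - int p * int t) * act p [P (a + b - t), P t] \<phi> f)] (mod int p)"
proof -
  let ?k = "\<lambda>t. (- 1) ^ (a + t) * cb ((int p - 1) * (int b - int t) - 1) (int a - int p * int t)"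
  have "[act p [P a, P b] \<phi> f = opT p (milnor_coeff p (int a) (int b)) \<phi> f] (mod int p)"
    using opP_opP[OF p] by simp
  moreover have "[opT p (milnor_coeff p (int a) (int b)) \<phi> f =
      opT p (\<lambda>N Q. \<Sum>t\<in>{0..a div p}. ?k t * milnor_coeff p (int (a + b - t)) (int t) N Q) \<phi> f] (mod int p)"
    by (rule opT_cong) (rule adem_milnor_coeff[OF p ab])
  moreover have "[(\<Sum>t\<in>{0..a div p}. ?k t * opT p (milnor_coeff p (int (a + b - t)) (int t)) \<phi> f)
     = (\<Sum>t\<in>{0..a div p}. ?k t * act p [P (a + b - t), P t] \<phi> f)] (mod int p)"
    by (intro cong_sum cong_mult cong_refl) (use cong_sym[OF opP_opP[OF p]] in simp)
  ultimately show ?thesis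
    unfolding opT_sum[OF finite_atLeastAtMost] by (rule cong_trans[OF cong_trans])
qed

lemma act_ademPB:
  assumes p: "prime p" "p \<noteq> 2" and ab: "0 < a" "0 < b" "a \<le> p * b"
  shows "[act p [P a, B, P b] \<phi> f =
     (\<Sum>t\<in>{0..a div p}. (- 1) ^ (a + t) *
        cb ((int p - 1) * (int b - int t)) (int a - int p * int t) * act p [B, P (a + b - t), P t] \<phi> f)
   + (\<Sum>t\<in>{0..a div p}. (- 1) ^ (a + t + 1) *
        cb ((int p - 1) * (int b - int t) - 1) (int a - int p * int t - 1) * act p [P (a + b - t), B, P t] \<phi> f)] (mod int p)"
    (is "[_ = ?R] (mod _)")
proof -
  let ?k = "\<lambda>t. (- 1) ^ (a + t) * cb ((int p - 1) * (int b - int t)) (int a - int p * int t)"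
  let ?l = "\<lambda>t. (- 1) ^ (a + t + 1) * cb ((int p - 1) * (int b - int t) - 1) (int a - int p * int t - 1)"
  let ?P = "\<lambda>t. milnor_coeff p (int (a + b - t)) (int t)" and ?P' = "\<lambda>t. milnor_coeff p (int (a + b - t) - 1) (int t)"
  have "[act p [P a, B, P b] \<phi> f = opTB p (milnor_coeff p (int a) (int b)) (milnor_coeff p (int a - 1) (int b)) \<phi> f] (mod int p)"
    using opP_opB_opP[OF p(1)] p(2) by simp
  \<comment> \<open>The terms \<beta> P^(a+b-t) P^t have second coefficient 0; it is written out as
    a sum so that \<open>opTB_sum\<close> finds the same scalars in both coefficients.\<close>
  moreover have "[opTB p (milnor_coeff p (int a) (int b)) (milnor_coeff p (int a - 1) (int b)) \<phi> f =
      opTB p (\<lambda>N Q. (\<Sum>t\<in>{0..a div p}. ?k t * ?P t N Q) + (\<Sum>t\<in>{0..a div p}. ?l t * ?P t N Q))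
        (\<lambda>N Q. (\<Sum>t\<in>{0..a div p}. ?k t * (\<lambda>N Q. 0) N Q) + (\<Sum>t\<in>{0..a div p}. ?l t * ?P' t N Q)) \<phi> f] (mod int p)"
    using adem_milnor_coeff_B1[OF p(1) ab] adem_milnor_coeff_B2[OF p(1) ab] by (intro opTB_cong) simp_all
  moreover have "[(\<Sum>t\<in>{0..a div p}. ?k t * opTB p (?P t) (\<lambda>N Q. 0) \<phi> f)
     + (\<Sum>t\<in>{0..a div p}. ?l t * opTB p (?P t) (?P' t) \<phi> f) = ?R] (mod int p)"
    by (intro cong_add cong_sum cong_mult cong_refl)
      (use cong_sym[OF opP_opP_opB[OF p(1)]] cong_sym[OF opP_opB_opP[OF p(1)]] p(2) in simp_all)
  ultimately show ?thesis
    unfolding opTB_add opTB_sum[OF finite_atLeastAtMost] by (rule cong_trans[OF cong_trans])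
qed

lemma act_steen_rels:
  assumes p: "prime p" and "r \<in> steen_rels p"
  shows "int p dvd pairing (\<lambda>w. act p w \<phi> f) r"
proof -
  have p0: "0 < p" using p by (simp add: prime_gt_0_nat)
  have zero: "opP p 0 \<phi> = \<phi>" for \<phi> using opP_zero[OF p0] by (intro ext)
  consider "r = wmono [P 0] - wmono []"
    | "p = 2" "r = wmono [B] - wmono [P 1]"
    | a b where "p = 2" "r = adem2 a b" "a < 2 * b"
    | "p \<noteq> 2" "r = wmono [B, B]"
    | a b where "p \<noteq> 2" "r = ademP p a b" "a < p * b"
    | a b where "p \<noteq> 2" "r = ademPB p a b" "0 < a" "0 < b" "a \<le> p * b"
  proof (cases "p = 2")
    case True
    with assms(2) show ?thesis
      unfolding steen_rels_def if_P[OF True] using that(1-3) by blast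
  next
    case False
    with assms(2) show ?thesis
      unfolding steen_rels_def if_not_P[OF False] using that(1,4-6) by blast
  qed
  then show ?thesis
  proof cases
    case 1
    then show ?thesis by (simp add: wmono_eq_frag_of zero)
  next
    case 2
    then show ?thesis by (simp add: wmono_eq_frag_of)
  next
    case (3 a b)
    have "[act 2 [P a, P b] \<phi> f = (\<Sum>t\<in>{0..a div 2}. (- 1) ^ (a + t) *
        cb (int b - int t - 1) (int a - 2 * int t) * act 2 [P (a + b - t), P t] \<phi> f)] (mod 2)"
      using act_adem2[of 2 a b \<phi> f] p 3 by (simp del: act.simps)
    \<comment> \<open>The relations for p = 2 are stated without signs.\<close>
    moreover have sign: "[(- 1) ^ n = (1 :: int)] (mod 2)" for n
      by (cases "even n") (simp_all add: cong_def)
    have "[(\<Sum>t\<in>{0..a div 2}. (- 1) ^ (a + t) *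
        cb (int b - int t - 1) (int a - 2 * int t) * act 2 [P (a + b - t), P t] \<phi> f)
      = (\<Sum>t\<in>{0..a div 2}. 1 *
        cb (int b - int t - 1) (int a - 2 * int t) * act 2 [P (a + b - t), P t] \<phi> f)] (mod 2)"
      by (rule cong_sum, rule cong_mult[OF cong_mult[OF sign cong_refl] cong_refl])
    ultimately have "2 dvd act 2 [P a, P b] \<phi> f - (\<Sum>t\<in>{0..a div 2}. 1 *
        cb (int b - int t - 1) (int a - 2 * int t) * act 2 [P (a + b - t), P t] \<phi> f)"
      unfolding cong_iff_dvd_diff[symmetric] by (rule cong_trans)
    then show ?thesis
      unfolding 3 by (simp add: adem2_def wmono_eq_frag_of cmono_eq cong_0_iff del: act.simps)
  next
    case 4
    have "opB (opB \<phi>) = (\<lambda>_. 0)" by (intro ext opB_opB)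
    with 4 show ?thesis by (simp add: wmono_eq_frag_of)
  next
    case (5 a b)
    have "int p dvd act p [P a, P b] \<phi> f - (\<Sum>t\<in>{0..a div p}. (- 1) ^ (a + t) *
      cb ((int p - 1) * (int b - int t) - 1) (int a - int p * int t) * act p [P (a + b - t), P t] \<phi> f)"
      using act_adem2[OF p 5(3)] unfolding cong_iff_dvd_diff .
    then show ?thesis
      unfolding 5 by (simp add: ademP_def wmono_eq_frag_of cmono_eq del: act.simps)
  next
    case (6 a b)
    show ?thesis
      using act_ademPB[OF p 6(1,3,4,5), of \<phi> f]
      unfolding 6 cong_iff_dvd_diff
      by (simp add: ademPB_def wmono_eq_frag_of cmono_eq diff_diff_eq del: act.simps)
  qed
qed

text \<open>For left multiples the induction hypothesis is applied to the functionals
  \<open>act p u \<phi>\<close>, because the left factor acts first. For right multiples the order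
  of summation is exchanged: the inner functional takes values divisible by p, and linear operators
  preserve this.\<close>

theorem act_steen_ideal:
  assumes p: "prime p" and "x \<in> steen_ideal p"
  shows "int p dvd pairing (\<lambda>w. act p w \<phi> f) x"
  using assms(2)
proof (induction arbitrary: \<phi> f rule: steen_ideal.induct)
  case (rel r)
  then show ?case using act_steen_rels[OF p] by simp
next
  case (lmul x y)
  show ?case unfolding pairing_fmul act_append by (rule pairing_dvd) (rule lmul.IH)
next
  case (rmul x y)
  have "pairing (\<lambda>w. act p w \<phi> f) (fmul x y) = pairing (\<lambda>v. pairing (\<lambda>u. act p v (act p u \<phi>) f) x) y"
    unfolding pairing_fmul act_append by (rule pairing_swap)
  also have "\<dots> = pairing (\<lambda>v. act p v (\<lambda>f. pairing (\<lambda>u. act p u \<phi> f) x) f) y"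
    by (subst lin_op_pairing[OF lin_op_act]) (rule refl)
  finally show ?case
    by (simp only:) (rule pairing_dvd, rule lin_op_dvd[OF lin_op_act], rule rmul.IH)
qed simp_all

section \<open>Linear independence of admissible monomials\<close>

definition opB_if :: "nat \<Rightarrow> (nat list \<Rightarrow> int) \<Rightarrow> nat list \<Rightarrow> int" where
  "opB_if e \<phi> = (if e = 0 then \<phi> else opB \<phi>)"

lemma opB_if_Suc: "opB_if e \<phi> (Suc h # t) = opB_if e (\<lambda>u. \<phi> (Suc h # u)) t"
  by (simp add: opB_if_def)

text \<open>A pair \<open>(i, e)\<close> encodes \<open>P^i \<beta>^e\<close>; exponents may be zero here, so that all monomials of a finite
  family can be padded to the same length.\<close>
fun act_pairs :: "nat \<Rightarrow> (int \<times> nat) list \<Rightarrow> (nat list \<Rightarrow> int) \<Rightarrow> nat list \<Rightarrow> int" where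
  "act_pairs p [] \<phi> = \<phi>"
| "act_pairs p ((i, e) # l) \<phi> = act_pairs p l (opB_if e (opP p i \<phi>))"

lemma act_pairs_append: "act_pairs p (l @ l') \<phi> = act_pairs p l' (act_pairs p l \<phi>)"
  by (induction p l \<phi> rule: act_pairs.induct) simp_all

text \<open>Shifting keeps every difference i_s - p i_(s+1), so it affects admissibility only at the
  last pair.\<close>

fun shift_pairs :: "nat \<Rightarrow> int \<Rightarrow> (int \<times> nat) list \<Rightarrow> (int \<times> nat) list" where
  "shift_pairs p c [] = []"
| "shift_pairs p c ((i, e) # l) = (i - c * int (p ^ length l), e) # shift_pairs p c l"

lemma length_shift_pairs [simp]: "length (shift_pairs p c l) = length l"
  by (induction p c l rule: shift_pairs.induct) simp_all

lemma shift_pairs_shift_pairs: "shift_pairs p c (shift_pairs p d l) = shift_pairs p (c + d) l"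
  by (induction p d l rule: shift_pairs.induct) (simp_all add: algebra_simps)

lemma shift_pairs_zero: "shift_pairs p 0 l = l"
proof (induction l)
  case (Cons x l)
  then show ?case by (cases x) simp
qed simp

lemma shift_pairs_append: "shift_pairs p c (l @ [(i, e)]) = shift_pairs p (c * int p) l @ [(i - c, e)]"
  by (induction p c l rule: shift_pairs.induct) (simp_all add: algebra_simps)

lemma shift_pairs_inj: "shift_pairs p c l = shift_pairs p c l' \<Longrightarrow> l = l'"
  using shift_pairs_shift_pairs[of p "- c" c] by (metis add.left_inverse shift_pairs_zero)

section \<open>Functionals concentrated on the top level\<close>

definition vanishes :: "nat \<Rightarrow> nat \<Rightarrow> (nat list \<Rightarrow> int) \<Rightarrow> bool" where
  "vanishes k H \<phi> \<longleftrightarrow> (\<forall>h t. k \<le> h \<longrightarrow> h < H \<longrightarrow> \<phi> (h # t) = 0)"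

lemma vanishesD: "vanishes k H \<phi> \<Longrightarrow> k \<le> h \<Longrightarrow> h < H \<Longrightarrow> (\<lambda>t. \<phi> (h # t)) = (\<lambda>t. 0)"
  by (auto simp: vanishes_def)

text \<open>A reduced power raises an entry by at most one level, so just one level is lost.\<close>

lemma vanishes_opP:
  assumes "vanishes k (Suc H) \<phi>"
  shows "vanishes k H (opP p i \<phi>)"
  unfolding vanishes_def
proof (intro allI impI)
  fix h t assume h: "k \<le> h" "h < H"
  show "opP p i \<phi> (h # t) = 0"
    by (cases h) (use h in \<open>simp_all add: vanishesD[OF assms] lin_op_zero[OF lin_op_opP]\<close>)
qed

lemma vanishes_opB_if_1: "vanishes 1 H \<phi> \<Longrightarrow> vanishes 1 H (opB_if e \<phi>)"
  unfolding vanishes_def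
proof (intro allI impI)
  fix h t assume v: "\<forall>h t. 1 \<le> h \<longrightarrow> h < H \<longrightarrow> \<phi> (h # t) = 0" and h: "1 \<le> h" "h < H"
  obtain k where k: "h = Suc k" using h(1) by (cases h) auto
  have "(\<lambda>u. \<phi> (Suc k # u)) = (\<lambda>u. 0)" using v h k by auto
  then show "opB_if e \<phi> (h # t) = 0"
    unfolding k opB_if_Suc by (simp add: opB_if_def lin_op_zero[OF lin_op_opB])
qed

text \<open>Level 0 passes to level 1 under \<beta>, so both levels have to lie below H.\<close>

lemma vanishes_opB_if_0:
  assumes "vanishes 0 H \<phi>" "2 \<le> H"
  shows "vanishes 0 H (opB_if e \<phi>)"
  unfolding vanishes_def
proof (intro allI impI)
  fix h t assume h: "h < H"
  note z = lin_op_zero[OF lin_op_opB]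
  show "opB_if e \<phi> (h # t) = 0"
  proof (cases h)
    case 0
    have "\<phi> (0 # t) = 0" "\<phi> (1 # t) = 0" "(\<lambda>u. \<phi> (0 # u)) = (\<lambda>u. 0)"
      using assms by (auto simp: vanishes_def)
    then show ?thesis unfolding 0 by (simp add: opB_if_def z)
  next
    case (Suc k)
    have "(\<lambda>u. \<phi> (Suc k # u)) = (\<lambda>u. 0)" using vanishesD[OF assms(1), of "Suc k"] h Suc by simp
    then show ?thesis unfolding Suc opB_if_Suc by (simp add: opB_if_def z)
  qed
qed

lemma vanishes_act_pairs_0:
  "vanishes 0 (length l + H) \<phi> \<Longrightarrow> 2 \<le> H \<Longrightarrow> vanishes 0 H (act_pairs p l \<phi>)"
proof (induction p l \<phi> rule: act_pairs.induct)
  case (2 p i e l \<phi>)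
  then have "vanishes 0 (length l + H) (opB_if e (opP p i \<phi>))"
    by (intro vanishes_opB_if_0 vanishes_opP) simp_all
  with 2 show ?case by simp
qed simp

text \<open>To reach the top level \<open>length l + 1\<close>, an entry starting at level \<open>1\<close> must be raised by every
  \<open>P^i\<close>, contributing \<open>1, p, p\<^sup>2, \<dots>\<close> to the exponents read from right to left.\<close>
lemma act_pairs_peel_1:
  "vanishes 1 (Suc (length l)) \<phi> \<Longrightarrow>
    act_pairs p l \<phi> (1 # t) = act_pairs p (shift_pairs p 1 l) (\<lambda>u. \<phi> (Suc (length l) # u)) t"
proof (induction l arbitrary: \<phi>)
  case (Cons x l)
  obtain i e where x: "x = (i, e)" by (cases x)
  let ?H = "Suc (length l)"
  let ?\<psi> = "opB_if e (opP p i \<phi>)"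
  have v: "vanishes 1 (Suc ?H) \<phi>" using Cons.prems by simp
  then have "vanishes 1 ?H ?\<psi>" by (intro vanishes_opB_if_1 vanishes_opP)
  then have "act_pairs p l ?\<psi> (1 # t) = act_pairs p (shift_pairs p 1 l) (\<lambda>u. ?\<psi> (?H # u)) t" by (rule Cons.IH)
  moreover have "opP p i \<phi> (?H # u) = opP p (i - int (p ^ length l)) (\<lambda>u. \<phi> (Suc ?H # u)) u" for u
    using vanishesD[OF v, of ?H] by (simp add: lin_op_zero[OF lin_op_opP])
  ultimately show ?case by (simp add: x opB_if_Suc)
qed simp

text \<open>To reach the top level an exterior entry must become y before any P^i acts on it. On
  vectors the last letters of a word act before the others, so this forces the word to end with
  \<beta>.\<close>

lemma act_pairs_peel_0:
  assumes "vanishes 0 (Suc (Suc (length l))) \<phi>"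
  shows "act_pairs p (l @ [(i, e)]) \<phi> (0 # t) =
    (if e = 0 then 0 else act_pairs p (shift_pairs p 1 (l @ [(i, 0)])) (\<lambda>u. \<phi> (Suc (Suc (length l)) # u)) t)"
proof -
  let ?\<rho> = "act_pairs p (l @ [(i, 0)]) \<phi>"
  have r: "?\<rho> = opP p i (act_pairs p l \<phi>)" by (simp add: act_pairs_append opB_if_def)
  have "vanishes 0 2 (act_pairs p l \<phi>)"
    by (rule vanishes_act_pairs_0) (use assms in simp_all)
  then have "vanishes 0 1 ?\<rho>"
    unfolding r by (intro vanishes_opP) (simp add: numeral_2_eq_2)
  then have z: "(\<lambda>u. ?\<rho> (0 # u)) = (\<lambda>u. 0)" by (rule vanishesD) simp_all
  then have z': "?\<rho> (0 # t) = 0" by (rule fun_cong)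
  have "vanishes 1 (Suc (length (l @ [(i, 0 :: nat)]))) \<phi>"
    using assms by (simp add: vanishes_def)
  then have one: "?\<rho> (1 # t) = act_pairs p (shift_pairs p 1 (l @ [(i, 0)])) (\<lambda>u. \<phi> (Suc (Suc (length l)) # u)) t"
    using act_pairs_peel_1 by fastforce
  have "act_pairs p (l @ [(i, e)]) \<phi> = opB_if e ?\<rho>" by (simp add: act_pairs_append opB_if_def)
  then show ?thesis
    using z z' one by (simp add: opB_if_def lin_op_zero[OF lin_op_opB])
qed

fun lift :: "nat \<Rightarrow> nat \<Rightarrow> (nat list \<Rightarrow> int) \<Rightarrow> nat list \<Rightarrow> int" where
  "lift H 0 \<Phi> g = \<Phi> g"
| "lift H (Suc n) \<Phi> [] = 0"
| "lift H (Suc n) \<Phi> (h # g) = (if h = H then lift H n \<Phi> g else 0)"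

lemma vanishes_lift: "vanishes k H (lift H (Suc n) \<Phi>)"
  by (simp add: vanishes_def)

lemma lift_top: "(\<lambda>u. lift H (Suc n) \<Phi> (H # u)) = lift H n \<Phi>"
  by (rule ext) simp

text \<open>The m entries are peeled off in turn; \<beta>^e0 acts last on vectors and leaves the
  polynomial entries unchanged.\<close>

lemma act_pairs_lift_1:
  "act_pairs p l (opB_if e0 (lift (Suc (length l)) m \<Phi>)) (replicate m 1 @ t) = act_pairs p (shift_pairs p (int m) l) (opB_if e0 \<Phi>) t"
proof (induction m arbitrary: l)
  case 0
  have "lift (Suc (length l)) 0 \<Phi> = \<Phi>" by (rule ext) simp
  then show ?case by (simp add: shift_pairs_zero)
next
  case (Suc m)
  let ?H = "Suc (length l)"
  have "vanishes 1 ?H (opB_if e0 (lift ?H (Suc m) \<Phi>))"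
    by (intro vanishes_opB_if_1 vanishes_lift)
  from act_pairs_peel_1[OF this, of p "replicate m 1 @ t"]
  have "act_pairs p l (opB_if e0 (lift ?H (Suc m) \<Phi>)) (replicate (Suc m) 1 @ t)
     = act_pairs p (shift_pairs p 1 l) (opB_if e0 (lift ?H m \<Phi>)) (replicate m 1 @ t)"
    unfolding opB_if_Suc lift_top by simp
  also have "\<dots> = act_pairs p (shift_pairs p (int (Suc m)) l) (opB_if e0 \<Phi>) t"
    using Suc.IH[of "shift_pairs p 1 l"] by (simp add: shift_pairs_shift_pairs add.commute)
  finally show ?case .
qed

text \<open>All e + m leading entries must climb to the top, which leaves i - (e + m) for the last
  reduced power: it acts as zero if i < e + m and as the identity if i = e + m.\<close>

lemma act_pairs_lift:
  assumes "e \<le> 1"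
  shows "act_pairs p (l @ [(i, e)]) (opB_if e0 (lift (Suc (Suc (length l))) (e + m) \<Phi>)) (replicate e 0 @ replicate m 1 @ t)
     = opP p (i - int (e + m)) (act_pairs p (shift_pairs p (int p * int (e + m)) l) (opB_if e0 \<Phi>)) t"
proof -
  let ?H = "Suc (Suc (length l))"
  have one: "act_pairs p (l @ [(i, 0)]) (opB_if e0 (lift ?H m \<Phi>)) (replicate m 1 @ t)
      = opP p (i - int m) (act_pairs p (shift_pairs p (int p * int m) l) (opB_if e0 \<Phi>)) t"
    if "?H = Suc (length (l @ [(i, 0 :: nat)]))" for i l m
    unfolding that act_pairs_lift_1 shift_pairs_append by (simp add: act_pairs_append opB_if_def mult.commute)
  show ?thesis
  proof (cases "e = 0")
    case True
    then show ?thesis using one[of l i m] by simp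
  next
    case False
    then have e: "e = 1" using assms by simp
    have "vanishes 0 ?H (opB_if e0 (lift ?H (Suc m) \<Phi>))"
      by (intro vanishes_opB_if_0 vanishes_lift) simp
    from act_pairs_peel_0[OF this, where p=p and i=i and e=1 and t="replicate m 1 @ t"]
    have "act_pairs p (l @ [(i, 1)]) (opB_if e0 (lift ?H (Suc m) \<Phi>)) (0 # replicate m 1 @ t)
      = act_pairs p (shift_pairs p (int p) l @ [(i - 1, 0)]) (opB_if e0 (lift ?H m \<Phi>)) (replicate m 1 @ t)"
      unfolding opB_if_Suc lift_top by (simp add: shift_pairs_append)
    then show ?thesis using one[of "shift_pairs p (int p) l" "i - 1" m]
      by (simp add: e shift_pairs_shift_pairs algebra_simps)
  qed
qed

lemma act_pairs_lift_eq_0: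
  assumes "e = 1"
  shows "act_pairs p (l @ [(i, 0)]) (opB_if e0 (lift (Suc (Suc (length l))) (e + m) \<Phi>)) (replicate e 0 @ t) = 0"
proof -
  let ?H = "Suc (Suc (length l))"
  have "vanishes 0 ?H (opB_if e0 (lift ?H (Suc m) \<Phi>))"
    by (intro vanishes_opB_if_0 vanishes_lift) simp
  from act_pairs_peel_0[OF this, where p=p and i=i and e=0] show ?thesis by (simp add: assms)
qed

fun hd_exp :: "(int \<times> nat) list \<Rightarrow> int" where
  "hd_exp [] = 0"
| "hd_exp ((i, e) # l) = i"

fun adm_pairs :: "nat \<Rightarrow> (int \<times> nat) list \<Rightarrow> bool" where
  "adm_pairs p [] = True"
| "adm_pairs p ((i, e) # l) = (e \<le> 1 \<and> int p * hd_exp l + int e \<le> i \<and> adm_pairs p l)"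

text \<open>After the shift the new last exponent is the old difference i_s - p i of the last two
  pairs, so their admissibility inequality becomes the condition on a last pair.\<close>

lemma adm_pairs_snoc: "adm_pairs p (l @ [(i, e)]) \<Longrightarrow> adm_pairs p (shift_pairs p (int p * i) l) \<and> e \<le> 1 \<and> int e \<le> i"
proof (induction l)
  case (Cons x l)
  obtain j e' where x: "x = (j, e')" by (cases x)
  show ?case
    using Cons unfolding x by (cases l rule: hd_exp.cases) (auto simp: algebra_simps)
qed simp

text \<open>The separated monomial maximizes the last \<open>e\<close> and then the last \<open>i\<close>: a vector with \<open>e\<close> exterior
  and \<open>i - e\<close> polynomial entries which all reach the top level kills the other monomials, and on the
  remaining ones it splits off the last letters.\<close>
lemma act_pairs_separation:
  assumes p: "0 < p"
  shows "finite S \<Longrightarrow> S \<noteq> {} \<Longrightarrow> (\<And>e0 l. (e0, l) \<in> S \<Longrightarrow> e0 \<le> 1 \<and> adm_pairs p l \<and> length l = R) \<Longrightarrow>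
    \<exists>J0\<in>S. \<exists>\<phi> f. act_pairs p (snd J0) (opB_if (fst J0) \<phi>) f = 1 \<and>
       (\<forall>J\<in>S. J \<noteq> J0 \<longrightarrow> act_pairs p (snd J) (opB_if (fst J) \<phi>) f = 0)"
proof (induction R arbitrary: S)
  case 0
  then have S: "S \<subseteq> {(0, []), (1, [])}" by force
  show ?case
  proof (cases "(1, []) \<in> S")
    case True
    \<comment> \<open>The words are 1 and \<beta>, and reading off y on the vector x separates
      \<beta> from 1.\<close>
    show ?thesis
      by (rule bexI[OF _ True], rule exI[of _ "\<lambda>g. if g = [1] then 1 else 0"], rule exI[of _ "[0]"])
        (use S in \<open>auto simp: opB_if_def\<close>)
  next
    case False
    then have "S = {(0, [])}" using S 0(2) by auto
    then show ?thesis by (auto simp: opB_if_def intro!: exI[of _ "\<lambda>g. 1"])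
  qed
next
  case (Suc R)
  define e where "e = Max ((\<lambda>J. snd (last (snd J))) ` S)"
  define S1 where "S1 = {J \<in> S. snd (last (snd J)) = e}"
  have fin1: "finite S1" using Suc.prems(1) by (simp add: S1_def)
  have "e \<in> (\<lambda>J. snd (last (snd J))) ` S"
    unfolding e_def using Suc.prems by (intro Max_in) auto
  then have ne1: "S1 \<noteq> {}" unfolding S1_def by blast
  have e_max: "snd (last (snd J)) \<le> e" if "J \<in> S" for J
    unfolding e_def using Suc.prems(1) that by (intro Max_ge) auto
  define k where "k = Max ((\<lambda>J. fst (last (snd J))) ` S1)"
  define S2 where "S2 = {J \<in> S1. fst (last (snd J)) = k}"
  have fin2: "finite S2" using fin1 by (simp add: S2_def)
  have "k \<in> (\<lambda>J. fst (last (snd J))) ` S1"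
    unfolding k_def using fin1 ne1 by (intro Max_in) auto
  then have ne2: "S2 \<noteq> {}" unfolding S2_def by blast
  have k_max: "fst (last (snd J)) \<le> k" if "J \<in> S1" for J
    unfolding k_def using fin1 that by (intro Max_ge) auto
  have decomp: "\<exists>l i ee. snd J = l @ [(i, ee)] \<and> length l = R \<and> adm_pairs p (shift_pairs p (int p * i) l) \<and> ee \<le> 1 \<and> int ee \<le> i \<and> fst J \<le> 1"
    if "J \<in> S" for J
  proof -
    have J: "fst J \<le> 1" "adm_pairs p (snd J)" "length (snd J) = Suc R"
      using Suc.prems(3)[of "fst J" "snd J"] that by auto
    then obtain l x where l: "snd J = l @ [x]" by (metis length_Suc_conv_rev)
    obtain i ee where x: "x = (i, ee)" by (cases x)
    show ?thesis using J adm_pairs_snoc[of p l i ee] unfolding l x by auto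
  qed
  \<comment> \<open>On \<open>S2\<close> the last pair is (k, e) throughout; removing it and
    shifting by p k is injective there and yields admissible lists of length R.\<close>
  define \<tau> where "\<tau> = (\<lambda>J. (fst J, shift_pairs p (int p * k) (butlast (snd J))) :: nat \<times> (int \<times> nat) list)"
  have \<tau>: "fst J \<le> 1 \<and> adm_pairs p (snd (\<tau> J)) \<and> length (snd (\<tau> J)) = R" if "J \<in> S2" for J
    using decomp[of J] that unfolding \<tau>_def S2_def S1_def by auto
  have inj: "J = J'" if "J \<in> S2" "J' \<in> S2" "\<tau> J = \<tau> J'" for J J'
  proof -
    have "butlast (snd J) = butlast (snd J')" "fst J = fst J'"
      using that(3) shift_pairs_inj unfolding \<tau>_def by auto
    moreover have "last (snd J) = last (snd J')"
      using that(1,2) unfolding S2_def S1_def by (auto intro: prod_eqI)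
    moreover have "snd J \<noteq> []" "snd J' \<noteq> []"
      using decomp[of J] decomp[of J'] that(1,2) unfolding S2_def S1_def by auto
    ultimately show ?thesis by (metis append_butlast_last_id prod_eqI)
  qed
  obtain Jk where Jk: "Jk \<in> S2" using ne2 by auto
  have ek: "e \<le> 1" "int e \<le> k"
    using decomp[of Jk] Jk unfolding S2_def S1_def by auto
  define m where "m = nat (k - int e)"
  have k: "k = int (e + m)" using ek by (simp add: m_def)
  have "\<exists>J0\<in>\<tau> ` S2. \<exists>\<phi> f. act_pairs p (snd J0) (opB_if (fst J0) \<phi>) f = 1 \<and>
       (\<forall>J\<in>\<tau> ` S2. J \<noteq> J0 \<longrightarrow> act_pairs p (snd J) (opB_if (fst J) \<phi>) f = 0)"
    by (rule Suc.IH) (use fin2 ne2 \<tau> in \<open>auto simp: \<tau>_def\<close>)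
  then obtain J0 \<Phi> g where J0: "J0 \<in> S2" "act_pairs p (snd (\<tau> J0)) (opB_if (fst (\<tau> J0)) \<Phi>) g = 1"
    and others: "\<And>J. J \<in> S2 \<Longrightarrow> \<tau> J \<noteq> \<tau> J0 \<Longrightarrow> act_pairs p (snd (\<tau> J)) (opB_if (fst (\<tau> J)) \<Phi>) g = 0"
    by auto
  define \<phi> where "\<phi> = lift (Suc (Suc R)) (e + m) \<Phi>"
  define f where "f = replicate e 0 @ replicate m 1 @ g"
  have in2: "act_pairs p (snd J) (opB_if (fst J) \<phi>) f = act_pairs p (snd (\<tau> J)) (opB_if (fst (\<tau> J)) \<Phi>) g" if "J \<in> S2" for J
  proof -
    have "J \<in> S" "snd (last (snd J)) = e" "fst (last (snd J)) = k"
      using that by (simp_all add: S2_def S1_def)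
    then obtain l where l: "snd J = l @ [(k, e)]" "length l = R"
      using decomp[of J] by fastforce
    show ?thesis
      using act_pairs_lift[OF ek(1), of p l k "fst J" m \<Phi> g] opP_zero[OF p]
      by (simp add: \<tau>_def \<phi>_def f_def l k)
  qed
  have notin2: "act_pairs p (snd J) (opB_if (fst J) \<phi>) f = 0" if "J \<in> S" "J \<notin> S2" for J
  proof (cases "J \<in> S1")
    case True
    obtain l i where l: "snd J = l @ [(i, e)]" "length l = R"
      using decomp[of J] True unfolding S1_def by auto
    have "i < k" using k_max[OF True] True that(2) l unfolding S2_def by auto
    then show ?thesis
      using act_pairs_lift[OF ek(1), of p l i "fst J" m \<Phi> g] opP_negative[of "i - k"]
      by (simp add: \<phi>_def f_def l k)
  next
    case False
    obtain l i ee where l: "snd J = l @ [(i, ee)]" "length l = R"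
      using decomp[OF \<open>J \<in> S\<close>] by blast
    have "ee < e" using e_max[OF that(1)] False that(1) l unfolding S1_def by auto
    then have "e = 1" "ee = 0" using ek by auto
    then show ?thesis
      using act_pairs_lift_eq_0[of e p l i "fst J" m \<Phi>] by (simp add: \<phi>_def f_def l)
  qed
  have "J0 \<in> S" using J0(1) by (simp add: S2_def S1_def)
  moreover have "act_pairs p (snd J0) (opB_if (fst J0) \<phi>) f = 1" using in2 J0 by simp
  moreover have "act_pairs p (snd J) (opB_if (fst J) \<phi>) f = 0" if "J \<in> S" "J \<noteq> J0" for J
    using in2[of J] notin2[of J] others[of J] inj[OF _ J0(1), of J] that by metis
  ultimately show ?case by blast
qed

section \<open>Admissible words and their excess\<close>

fun lead_val :: "nat \<Rightarrow> gen list \<Rightarrow> nat" where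
  "lead_val p [] = 0"
| "lead_val p (P a # w) = p * a"
| "lead_val p (B # w) = Suc (lead_val p w)"

text \<open>One recursion for both primes: \<open>lead_val\<close> of the tail is p i' + \<epsilon>,
  so its comparison with a is the admissibility inequality; for p = 2 the letter \<open>B\<close> is
  excluded.\<close>

fun adm_word :: "nat \<Rightarrow> gen list \<Rightarrow> bool" where
  "adm_word p [] = True"
| "adm_word p (P a # w) = (1 \<le> a \<and> lead_val p w \<le> a \<and> adm_word p w)"
| "adm_word p (B # w) = (p \<noteq> 2 \<and> (w = [] \<or> hd w \<noteq> B) \<and> adm_word p w)"

definition word_exc_scale :: "nat \<Rightarrow> int" where
  "word_exc_scale p = (if p = 2 then 1 else 2)"

text \<open>The telescoped form of the excess; \<open>word_exc_word2\<close> and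
  \<open>word_exc_wordP\<close> identify it with the defining sums.\<close>

definition word_exc :: "nat \<Rightarrow> gen list \<Rightarrow> int" where
  "word_exc p w = word_exc_scale p * int (lead_val p w) - int (wdeg p w)"

lemma wdeg_Nil [simp]: "wdeg p [] = 0"
  and wdeg_Cons [simp]: "wdeg p (g # w) = gdeg p g + wdeg p w"
  and wdeg_append [simp]: "wdeg p (u @ w) = wdeg p u + wdeg p w"
  by (simp_all add: wdeg_def)

lemma all_nat_split: "(\<forall>s::nat. R s) \<longleftrightarrow> R 0 \<and> (\<forall>s. R (Suc s))"
  by (metis not0_implies_Suc)

lemma adm2_Cons: "adm2 (j # js) \<longleftrightarrow> 1 \<le> j \<and> (js \<noteq> [] \<longrightarrow> 2 * hd js \<le> j) \<and> adm2 js"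
  unfolding adm2_def by (subst (1 2) all_nat_split) (auto simp: hd_conv_nth)

lemma excess2_Cons: "excess2 (j # js) = int j - 2 * int (if js = [] then 0 else hd js) + excess2 js"
  unfolding excess2_def by (simp add: sum.lessThan_Suc_shift nxt_def hd_conv_nth del: sum.lessThan_Suc cong: if_cong)

lemma admP_Cons: "admP p e0 ((i, e) # ps) \<longleftrightarrow>
    e0 \<le> 1 \<and> 1 \<le> i \<and> e \<le> 1 \<and> (ps \<noteq> [] \<longrightarrow> p * fst (hd ps) + e \<le> i) \<and> admP p e ps"
  unfolding admP_def by (subst (1 2) all_nat_split) (auto simp: hd_conv_nth)

lemma excessP_Cons: "excessP p e0 ((i, e) # ps) =
    int e0 + 2 * (int i - int p * int (if ps = [] then 0 else fst (hd ps)) - int e) + excessP p e ps"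
  unfolding excessP_def
  by (simp add: sum.lessThan_Suc_shift nxtP_def hd_conv_nth algebra_simps del: sum.lessThan_Suc cong: if_cong)

lemma wordP_Cons: "wordP e0 ((i, e) # ps) = replicate e0 B @ P i # wordP e ps"
  by (simp add: wordP_def)

lemma lead_val_replicate: "lead_val p (replicate e B @ w) = e + lead_val p w"
  by (induction e) simp_all

lemma lead_val_replicate_B: "lead_val p (replicate e B) = e"
  by (induction e) simp_all

lemma lead_val_wordP: "lead_val p (wordP e0 ps) = e0 + (if ps = [] then 0 else p * fst (hd ps))"
  by (cases ps) (auto simp: wordP_def lead_val_replicate lead_val_replicate_B split: prod.splits)

lemma word_exc_word2: "excess2 js = word_exc 2 (word2 js)"
proof (induction js)
  case Nil
  then show ?case by (simp add: excess2_def word2_def word_exc_def)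
next
  case (Cons j js)
  then show ?case
    by (cases js) (simp_all add: excess2_Cons word2_def word_exc_def word_exc_scale_def)
qed

lemma adm_word_word2: "adm2 js \<Longrightarrow> adm_word 2 (word2 js)"
proof (induction js)
  case (Cons j js)
  then show ?case by (cases js) (simp_all add: adm2_Cons word2_def)
qed (simp add: word2_def)

lemma adm_word_2_obtain: "adm_word 2 w \<Longrightarrow> \<exists>js. w = word2 js \<and> adm2 js"
proof (induction w)
  case Nil
  then show ?case by (auto simp: word2_def adm2_def)
next
  case (Cons g w)
  then obtain a where g: "g = P a" by (cases g) auto
  with Cons obtain js where "w = word2 js" "adm2 js" by auto
  with Cons(2) g have "g # w = word2 (a # js)" "adm2 (a # js)"
    by (auto simp: word2_def adm2_Cons neq_Nil_conv)
  then show ?case by blast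
qed

lemma wdeg_replicate: "wdeg p (replicate e B) = e"
  by (induction e) simp_all

lemma word_exc_wordP:
  assumes "p \<noteq> 2" "1 \<le> p"
  shows "excessP p e0 ps = word_exc p (wordP e0 ps)"
proof (induction ps arbitrary: e0)
  case Nil
  then show ?case using assms by (simp add: excessP_def word_exc_def wordP_def lead_val_replicate_B wdeg_replicate word_exc_scale_def)
next
  case (Cons x ps)
  obtain i e where x: "x = (i, e)" by (cases x)
  have "word_exc p (wordP e ps) = 2 * (int e + (if ps = [] then 0 else int p * int (fst (hd ps)))) - int (wdeg p (wordP e ps))"
    using assms(1) by (simp add: word_exc_def word_exc_scale_def lead_val_wordP)
  moreover have "int (wdeg p (wordP e0 (x # ps))) = int e0 + 2 * int i * (int p - 1) + int (wdeg p (wordP e ps))"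
    using assms by (simp add: x wordP_Cons wdeg_replicate of_nat_diff)
  moreover have "int (lead_val p (wordP e0 (x # ps))) = int e0 + int p * int i"
    by (simp add: x lead_val_wordP)
  ultimately show ?case
    using assms(1) unfolding x excessP_Cons Cons.IH
    by (cases "ps = []") (simp_all add: word_exc_def word_exc_scale_def algebra_simps)
qed

lemma adm_word_replicate_P: "e \<le> 1 \<Longrightarrow> p \<noteq> 2 \<Longrightarrow> adm_word p (P a # w) \<Longrightarrow> adm_word p (replicate e B @ P a # w)"
  by (cases e) auto

lemma adm_word_wordP: "p \<noteq> 2 \<Longrightarrow> admP p e0 ps \<Longrightarrow> adm_word p (wordP e0 ps)"
proof (induction ps arbitrary: e0)
  case Nil
  then have "e0 = 0 \<or> e0 = 1" by (auto simp: admP_def)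
  then show ?case using Nil by (auto simp: wordP_def)
next
  case (Cons x ps)
  obtain i e where x: "x = (i, e)" by (cases x)
  have a: "e0 \<le> 1" "1 \<le> i" "e \<le> 1" "ps \<noteq> [] \<longrightarrow> p * fst (hd ps) + e \<le> i" "admP p e ps"
    using Cons.prems(2) unfolding x admP_Cons by auto
  then have "adm_word p (wordP e ps)" using Cons by blast
  moreover have "lead_val p (wordP e ps) \<le> i" using a unfolding lead_val_wordP by (auto split: if_splits)
  ultimately show ?case
    unfolding x wordP_Cons using a Cons.prems(1) by (intro adm_word_replicate_P) auto
qed

text \<open>Words without \<open>B\<close> are the case in which all exponents of \<beta> vanish, so
  the encoding by pairs serves p = 2 as well and independence is proved once for all primes.\<close>

lemma adm_word_obtain: "adm_word p w \<Longrightarrow> \<exists>e0 ps. w = wordP e0 ps \<and> admP p e0 ps \<and>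
    (p = 2 \<longrightarrow> e0 = 0 \<and> (\<forall>x\<in>set ps. snd x = 0))"
proof (induction w)
  case Nil
  then show ?case by (intro exI[of _ 0] exI[of _ "[]"]) (simp add: wordP_def admP_def)
next
  case (Cons g w)
  obtain e0 ps where w: "w = wordP e0 ps" "admP p e0 ps" "p = 2 \<longrightarrow> e0 = 0 \<and> (\<forall>x\<in>set ps. snd x = 0)"
    using Cons by (cases g) auto
  have "e0 \<le> 1" using w(2) by (simp add: admP_def)
  show ?case
  proof (cases g)
    case (P a)
    then have "1 \<le> a" "e0 + (if ps = [] then 0 else p * fst (hd ps)) \<le> a"
      using Cons.prems unfolding w(1) by (auto simp: lead_val_wordP)
    then have "admP p 0 ((a, e0) # ps)"
      unfolding admP_Cons using w(2) \<open>e0 \<le> 1\<close> by auto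
    then show ?thesis
      using w P by (intro exI[of _ 0] exI[of _ "(a, e0) # ps"]) (simp add: wordP_Cons)
  next
    case B
    have "e0 = 0"
    proof (rule ccontr)
      assume "e0 \<noteq> 0"
      then have "hd w = B" "w \<noteq> []" unfolding w(1) by (cases e0; simp add: wordP_def)+
      then show False using Cons.prems B by auto
    qed
    then show ?thesis
      using w B Cons.prems by (intro exI[of _ 1] exI[of _ ps]) (auto simp: wordP_def admP_def)
  qed
qed

lemma adm_exc_eq:
  assumes "prime p"
  shows "adm_exc p i = wmono ` {w. adm_word p w \<and> i \<le> word_exc p w}"
proof (cases "p = 2")
  case True
  then show ?thesis
    unfolding adm_exc_def by (auto simp: word_exc_word2 adm_word_word2 dest!: adm_word_2_obtain)
next
  case False
  have p: "1 \<le> p" using prime_gt_0_nat[OF assms] by simp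
  have "wmono w \<in> {wmono (wordP e0 ps) |e0 ps. admP p e0 ps \<and> i \<le> excessP p e0 ps}"
    if "adm_word p w" "i \<le> word_exc p w" for w
    using adm_word_obtain[OF that(1)] that(2) word_exc_wordP[OF False p] by fastforce
  then show ?thesis
    unfolding adm_exc_def using False adm_word_wordP word_exc_wordP[OF False p] by fastforce
qed

section \<open>Padding admissible monomials to a common length\<close>

definition int_pairs :: "(nat \<times> nat) list \<Rightarrow> (int \<times> nat) list" where
  "int_pairs = map (\<lambda>(i, e). (int i, e))"

text \<open>The second hypothesis keeps \<open>B\<close> away for p = 2, where \<open>act\<close>
  reads it as Sq^1 while \<open>opB_if\<close> applies \<beta>.\<close>

lemma act_wordP:
  assumes "admP p e0 ps" "p = 2 \<longrightarrow> e0 = 0 \<and> (\<forall>x\<in>set ps. snd x = 0)"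
  shows "act p (wordP e0 ps) \<phi> = act_pairs p (int_pairs ps) (opB_if e0 \<phi>)"
  using assms
proof (induction ps arbitrary: e0 \<phi>)
  case Nil
  then have "e0 = 0 \<or> e0 = 1" by (auto simp: admP_def)
  then show ?case using Nil by (auto simp: wordP_def int_pairs_def opB_if_def)
next
  case (Cons x ps)
  obtain i e where x: "x = (i, e)" by (cases x)
  have a: "e0 = 0 \<or> e0 = 1" "admP p e ps" using Cons.prems(1) unfolding x admP_Cons by auto
  have "act p (wordP e ps) (opP p (int i) (opB_if e0 \<phi>)) = act_pairs p (int_pairs ps) (opB_if e (opP p (int i) (opB_if e0 \<phi>)))"
    using Cons.IH[OF a(2)] Cons.prems(2) x by simp
  moreover have "act p (wordP e0 (x # ps)) \<phi> = act p (wordP e ps) (opP p (int i) (opB_if e0 \<phi>))"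
    using a(1) Cons.prems(2) by (auto simp: x wordP_Cons opB_if_def)
  ultimately show ?case by (simp add: x int_pairs_def)
qed

lemma act_pairs_replicate:
  assumes "0 < p"
  shows "act_pairs p (replicate n (0, 0)) \<phi> = \<phi>"
proof (induction n arbitrary: \<phi>)
  case (Suc n)
  have "opP p 0 \<phi> = \<phi>" by (rule ext) (rule opP_zero[OF assms])
  with Suc show ?case by (simp add: opB_if_def)
qed simp

lemma hd_exp_pad: "hd_exp (int_pairs ps @ replicate n (0, 0)) = (if ps = [] then 0 else int (fst (hd ps)))"
  by (cases ps; cases n) (auto simp: int_pairs_def split: prod.splits)

lemma adm_pairs_replicate: "adm_pairs p (replicate n (0, 0))"
proof (induction n)
  case (Suc n)
  then show ?case by (cases n) simp_all
qed simp

lemma adm_pairs_pad: "admP p e0 ps \<Longrightarrow> adm_pairs p (int_pairs ps @ replicate n (0, 0))"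
proof (induction ps arbitrary: e0)
  case Nil
  then show ?case by (simp add: int_pairs_def adm_pairs_replicate)
next
  case (Cons x ps)
  obtain i e where x: "x = (i, e)" by (cases x)
  have a: "1 \<le> i" "e \<le> 1" "ps \<noteq> [] \<longrightarrow> p * fst (hd ps) + e \<le> i" "admP p e ps"
    using Cons.prems unfolding x admP_Cons by auto
  have "int p * hd_exp (int_pairs ps @ replicate n (0, 0)) + int e \<le> int i"
    using a unfolding hd_exp_pad by (auto simp flip: of_nat_mult of_nat_add)
  then show ?case using Cons.IH[OF a(4)] a(2) by (simp add: x int_pairs_def)
qed

text \<open>Exponents of admissible monomials are positive, so the padding begins at the first zero
  exponent.\<close>

lemma pad_inj:
  assumes "admP p e0 ps" "admP p e0' qs"
    and "int_pairs ps @ replicate m (0, 0) = int_pairs qs @ replicate n (0, 0)"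
  shows "ps = qs"
proof -
  have tw: "takeWhile (\<lambda>x. fst x \<noteq> 0) (int_pairs ps @ replicate m (0, 0)) = int_pairs ps" if "admP p e0 ps" for ps e0 m
  proof -
    have "\<forall>x\<in>set (int_pairs ps). fst x \<noteq> 0"
      using that unfolding admP_def int_pairs_def by (fastforce simp: in_set_conv_nth)
    then have "takeWhile (\<lambda>x. fst x \<noteq> 0) (int_pairs ps @ replicate m (0, 0))
      = int_pairs ps @ takeWhile (\<lambda>x. fst x \<noteq> 0) (replicate m (0, 0))"
      by (intro takeWhile_append2) blast
    also have "takeWhile (\<lambda>x. fst x \<noteq> 0) (replicate m (0 :: int, 0 :: nat)) = []"
      by (cases m) simp_all
    finally show ?thesis by simp
  qed
  have "int_pairs ps = int_pairs qs" using tw[OF assms(1)] tw[OF assms(2)] assms(3) by metis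
  moreover have "inj (\<lambda>(i, e). (int i, e :: nat))" by (auto simp: inj_def)
  ultimately show ?thesis unfolding int_pairs_def by (metis inj_map_eq_map)
qed

text \<open>Independence over F_p, put as divisibility because the coefficients are integers. A
  functional that sees just one of the monomials with nonzero residue turns
  \<open>act_steen_ideal\<close> into divisibility of its coefficient, a contradiction.\<close>

theorem adm_word_independent:
  assumes p: "prime p" and y: "Poly_Mapping.keys y \<subseteq> {w. adm_word p w}" and "y \<in> steen_ideal p"
  shows "int p dvd Poly_Mapping.lookup y w"
proof (rule ccontr)
  assume w: "\<not> int p dvd Poly_Mapping.lookup y w"
  have p0: "0 < p" using p by (simp add: prime_gt_0_nat)
  \<comment> \<open>Words whose coefficient is divisible by p contribute multiples of p to the
    pairing, so only the remaining ones have to be separated.\<close>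
  define K where "K = {w \<in> Poly_Mapping.keys y. \<not> int p dvd Poly_Mapping.lookup y w}"
  have "w \<in> Poly_Mapping.keys y" using w by (metis dvd_0_right in_keys_iff)
  then have wK: "w \<in> K" using w by (simp add: K_def)
  have finK: "finite K" by (simp add: K_def)
  have "\<forall>w. \<exists>x. adm_word p w \<longrightarrow> w = wordP (fst x) (snd x) \<and> admP p (fst x) (snd x) \<and>
    (p = 2 \<longrightarrow> fst x = 0 \<and> (\<forall>z\<in>set (snd x). snd z = 0))"
    using adm_word_obtain[of p] by (metis fst_conv snd_conv)
  then obtain code where code: "\<And>w. adm_word p w \<Longrightarrow> w = wordP (fst (code w)) (snd (code w)) \<and> admP p (fst (code w)) (snd (code w)) \<and>
    (p = 2 \<longrightarrow> fst (code w) = 0 \<and> (\<forall>z\<in>set (snd (code w)). snd z = 0))"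
    by metis
  define R where "R = Max ((\<lambda>w. length (snd (code w))) ` K)"
  have R: "length (snd (code w)) \<le> R" if "w \<in> K" for w
    unfolding R_def using finK that by (intro Max_ge) auto
  define J where "J = (\<lambda>w. (fst (code w), int_pairs (snd (code w)) @ replicate (R - length (snd (code w))) (0 :: int, 0 :: nat)))"
  have adK: "adm_word p w" if "w \<in> K" for w using that y unfolding K_def by auto
  have act: "act p w \<phi> f = act_pairs p (snd (J w)) (opB_if (fst (J w)) \<phi>) f" if "w \<in> K" for w \<phi> f
  proof -
    have "act p w \<phi> f = act p (wordP (fst (code w)) (snd (code w))) \<phi> f"
      using code[OF adK[OF that]] by metis
    also have "\<dots> = act_pairs p (int_pairs (snd (code w))) (opB_if (fst (code w)) \<phi>) f"
      by (intro fun_cong[OF act_wordP]) (use code[OF adK[OF that]] in blast)+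
    also have "\<dots> = act_pairs p (snd (J w)) (opB_if (fst (J w)) \<phi>) f"
      by (simp add: J_def act_pairs_append act_pairs_replicate[OF p0])
    finally show ?thesis .
  qed
  have inj: "w = w'" if "w \<in> K" "w' \<in> K" "J w = J w'" for w w'
  proof -
    have "snd (code w) = snd (code w')" "fst (code w) = fst (code w')"
      using pad_inj code[OF adK[OF that(1)]] code[OF adK[OF that(2)]] that(3) unfolding J_def by auto
    then show ?thesis using code[OF adK[OF that(1)]] code[OF adK[OF that(2)]] by simp
  qed
  have "\<exists>J0\<in>J ` K. \<exists>\<phi> f. act_pairs p (snd J0) (opB_if (fst J0) \<phi>) f = 1 \<and>
       (\<forall>J\<in>J ` K. J \<noteq> J0 \<longrightarrow> act_pairs p (snd J) (opB_if (fst J) \<phi>) f = 0)"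
  proof (rule act_pairs_separation[OF p0])
    fix e0 l assume "(e0, l) \<in> J ` K"
    then obtain w where w: "w \<in> K" "(e0, l) = J w" by auto
    show "e0 \<le> 1 \<and> adm_pairs p l \<and> length l = R"
      using w(2) code[OF adK[OF w(1)]] R[OF w(1)] adm_pairs_pad
      unfolding J_def by (auto simp: admP_def int_pairs_def)
  qed (use finK wK in auto)
  then obtain w0 \<phi> f where w0: "w0 \<in> K" "act p w0 \<phi> f = 1"
    and others: "\<And>w. w \<in> K \<Longrightarrow> w \<noteq> w0 \<Longrightarrow> act p w \<phi> f = 0"
    using act inj by (smt (verit, best) imageE imageI)
  have "int p dvd pairing (\<lambda>w. act p w \<phi> f) y"
    by (rule act_steen_ideal[OF p assms(3)])
  also have "pairing (\<lambda>w. act p w \<phi> f) y = Poly_Mapping.lookup y w0 * act p w0 \<phi> f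
      + (\<Sum>w\<in>Poly_Mapping.keys y - {w0}. Poly_Mapping.lookup y w * act p w \<phi> f)"
    unfolding pairing_def using w0(1) by (intro sum.remove) (simp_all add: K_def)
  finally have d: "int p dvd \<dots>" .
  have "int p dvd (\<Sum>w\<in>Poly_Mapping.keys y - {w0}. Poly_Mapping.lookup y w * act p w \<phi> f)"
  proof (rule dvd_sum)
    fix w assume "w \<in> Poly_Mapping.keys y - {w0}"
    then show "int p dvd Poly_Mapping.lookup y w * act p w \<phi> f"
      using others[of w] by (cases "w \<in> K") (auto simp: K_def)
  qed
  with d have "int p dvd Poly_Mapping.lookup y w0"
    using w0(2) by (simp add: dvd_add_left_iff)
  then show False using w0(1) by (simp add: K_def)
qed

section \<open>Spanning by admissible monomials\<close>

lemma ideal_zero: "0 \<in> steen_ideal p"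
  using steen_ideal.char[of p 0] by simp

lemma fmul_Nil_left: "fmul (frag_of []) x = x"
  by (simp add: fmul_eq_frag_extend frag_expansion[symmetric])

lemma ideal_cmul: "x \<in> steen_ideal p \<Longrightarrow> frag_cmul c x \<in> steen_ideal p"
  using steen_ideal.lmul[of x p "frag_cmul c (frag_of [])"]
  by (simp add: fmul_cmul_left fmul_Nil_left)

lemma ideal_diff: "x \<in> steen_ideal p \<Longrightarrow> y \<in> steen_ideal p \<Longrightarrow> x - y \<in> steen_ideal p"
  using steen_ideal.add[of x p "- y"] ideal_cmul[of y p "- 1"] by simp

lemma ideal_sum: "(\<And>i. i \<in> I \<Longrightarrow> g i \<in> steen_ideal p) \<Longrightarrow> sum g I \<in> steen_ideal p"
  by (induction I rule: infinite_finite_induct) (auto simp: ideal_zero steen_ideal.add)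

lemma ideal_dvd:
  assumes "\<And>w. int p dvd Poly_Mapping.lookup y w"
  shows "y \<in> steen_ideal p"
proof -
  have "frag_extend frag_of y \<in> steen_ideal p"
    unfolding frag_extend_def
  proof (rule ideal_sum)
    fix w
    obtain k where "Poly_Mapping.lookup y w = int p * k" using assms by (rule dvdE)
    then have "frag_cmul (Poly_Mapping.lookup y w) (frag_of w) = frag_cmul (int p) (frag_cmul k (frag_of w))"
      by simp
    then show "frag_cmul (Poly_Mapping.lookup y w) (frag_of w) \<in> steen_ideal p"
      by (simp only: steen_ideal.char)
  qed
  then show ?thesis by (simp add: frag_expansion[symmetric])
qed

text \<open>The F_p-span of X in the quotient algebra, expressed through integral
  representatives.\<close>

definition spanned :: "nat \<Rightarrow> gen list set \<Rightarrow> falg set" where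
  "spanned p X = {x. \<exists>y. Poly_Mapping.keys y \<subseteq> X \<and> x - y \<in> steen_ideal p}"

lemma spannedI: "Poly_Mapping.keys y \<subseteq> X \<Longrightarrow> x - y \<in> steen_ideal p \<Longrightarrow> x \<in> spanned p X"
  by (auto simp: spanned_def)

lemma spannedE:
  assumes "x \<in> spanned p X"
  obtains y where "Poly_Mapping.keys y \<subseteq> X" "x - y \<in> steen_ideal p"
  using assms by (auto simp: spanned_def)

lemma spanned_mono: "X \<subseteq> Y \<Longrightarrow> x \<in> spanned p X \<Longrightarrow> x \<in> spanned p Y"
  by (auto simp: spanned_def)

lemma spanned_ideal: "x \<in> steen_ideal p \<Longrightarrow> x \<in> spanned p X"
  by (rule spannedI[of 0]) simp_all

lemma spanned_frag_of: "w \<in> X \<Longrightarrow> frag_of w \<in> spanned p X"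
  by (rule spannedI[of "frag_of w"]) (simp_all add: ideal_zero)

lemma spanned_zero: "0 \<in> spanned p X"
  by (rule spanned_ideal[OF ideal_zero])

lemma spanned_add:
  assumes "x \<in> spanned p X" "x' \<in> spanned p X"
  shows "x + x' \<in> spanned p X"
proof -
  obtain y y' where "Poly_Mapping.keys y \<subseteq> X" "x - y \<in> steen_ideal p"
    "Poly_Mapping.keys y' \<subseteq> X" "x' - y' \<in> steen_ideal p"
    using assms by (elim spannedE)
  then show ?thesis
    using keys_add[of y y'] steen_ideal.add[of "x - y" p "x' - y'"]
    by (intro spannedI[of "y + y'"]) (auto simp: algebra_simps)
qed

lemma spanned_cmul:
  assumes "x \<in> spanned p X"
  shows "frag_cmul c x \<in> spanned p X"
proof -
  obtain y where "Poly_Mapping.keys y \<subseteq> X" "x - y \<in> steen_ideal p"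
    using assms by (elim spannedE)
  then show ?thesis
    using ideal_cmul[of "x - y" p c] keys_cmul[of c y]
    by (intro spannedI[of "frag_cmul c y"]) (auto simp: frag_cmul_diff_distrib2)
qed

lemma spanned_diff: "x \<in> spanned p X \<Longrightarrow> x' \<in> spanned p X \<Longrightarrow> x - x' \<in> spanned p X"
  using spanned_add[of x p X "- x'"] spanned_cmul[of x' p X "- 1"] by simp

lemma spanned_sum: "(\<And>i. i \<in> I \<Longrightarrow> g i \<in> spanned p X) \<Longrightarrow> sum g I \<in> spanned p X"
  by (induction I rule: infinite_finite_induct) (auto simp: spanned_zero spanned_add)

lemma spanned_keys: "Poly_Mapping.keys y \<subseteq> X \<Longrightarrow> y \<in> spanned p X"
  by (rule spannedI[of y]) (simp_all add: ideal_zero)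

lemma spanned_cong: "x - x' \<in> steen_ideal p \<Longrightarrow> x' \<in> spanned p X \<Longrightarrow> x \<in> spanned p X"
  using spanned_add[of "x - x'" p X x'] spanned_ideal[of "x - x'" p X] by simp

lemma spanned_frag_extend:
  assumes "Poly_Mapping.keys y \<subseteq> X" "\<And>w. w \<in> X \<Longrightarrow> h w \<in> spanned p Y"
  shows "frag_extend h y \<in> spanned p Y"
  using assms(1) by (induction y rule: frag_induction)
    (auto simp: frag_extend_diff intro: spanned_zero spanned_diff assms(2))

lemma fmul_frag_of_left: "fmul (frag_of u) x = frag_extend (\<lambda>v. frag_of (u @ v)) x"
  by (simp add: fmul_eq_frag_extend)

lemma spanned_lmul:
  assumes "x \<in> spanned p X" "\<And>w. w \<in> X \<Longrightarrow> frag_of (u @ w) \<in> spanned p Y"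
  shows "fmul (frag_of u) x \<in> spanned p Y"
proof -
  obtain y where y: "Poly_Mapping.keys y \<subseteq> X" "x - y \<in> steen_ideal p"
    using assms(1) by (elim spannedE)
  have "fmul (frag_of u) x - fmul (frag_of u) y \<in> steen_ideal p"
    using steen_ideal.lmul[OF y(2)] by (simp add: fmul_diff_right)
  moreover have "fmul (frag_of u) y \<in> spanned p Y"
    unfolding fmul_frag_of_left using y(1) assms(2) by (rule spanned_frag_extend)
  ultimately show ?thesis by (rule spanned_cong)
qed

lemma spanned_append:
  "frag_of v \<in> spanned p X \<Longrightarrow> (\<And>w. w \<in> X \<Longrightarrow> frag_of (u @ w) \<in> spanned p Y) \<Longrightarrow> frag_of (u @ v) \<in> spanned p Y"
  using spanned_lmul[of "frag_of v" p X u Y] by (simp add: fmul_frag_of)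

section \<open>Straightening words by the Adem relations\<close>

definition adm_words :: "nat \<Rightarrow> nat \<Rightarrow> nat \<Rightarrow> gen list set" where
  "adm_words p D l = {w. adm_word p w \<and> wdeg p w = D \<and> l \<le> lead_val p w}"

lemma adm_words_mono: "l' \<le> l \<Longrightarrow> adm_words p D l \<subseteq> adm_words p D l'"
  by (auto simp: adm_words_def)

definition pdeg :: "nat \<Rightarrow> nat" where
  "pdeg p = (if p = 2 then 1 else 2 * (p - 1))"

lemma gdeg_P [simp]: "gdeg p (P a) = a * pdeg p"
  by (simp add: pdeg_def)

declare gdeg.simps(2) [simp del]

lemma pdeg_pos: "prime p \<Longrightarrow> 0 < pdeg p"
  by (auto simp: pdeg_def dest: prime_gt_1_nat)

lemma ideal_P0: "frag_of (P 0 # w) - frag_of w \<in> steen_ideal p"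
proof -
  have "wmono [P 0] - wmono [] \<in> steen_ideal p"
    by (rule steen_ideal.rel) (simp add: steen_rels_def)
  from steen_ideal.rmul[OF this, of "frag_of w"] show ?thesis
    by (simp add: wmono_eq_frag_of fmul_diff_left fmul_frag_of)
qed

lemma ideal_B_2: "frag_of (B # w) - frag_of (P 1 # w) \<in> steen_ideal 2"
proof -
  have "wmono [B] - wmono [P 1] \<in> steen_ideal 2"
    by (rule steen_ideal.rel) (simp add: steen_rels_def)
  from steen_ideal.rmul[OF this, of "frag_of w"] show ?thesis
    by (simp add: wmono_eq_frag_of fmul_diff_left fmul_frag_of)
qed

lemma ideal_BB: "p \<noteq> 2 \<Longrightarrow> frag_of (B # B # w) \<in> steen_ideal p"
proof -
  assume "p \<noteq> 2"
  then have "wmono [B, B] \<in> steen_ideal p"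
    by (intro steen_ideal.rel) (simp add: steen_rels_def)
  from steen_ideal.rmul[OF this, of "frag_of w"] show ?thesis
    by (simp add: wmono_eq_frag_of fmul_frag_of)
qed

text \<open>What is kept of the relation is its shape: the range of t, and coefficients that are
  uniform in the tail w.\<close>

lemma ideal_adem:
  assumes "0 < a" "a < p * b"
  shows "\<exists>k. \<forall>w. frag_of (P a # P b # w) - (\<Sum>t\<in>{0..a div p}. frag_cmul (k t) (frag_of (P (a + b - t) # P t # w))) \<in> steen_ideal p"
proof -
  have "0 < b" using assms by (cases b) auto
  have "\<exists>k. wmono [P a, P b] - (\<Sum>t\<in>{0..a div p}. cmono (k t) [P (a + b - t), P t]) \<in> steen_ideal p"
  proof (cases "p = 2")
    case True
    then have "adem2 a b \<in> steen_ideal p"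
      using assms by (intro steen_ideal.rel) (auto simp: steen_rels_def)
    then show ?thesis unfolding adem2_def True
      by (rule exI[of _ "\<lambda>t. cb (int b - int t - 1) (int a - 2 * int t)"])
  next
    case False
    then have "ademP p a b \<in> steen_ideal p"
      using assms \<open>0 < b\<close> by (intro steen_ideal.rel) (auto simp: steen_rels_def)
    then show ?thesis unfolding ademP_def
      by (rule exI[of _ "\<lambda>t. (- 1) ^ (a + t) * cb ((int p - 1) * (int b - int t) - 1) (int a - int p * int t)"])
  qed
  then obtain k where k: "wmono [P a, P b] - (\<Sum>t\<in>{0..a div p}. cmono (k t) [P (a + b - t), P t]) \<in> steen_ideal p" ..
  show ?thesis
  proof (intro exI[of _ k] allI)
    fix w
    show "frag_of (P a # P b # w) - (\<Sum>t\<in>{0..a div p}. frag_cmul (k t) (frag_of (P (a + b - t) # P t # w))) \<in> steen_ideal p"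
      using steen_ideal.rmul[OF k, of "frag_of w"]
      by (simp add: wmono_eq_frag_of cmono_eq fmul_diff_left fmul_sum_left fmul_cmul_left fmul_frag_of)
  qed
qed

text \<open>For a = p b the index t = b occurs, and its word P^a \<beta> P^b is the one to be
  rewritten. Its coefficient \<open>l b\<close> is 0, the upper binomial entry being -1; otherwise
  rewriting would be circular.\<close>

lemma ideal_ademB:
  assumes "p \<noteq> 2" "0 < a" "0 < b" "a \<le> p * b"
  shows "\<exists>k l. l b = 0 \<and> (\<forall>w. frag_of (P a # B # P b # w)
      - (\<Sum>t\<in>{0..a div p}. frag_cmul (k t) (frag_of (B # P (a + b - t) # P t # w)))
      - (\<Sum>t\<in>{0..a div p}. frag_cmul (l t) (frag_of (P (a + b - t) # B # P t # w))) \<in> steen_ideal p)"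
proof -
  define k where "k = (\<lambda>t. (- 1) ^ (a + t) * cb ((int p - 1) * (int b - int t)) (int a - int p * int t))"
  define l where "l = (\<lambda>t. (- 1) ^ (a + t + 1) * cb ((int p - 1) * (int b - int t) - 1) (int a - int p * int t - 1))"
  have "ademPB p a b \<in> steen_ideal p"
    using assms by (intro steen_ideal.rel) (auto simp: steen_rels_def)
  then have r: "wmono [P a, B, P b] - (\<Sum>t\<in>{0..a div p}. cmono (k t) [B, P (a + b - t), P t])
     - (\<Sum>t\<in>{0..a div p}. cmono (l t) [P (a + b - t), B, P t]) \<in> steen_ideal p"
    unfolding ademPB_def k_def l_def .
  show ?thesis
  proof (rule exI[of _ k], rule exI[of _ l], intro conjI allI)
    show "l b = 0" by (simp add: l_def cb_def)
    fix w
    show "frag_of (P a # B # P b # w)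
      - (\<Sum>t\<in>{0..a div p}. frag_cmul (k t) (frag_of (B # P (a + b - t) # P t # w)))
      - (\<Sum>t\<in>{0..a div p}. frag_cmul (l t) (frag_of (P (a + b - t) # B # P t # w))) \<in> steen_ideal p"
      using steen_ideal.rmul[OF r, of "frag_of w"]
      by (simp add: wmono_eq_frag_of cmono_eq fmul_diff_left fmul_sum_left fmul_cmul_left fmul_frag_of)
  qed
qed

lemma B_spanned:
  assumes "p \<noteq> 2" "frag_of v \<in> spanned p (adm_words p D l)"
  shows "frag_of (B # v) \<in> spanned p (adm_words p (Suc D) (Suc l))"
proof -
  have "frag_of ([B] @ w) \<in> spanned p (adm_words p (Suc D) (Suc l))" if w: "w \<in> adm_words p D l" for w
  proof (cases "w = [] \<or> hd w \<noteq> B")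
    case True
    then show ?thesis using w assms(1) by (intro spanned_frag_of) (auto simp: adm_words_def)
  next
    case False
    then obtain w' where "w = B # w'" by (cases w) auto
    then show ?thesis using ideal_BB[OF assms(1)] by (auto intro: spanned_ideal)
  qed
  from spanned_append[OF assms(2) this] show ?thesis by simp
qed

text \<open>Double induction, on the degree D and within it on D - c: rewriting leads to smaller
  degree or to a larger first exponent, which D bounds. The extra 1 records that straightening a
  product that is not admissible strictly raises the leading value.\<close>

lemma P_spanned_aux:
  assumes p: "prime p"
  shows "adm_word p b \<Longrightarrow> 1 \<le> c \<Longrightarrow> wdeg p (P c # b) = D \<Longrightarrow>
    frag_of (P c # b) \<in> spanned p (adm_words p D (if lead_val p b \<le> c then p * c else p * c + 1))"
proof (induction D arbitrary: b c rule: less_induct)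
  case (less D)
  note IH1 = less.IH
  show ?case
    using less.prems
  proof (induction "D - c" arbitrary: b c rule: less_induct)
    case (less c b)
    have p2: "2 \<le> p" using p by (simp add: prime_ge_2_nat)
    have g: "0 < pdeg p" by (rule pdeg_pos[OF p])
    have weak: "frag_of (P c' # b') \<in> spanned p (adm_words p D' l)"
      if "frag_of (P c' # b') \<in> spanned p (adm_words p D' (if lead_val p b' \<le> c' then p * c' else p * c' + 1))" "l \<le> p * c'" for c' b' D' l
      by (rule spanned_mono[OF adm_words_mono that(1)]) (use that(2) in auto)
    have IHP: "frag_of (P c' # b') \<in> spanned p (adm_words p (wdeg p (P c' # b')) l)"
      if "adm_word p b'" "1 \<le> c'" "wdeg p (P c' # b') < D" "l \<le> p * c'" for c' b' l
      by (rule weak[OF IH1]) (use that in auto)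
    \<comment> \<open>A larger first exponent raises the leading value by at least p, hence by the 1
      that is wanted.\<close>
    have IHc: "frag_of (P c' # b') \<in> spanned p (adm_words p D (p * c + 1))"
      if "adm_word p b'" "c < c'" "wdeg p (P c' # b') = D" for c' b'
    proof (rule weak[OF less.hyps])
      have "c' \<le> c' * pdeg p" using g by simp
      also have "\<dots> \<le> D" using that(3) by simp
      finally have "c' \<le> D" .
      then show "D - c' < D - c" using that(2) by simp
      have "p * c + 1 \<le> p * Suc c" using p2 by simp
      also have "\<dots> \<le> p * c'" using that(2) by (intro mult_le_mono2) simp
      finally show "p * c + 1 \<le> p * c'" .
    qed (use that less.prems in auto)
    \<comment> \<open>The exponent t may be 0, and then the relation P^0 = 1 removes the
      letter.\<close>
    have Pt: "frag_of (P t # b') \<in> spanned p (adm_words p (wdeg p (P t # b')) 0)"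
      if "adm_word p b'" "wdeg p (P t # b') < D" for t b'
    proof (cases "t = 0")
      case True
      have "frag_of b' \<in> spanned p (adm_words p (wdeg p (P t # b')) 0)"
        by (rule spanned_frag_of) (use that True in \<open>simp add: adm_words_def\<close>)
      then show ?thesis using spanned_cong[OF ideal_P0] True by blast
    next
      case False
      then show ?thesis using IHP that by simp
    qed
    show ?case
    proof (cases "lead_val p b \<le> c")
      case True
      then show ?thesis using less.prems by (auto intro!: spanned_frag_of simp: adm_words_def)
    next
      case False
      have "frag_of (P c # b) \<in> spanned p (adm_words p D (p * c + 1))"
      proof (cases b)
        case Nil
        then show ?thesis using False by simp
      next
        case (Cons x b')
        show ?thesis
        proof (cases x)
          case (P d)
          have b: "b = P d # b'" using Cons P by simp
          have ad: "adm_word p b'" "1 \<le> d" using less.prems(1) b by auto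
          have cd: "c < p * d" using False b by simp
          have D: "D = (c + d) * pdeg p + wdeg p b'" using less.prems(3) b by (simp add: algebra_simps)
          have c0: "0 < c" using less.prems(2) by simp
          obtain k where "\<forall>w. frag_of (P c # P d # w) - (\<Sum>t\<in>{0..c div p}. frag_cmul (k t) (frag_of (P (c + d - t) # P t # w))) \<in> steen_ideal p"
            using ideal_adem[OF c0 cd] ..
          note k = this[rule_format, of b']
          have "(\<Sum>t\<in>{0..c div p}. frag_cmul (k t) (frag_of (P (c + d - t) # P t # b'))) \<in> spanned p (adm_words p D (p * c + 1))"
          proof (intro spanned_sum spanned_cmul)
            fix t assume "t \<in> {0..c div p}"
            then have "t \<le> c div p" by simp
            then have "p * t \<le> c" using p2 by (metis le_trans mult_le_mono2 times_div_less_eq_dividend)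
            \<comment> \<open>From p t \<le> c < p d; therefore the new first exponent c + d - t
              exceeds c.\<close>
            then have td: "t < d" using cd p2 by (metis le_less_trans mult_less_cancel1)
            then have "(c + d - t) * pdeg p + t * pdeg p = (c + d) * pdeg p"
              by (simp flip: add_mult_distrib)
            then have D': "D = (c + d - t) * pdeg p + wdeg p (P t # b')" unfolding D by simp
            have "0 < (c + d - t) * pdeg p" using g td by simp
            then have "wdeg p (P t # b') < D" using D' by simp
            from Pt[OF ad(1) this]
            have "frag_of ([P (c + d - t)] @ (P t # b')) \<in> spanned p (adm_words p D (p * c + 1))"
            proof (rule spanned_append)
              fix w assume "w \<in> adm_words p (wdeg p (P t # b')) 0"
              then have "adm_word p w" "wdeg p w = wdeg p (P t # b')" by (auto simp: adm_words_def)
              then show "frag_of ([P (c + d - t)] @ w) \<in> spanned p (adm_words p D (p * c + 1))"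
                using IHc[of w "c + d - t"] td D' by simp
            qed
            then show "frag_of (P (c + d - t) # P t # b') \<in> spanned p (adm_words p D (p * c + 1))" by simp
          qed
          with k show ?thesis unfolding b by (rule spanned_cong)
        next
          case B
          then have pn2: "p \<noteq> 2" using less.prems(1) Cons by auto
          have "b' \<noteq> []" using False B Cons less.prems(2) by auto
          moreover have "hd b' \<noteq> B" using less.prems(1) B Cons \<open>b' \<noteq> []\<close> by simp
          ultimately obtain d b'' where b': "b' = P d # b''" by (cases b'; cases "hd b'") auto
          have b: "b = B # P d # b''" using Cons B b' by simp
          have ad: "adm_word p b''" "1 \<le> d" using less.prems(1) b by auto
          have cd: "c \<le> p * d" using False b by simp
          have D: "D = Suc ((c + d) * pdeg p + wdeg p b'')" using less.prems(3) b by (simp add: algebra_simps)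
          have cd0: "0 < c" "0 < d" using less.prems(2) ad(2) by simp_all
          obtain k l where l: "l d = 0 \<and> (\<forall>w. frag_of (P c # B # P d # w)
      - (\<Sum>t\<in>{0..c div p}. frag_cmul (k t) (frag_of (B # P (c + d - t) # P t # w)))
      - (\<Sum>t\<in>{0..c div p}. frag_cmul (l t) (frag_of (P (c + d - t) # B # P t # w))) \<in> steen_ideal p)"
            using ideal_ademB[OF pn2 cd0 cd] by (elim exE)
          note k = conjunct2[OF l, rule_format, of b'']
          have td: "t \<le> d" if "t \<in> {0..c div p}" for t
          proof -
            have "t \<le> c div p" using that by simp
            then have "p * t \<le> c" using p2 by (metis le_trans mult_le_mono2 times_div_less_eq_dividend)
            then have "p * t \<le> p * d" using cd by (rule le_trans)
            then show ?thesis using p2 by simp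
          qed
          have D': "D = Suc ((c + d - t) * pdeg p + wdeg p (P t # b''))" if "t \<le> d" for t
          proof -
            have "(c + d - t) * pdeg p + t * pdeg p = (c + d) * pdeg p"
              using that by (simp flip: add_mult_distrib)
            then show ?thesis unfolding D by simp
          qed
          have lt: "wdeg p (P t # b'') < D" if "t \<le> d" for t using D'[OF that] by simp
          \<comment> \<open>The exponent c + d - t may equal c here, for t = d, but the \<beta> in
            front supplies the missing 1. The word behind it has degree D - 1, so the outer
            induction applies.\<close>
          have s1: "(\<Sum>t\<in>{0..c div p}. frag_cmul (k t) (frag_of (B # P (c + d - t) # P t # b''))) \<in> spanned p (adm_words p D (p * c + 1))"
          proof (intro spanned_sum spanned_cmul)
            fix t assume "t \<in> {0..c div p}"
            then have t: "t \<le> d" by (rule td)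
            from Pt[OF ad(1) lt[OF t]]
            have "frag_of ([P (c + d - t)] @ (P t # b'')) \<in> spanned p (adm_words p (D - 1) (p * c))"
            proof (rule spanned_append)
              fix w assume "w \<in> adm_words p (wdeg p (P t # b'')) 0"
              then have w: "adm_word p w" "wdeg p w = wdeg p (P t # b'')" by (auto simp: adm_words_def)
              have cc: "c \<le> c + d - t" using t by simp
              have "wdeg p (P (c + d - t) # w) = D - 1" using w(2) D'[OF t] by simp
              then show "frag_of ([P (c + d - t)] @ w) \<in> spanned p (adm_words p (D - 1) (p * c))"
                using IHP[of w "c + d - t" "p * c"] w(1) D less.prems(2) t cc by simp
            qed
            then have "frag_of (B # P (c + d - t) # P t # b'') \<in> spanned p (adm_words p (Suc (D - 1)) (Suc (p * c)))"
              using B_spanned[OF pn2] by simp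
            then show "frag_of (B # P (c + d - t) # P t # b'') \<in> spanned p (adm_words p D (p * c + 1))"
              using D by simp
          qed
          \<comment> \<open>Without a \<beta> in front the exponent itself has to grow; t = d is
            excluded by the zero coefficient.\<close>
          have s2: "(\<Sum>t\<in>{0..c div p}. frag_cmul (l t) (frag_of (P (c + d - t) # B # P t # b''))) \<in> spanned p (adm_words p D (p * c + 1))"
          proof (rule spanned_sum)
            fix t assume "t \<in> {0..c div p}"
            then have t: "t \<le> d" by (rule td)
            show "frag_cmul (l t) (frag_of (P (c + d - t) # B # P t # b'')) \<in> spanned p (adm_words p D (p * c + 1))"
            proof (cases "t = d")
              case True
              then show ?thesis using l by (simp add: spanned_zero)
            next
              case False
              from B_spanned[OF pn2 Pt[OF ad(1) lt[OF t]]]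
              have "frag_of ([P (c + d - t)] @ (B # P t # b'')) \<in> spanned p (adm_words p D (p * c + 1))"
              proof (rule spanned_append)
                fix w assume "w \<in> adm_words p (Suc (wdeg p (P t # b''))) (Suc 0)"
                then have "adm_word p w" "wdeg p w = Suc (wdeg p (P t # b''))" by (auto simp: adm_words_def)
                then show "frag_of ([P (c + d - t)] @ w) \<in> spanned p (adm_words p D (p * c + 1))"
                  using IHc[of w "c + d - t"] t False D'[OF t] by simp
              qed
              then show ?thesis using spanned_cmul by simp
            qed
          qed
          have "frag_of (P c # B # P d # b'')
            - ((\<Sum>t\<in>{0..c div p}. frag_cmul (k t) (frag_of (B # P (c + d - t) # P t # b'')))
             + (\<Sum>t\<in>{0..c div p}. frag_cmul (l t) (frag_of (P (c + d - t) # B # P t # b'')))) \<in> steen_ideal p"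
            using k by (simp only: diff_diff_eq)
          then show ?thesis unfolding b by (rule spanned_cong) (rule spanned_add[OF s1 s2])
        qed
      qed
      then show ?thesis using False by simp
    qed
  qed
qed

lemma P_spanned:
  assumes "prime p" "adm_word p b" "1 \<le> c"
  shows "frag_of (P c # b) \<in> spanned p (adm_words p (wdeg p (P c # b)) (if lead_val p b \<le> c then p * c else p * c + 1))"
  using P_spanned_aux[OF assms refl] .

lemma word_spanned:
  assumes p: "prime p"
  shows "frag_of w \<in> spanned p (adm_words p (wdeg p w) 0)"
proof (induction w)
  case Nil
  then show ?case by (intro spanned_frag_of) (simp add: adm_words_def)
next
  case (Cons g w)
  have P: "frag_of (P a # w) \<in> spanned p (adm_words p (wdeg p (P a # w)) 0)" for a
  proof -
    have "frag_of ([P a] @ w) \<in> spanned p (adm_words p (wdeg p (P a # w)) 0)"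
      using Cons.IH
    proof (rule spanned_append)
      fix v assume v: "v \<in> adm_words p (wdeg p w) 0"
      then have v': "adm_word p v" "wdeg p v = wdeg p w" by (auto simp: adm_words_def)
      show "frag_of ([P a] @ v) \<in> spanned p (adm_words p (wdeg p (P a # w)) 0)"
      proof (cases "a = 0")
        case True
        have "frag_of v \<in> spanned p (adm_words p (wdeg p (P a # w)) 0)"
          by (rule spanned_frag_of) (use v True in simp)
        then show ?thesis using spanned_cong[OF ideal_P0[of v]] True by simp
      next
        case False
        then show ?thesis
          using spanned_mono[OF adm_words_mono[OF le0] P_spanned[OF p v'(1), of a]] v'(2) by simp
      qed
    qed
    then show ?thesis by simp
  qed
  show ?case
  proof (cases g)
    case (P a)
    with \<open>\<And>a. frag_of (P a # w) \<in> _\<close> show ?thesis by simp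
  next
    case B
    show ?thesis
    proof (cases "p = 2")
      case True
      have "wdeg p (B # w) = wdeg p (P 1 # w)" using True by (simp add: pdeg_def)
      with P[of 1] have "frag_of (P 1 # w) \<in> spanned p (adm_words p (wdeg p (B # w)) 0)" by simp
      then show ?thesis unfolding B True by (rule spanned_cong[OF ideal_B_2])
    next
      case False
      show ?thesis using spanned_mono[OF adm_words_mono[OF le0] B_spanned[OF False Cons.IH]] B by simp
    qed
  qed
qed

lemma homog_spanned:
  assumes "prime p" "homog p D x"
  shows "x \<in> spanned p (adm_words p D 0)"
proof -
  have "frag_extend frag_of x \<in> spanned p (adm_words p D 0)"
    by (rule spanned_frag_extend[where X="{w. wdeg p w = D}"])
      (use assms(2) word_spanned[OF assms(1)] in \<open>auto simp: homog_def\<close>)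
  then show ?thesis by (simp add: frag_expansion[symmetric])
qed

section \<open>The leading factor of an admissible monomial\<close>

text \<open>P^0 is omitted because \<open>adm_word\<close> asks for positive exponents.\<close>

definition lead :: "nat \<Rightarrow> nat \<Rightarrow> gen list" where
  "lead c e = replicate e B @ (if c = 0 then [] else [P c])"

lemma wdeg_lead: "wdeg p (lead c e) = c * pdeg p + e"
  by (simp add: lead_def wdeg_replicate)

lemma lead_val_0_adm_word: "0 < p \<Longrightarrow> adm_word p w \<Longrightarrow> lead_val p w = 0 \<Longrightarrow> w = []"
  by (cases w; cases "hd w") auto

lemma adm_word_lead_append:
  assumes "0 < p" "e \<le> 1" "p = 2 \<longrightarrow> e = 0" "adm_word p w" "lead_val p w \<le> c"
  shows "adm_word p (lead c e @ w) \<and> lead_val p (lead c e @ w) = p * c + e"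
proof (cases "c = 0")
  case True
  then have "w = []" using lead_val_0_adm_word assms by simp
  then show ?thesis using True assms by (cases e) (auto simp: lead_def)
next
  case False
  then show ?thesis using assms by (cases e) (auto simp: lead_def)
qed

lemma adm_word_lead_cases:
  assumes "adm_word p w"
  obtains c e b where "e \<le> 1" "p = 2 \<longrightarrow> e = 0" "w = lead c e @ b" "adm_word p b" "lead_val p b \<le> c" "lead_val p w = p * c + e"
proof -
  consider "w = []" | a v where "w = P a # v" | "w = [B]" | a v where "w = B # P a # v"
    using assms by (cases w; cases "hd w"; cases "tl w"; cases "hd (tl w)") auto
  then show ?thesis
  proof cases
    case 1
    then show ?thesis by (intro that[of 0 0 "[]"]) (auto simp: lead_def)
  next
    case (2 a v)
    then show ?thesis using assms by (intro that[of 0 a v]) (auto simp: lead_def)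
  next
    case 3
    then show ?thesis using assms by (intro that[of 1 0 "[]"]) (auto simp: lead_def)
  next
    case (4 a v)
    then show ?thesis using assms by (intro that[of 1 a v]) (auto simp: lead_def)
  qed
qed

lemma wdeg_0_adm_word:
  assumes "prime p" "adm_word p w" "wdeg p w = 0"
  shows "w = []"
  using assms pdeg_pos[OF assms(1)] by (cases w; cases "hd w") auto

text \<open>The degree forbids a first exponent above c, the leading value forbids one below c, and
  what follows the leading factor then has degree 0.\<close>

lemma adm_words_lead:
  assumes p: "prime p" and e: "e \<le> 1" "p = 2 \<longrightarrow> e = 0"
    and w: "w \<in> adm_words p (wdeg p (lead c e)) (p * c + e)"
  shows "w = lead c e \<and> lead_val p w = p * c + e"
proof -
  have p2: "2 \<le> p" using p by (simp add: prime_ge_2_nat)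
  \<comment> \<open>A first exponent above c would cost at least \<open>pdeg p\<close> in degree,
    more than the e that is available.\<close>
  have g: "e < pdeg p"
    using e p2 by (auto simp: pdeg_def)
  have "adm_word p w" using w by (simp add: adm_words_def)
  then obtain a e' b where b: "e' \<le> 1" "p = 2 \<longrightarrow> e' = 0" "w = lead a e' @ b" "adm_word p b" "lead_val p b \<le> a" "lead_val p w = p * a + e'"
    by (rule adm_word_lead_cases)
  have d: "a * pdeg p + e' + wdeg p b = c * pdeg p + e"
    using w b(3) unfolding adm_words_def by (simp add: wdeg_lead)
  have "\<not> c < a"
  proof
    assume "c < a"
    then have "Suc c * pdeg p \<le> a * pdeg p" by (intro mult_le_mono1) simp
    then show False using d g by simp
  qed
  moreover have "\<not> a < c"
  proof
    assume "a < c"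
    then have "p * Suc a \<le> p * c" by (intro mult_le_mono2) simp
    moreover have "p * c + e \<le> p * a + e'" using w b(6) unfolding adm_words_def by simp
    ultimately show False using b(1) p2 by simp
  qed
  ultimately have "a = c" by simp
  then have "e \<le> e'" using w b(6) unfolding adm_words_def by simp
  then have "e' = e" "wdeg p b = 0" using d \<open>a = c\<close> by auto
  then show ?thesis using b \<open>a = c\<close> wdeg_0_adm_word[OF p] by (simp add: lead_def)
qed

lemma mult_add_small_inject:
  fixes p a c e e' :: nat
  assumes "2 \<le> p" "e \<le> 1" "e' \<le> 1" "p * a + e' = p * c + e"
  shows "a = c \<and> e' = e"
proof -
  have "(p * a + e') div p = (p * c + e) div p" by (simp only: assms(4))
  then have "a = c" using assms(1-3) by simp
  then show ?thesis using assms(4) by simp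
qed

text \<open>The product is admissible as it stands if the leading value of w is at most c; otherwise
  straightening P^c w gains at least 1, and \<beta>^e adds e. For c = 0 the gain is already there,
  as w has positive leading value.\<close>

lemma lead_mult_spanned:
  assumes p: "prime p" and e: "e \<le> 1" "p = 2 \<longrightarrow> e = 0" and w: "adm_word p w"
  shows "frag_of (lead c e @ w) \<in> spanned p (adm_words p (wdeg p (lead c e) + wdeg p w)
    (if lead_val p w \<le> c then p * c + e else p * c + e + 1))"
proof (cases "lead_val p w \<le> c")
  case True
  then show ?thesis
    using adm_word_lead_append[OF prime_gt_0_nat[OF p] e w True]
    by (intro spanned_frag_of) (simp add: adm_words_def)
next
  case False
  have *: "frag_of (lead c 0 @ w) \<in> spanned p (adm_words p (c * pdeg p + wdeg p w) (p * c + 1))"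
  proof (cases "c = 0")
    case True
    then show ?thesis using False w by (intro spanned_frag_of) (auto simp: lead_def adm_words_def)
  next
    case c: False
    then show ?thesis using P_spanned[OF p w, of c] False by (simp add: lead_def)
  qed
  show ?thesis
  proof (cases "e = 0")
    case True
    then show ?thesis using * False by (simp add: wdeg_lead)
  next
    case e1: False
    then have "e = 1" "p \<noteq> 2" using e by auto
    then show ?thesis using B_spanned[OF _ *] False by (simp add: wdeg_lead) (simp add: lead_def)
  qed
qed

section \<open>The excess filtration in a fixed degree\<close>

lemma word_exc_nonneg:
  assumes "prime p"
  shows "adm_word p w \<Longrightarrow> 0 \<le> word_exc p w"
proof (induction w)
  case Nil
  then show ?case by (simp add: word_exc_def)
next
  case (Cons g w)
  show ?case
  proof (cases g)
    case (P a)
    obtain q where q: "p = Suc q" using prime_gt_0_nat[OF assms] gr0_conv_Suc by blast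
    have "word_exc_scale p * int (p * a) = word_exc_scale p * int a + int (a * pdeg p)"
      by (auto simp: q word_exc_scale_def pdeg_def algebra_simps)
    moreover have "word_exc_scale p * int (lead_val p w) \<le> word_exc_scale p * int a"
      using Cons P by (intro mult_left_mono) (auto simp: word_exc_scale_def)
    ultimately show ?thesis using Cons P by (simp add: word_exc_def)
  next
    case B
    then show ?thesis using Cons by (auto simp: word_exc_def word_exc_scale_def)
  qed
qed

lemma zspan_wmono: "zspan (wmono ` X) = {y. Poly_Mapping.keys y \<subseteq> X}"
proof (intro equalityI subsetI)
  fix y :: falg assume "y \<in> zspan (wmono ` X)"
  then show "y \<in> {y. Poly_Mapping.keys y \<subseteq> X}"
  proof (induction rule: zspan.induct)
    case (step x m c)
    then obtain w where "m = frag_of w" "w \<in> X" by (auto simp: wmono_eq_frag_of)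
    then show ?case using step keys_add[of x "frag_cmul c m"] keys_cmul[of c m] by auto
  qed simp
next
  fix y :: falg assume "y \<in> {y. Poly_Mapping.keys y \<subseteq> X}"
  then have y: "Poly_Mapping.keys y \<subseteq> X" by simp
  have "sum (\<lambda>w. frag_cmul (Poly_Mapping.lookup y w) (frag_of w)) I \<in> zspan (wmono ` X)"
    if "finite I" "I \<subseteq> X" for I
    using that
  proof (induction I)
    case empty
    then show ?case by (simp add: zspan.zero)
  next
    case (insert w I)
    then have "sum (\<lambda>w. frag_cmul (Poly_Mapping.lookup y w) (frag_of w)) I + frag_cmul (Poly_Mapping.lookup y w) (wmono w) \<in> zspan (wmono ` X)"
      by (intro zspan.step) auto
    then show ?case using insert by (simp add: wmono_eq_frag_of add.commute)
  qed
  from this[OF finite_keys y] show "y \<in> zspan (wmono ` X)"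
    by (simp add: frag_extend_def[symmetric] frag_expansion[symmetric])
qed

lemma Fset_pos:
  assumes "prime p" "0 < t"
  shows "Fset p t = spanned p {w. adm_word p w \<and> t \<le> word_exc p w}"
  using assms by (auto simp: Fset_def adm_exc_eq zspan_wmono spanned_def)

text \<open>For t > 0 a homogeneous x of the filtration step has an expansion z in its own degree
  and an expansion y of large excess but possibly mixed degrees. By independence they agree modulo
  p, so the part of z with small excess is divisible by p.\<close>

lemma Fdeg_eq:
  assumes p: "prime p"
  shows "Fdeg p t D = {x. homog p D x \<and> x \<in> spanned p {w. adm_word p w \<and> wdeg p w = D \<and> t \<le> word_exc p w}}"
    (is "_ = {x. _ \<and> x \<in> spanned p ?X}")
proof (cases "t \<le> 0")
  case True
  \<comment> \<open>The excess of an admissible word is nonnegative, in agreement with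
    \<open>Fset\<close> being everything for t \<le> 0.\<close>
  have "t \<le> word_exc p w" if "adm_word p w" for w using word_exc_nonneg[OF p that] True by linarith
  then have X: "?X = adm_words p D 0" by (auto simp: adm_words_def)
  show ?thesis
    unfolding X Fdeg_def Fset_def if_P[OF True] using homog_spanned[OF p] by blast
next
  case False
  have "x \<in> spanned p ?X" if h: "homog p D x" and x: "x \<in> spanned p {w. adm_word p w \<and> t \<le> word_exc p w}" for x
  proof -
    obtain y where y: "Poly_Mapping.keys y \<subseteq> {w. adm_word p w \<and> t \<le> word_exc p w}" "x - y \<in> steen_ideal p"
      using x by (rule spannedE)
    obtain z where z: "Poly_Mapping.keys z \<subseteq> adm_words p D 0" "x - z \<in> steen_ideal p"
      using homog_spanned[OF p h] by (rule spannedE)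
    have "z - y \<in> steen_ideal p" using ideal_diff[OF y(2) z(2)] by simp
    moreover have "Poly_Mapping.keys (z - y) \<subseteq> {w. adm_word p w}"
      using keys_diff[of z y] y(1) z(1) by (auto simp: adm_words_def)
    ultimately have zy: "int p dvd Poly_Mapping.lookup z w - Poly_Mapping.lookup y w" for w
      using adm_word_independent[OF p, of "z - y" w] by (simp add: lookup_minus)
    have "Poly_Mapping.keys z \<subseteq> ?X \<union> {w \<in> adm_words p D 0. \<not> t \<le> word_exc p w}" using z(1) by (auto simp: adm_words_def)
    then obtain d r where dr: "Poly_Mapping.keys d \<subseteq> ?X" "Poly_Mapping.keys r \<subseteq> {w \<in> adm_words p D 0. \<not> t \<le> word_exc p w}" "d + r = z"
      by (rule frag_split)
    have "int p dvd Poly_Mapping.lookup r w" for w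
    proof (cases "w \<in> Poly_Mapping.keys r")
      case True
      then have "\<not> t \<le> word_exc p w" using dr(2) by auto
      then have "w \<notin> Poly_Mapping.keys d" "w \<notin> Poly_Mapping.keys y" using dr(1) y(1) by auto
      then have "Poly_Mapping.lookup z w = Poly_Mapping.lookup r w" "Poly_Mapping.lookup y w = 0"
        using dr(3) by (auto simp: lookup_add in_keys_iff)
      then show ?thesis using zy[of w] by simp
    qed (simp add: in_keys_iff)
    then have "r \<in> steen_ideal p" by (rule ideal_dvd)
    from steen_ideal.add[OF z(2) this] have "x - d \<in> steen_ideal p"
      unfolding dr(3)[symmetric] by simp
    then show ?thesis by (rule spannedI[OF dr(1)])
  qed
  moreover have "spanned p ?X \<subseteq> spanned p {w. adm_word p w \<and> t \<le> word_exc p w}"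
    by (rule subsetI, rule spanned_mono) auto
  moreover have "Fset p t = spanned p {w. adm_word p w \<and> t \<le> word_exc p w}"
    using False by (intro Fset_pos[OF p]) simp
  ultimately show ?thesis unfolding Fdeg_def by blast
qed

lemma homog_zero: "homog p D 0"
  by (simp add: homog_def)

lemma homog_diff: "homog p D x \<Longrightarrow> homog p D y \<Longrightarrow> homog p D (x - y)"
  using keys_diff[of x y] by (auto simp: homog_def)

lemma homog_cmul: "homog p D x \<Longrightarrow> homog p D (frag_cmul c x)"
  using keys_cmul[of c x] by (auto simp: homog_def)

lemma homog_frag_of: "homog p (wdeg p w) (frag_of w)"
  by (simp add: homog_def)

lemma homog_fmul:
  assumes "homog p k x" "homog p j y"
  shows "homog p (k + j) (fmul x y)"
  unfolding homog_def
proof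
  fix w assume "w \<in> Poly_Mapping.keys (fmul x y)"
  then obtain u v where "u \<in> Poly_Mapping.keys x" "v \<in> Poly_Mapping.keys y" "w = u @ v"
    unfolding fmul_eq_frag_extend by (auto dest!: subsetD[OF keys_frag_extend])
  then show "wdeg p w = k + j" using assms by (simp add: homog_def)
qed

section \<open>The multiplication map on tensors\<close>

lemma tmul_eq: "tmul s = frag_extend (\<lambda>q. fmul (fst q) (snd q)) s"
  by (simp add: tmul_def frag_extend_def)

lemma tens_rel_diff: "x \<in> tens_rel U U' V V' \<Longrightarrow> y \<in> tens_rel U U' V V' \<Longrightarrow> x - y \<in> tens_rel U U' V V'"
  using tens_rel.add[of x U U' V V' "- y"] tens_rel.cmul[of y U U' V V' "- 1"] by simp

text \<open>Additivity modulo the subgroup T implies linearity over the integers modulo T. It serves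
  to move integers across the tensor sign, since the generators of \<open>tens_rel\<close> speak of
  sums only.\<close>

lemma additive_frag_cmul:
  fixes h :: "int \<Rightarrow> ('b \<Rightarrow>\<^sub>0 int)"
  assumes add: "\<And>m n. h (m + n) - h m - h n \<in> T"
    and T: "\<And>x y. x \<in> T \<Longrightarrow> y \<in> T \<Longrightarrow> x - y \<in> T"
  shows "h n - frag_cmul n (h 1) \<in> T"
proof -
  have Tz: "0 \<in> T" using T[OF add[of 0 0] add[of 0 0]] by simp
  have Tm: "- x \<in> T" if "x \<in> T" for x using T[OF Tz that] by simp
  have Ta: "x + y \<in> T" if "x \<in> T" "y \<in> T" for x y using T[OF that(1) Tm[OF that(2)]] by simp
  have step: "h (n + 1) - frag_cmul (n + 1) (h 1) = (h (n + 1) - h n - h 1) + (h n - frag_cmul n (h 1))" for n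
    by (simp add: frag_cmul_distrib)
  show ?thesis
  proof (induction n rule: int_induct[where k = 0])
    case base
    show ?case using Tm[OF add[of 0 0]] by simp
  next
    case (step1 i)
    show ?case unfolding step by (rule Ta[OF add step1(2)])
  next
    case (step2 i)
    then show ?case
      using step[of "i - 1"] T[OF _ add[of "i - 1" 1]] by (metis add_diff_cancel_left' diff_add_cancel)
  qed
qed

text \<open>The four parts say that the map is defined on representatives, respects the relations,
  is surjective and is injective. Modulo the ideal U consists of multiples of one element a, so
  every tensor is a \<otimes> b and the map is left multiplication by a.\<close>

theorem lead_tensor_iso:
  fixes p c e j :: nat
  assumes p: "prime p" and e: "e \<le> 1" "p = 2 \<longrightarrow> e = 0"
  defines "k \<equiv> wdeg p (lead c e)" and "M \<equiv> p * c + e"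
  defines "U \<equiv> {x. homog p k x \<and> x \<in> spanned p (adm_words p k M)}"
    and "U' \<equiv> {x. homog p k x \<and> x \<in> spanned p (adm_words p k (M + 1))}"
    and "V \<equiv> {x. homog p j x}"
    and "V' \<equiv> {x. homog p j x \<and> x \<in> spanned p (adm_words p j (c + 1))}"
    and "W \<equiv> {x. homog p (k + j) x \<and> x \<in> spanned p (adm_words p (k + j) M)}"
    and "W' \<equiv> {x. homog p (k + j) x \<and> x \<in> spanned p (adm_words p (k + j) (M + 1))}"
  shows "(\<forall>s. Poly_Mapping.keys s \<subseteq> U \<times> V \<longrightarrow> tmul s \<in> W)
       \<and> (\<forall>s\<in>tens_rel U U' V V'. tmul s \<in> W')
       \<and> (\<forall>w\<in>W. \<exists>s. Poly_Mapping.keys s \<subseteq> U \<times> V \<and> w - tmul s \<in> W')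
       \<and> (\<forall>s. Poly_Mapping.keys s \<subseteq> U \<times> V \<longrightarrow> tmul s \<in> W' \<longrightarrow> s \<in> tens_rel U U' V V')"
proof -
  have p2: "2 \<le> p" using p by (simp add: prime_ge_2_nat)
  let ?a = "frag_of (lead c e)"
  let ?T = "tens_rel U U' V V'"
  note lead = adm_word_lead_append[OF prime_gt_0_nat[OF p] e]
  have aU: "?a \<in> U"
    unfolding U_def k_def M_def using lead[of "[]" c] homog_frag_of
    by (auto intro!: spanned_frag_of simp: adm_words_def)
  have U: "\<exists>n. x - frag_cmul n ?a \<in> steen_ideal p" if "x \<in> U" for x
  proof -
    have "x \<in> spanned p (adm_words p k M)" using that by (simp add: U_def)
    then obtain y where y: "Poly_Mapping.keys y \<subseteq> adm_words p k M" "x - y \<in> steen_ideal p"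
      by (rule spannedE)
    have keys: "Poly_Mapping.keys y \<subseteq> {lead c e}"
      using y(1) adm_words_lead[OF p e] unfolding k_def M_def by blast
    have "y = frag_cmul (Poly_Mapping.lookup y (lead c e)) ?a"
    proof (rule poly_mapping_eqI)
      fix w
      show "Poly_Mapping.lookup y w = Poly_Mapping.lookup (frag_cmul (Poly_Mapping.lookup y (lead c e)) ?a) w"
        using keys by (cases "w = lead c e") (auto simp: in_keys_iff lookup_single)
    qed
    then show ?thesis using y(2) by metis
  qed
  \<comment> \<open>In degree k no admissible word has leading value above M.\<close>
  have U': "x \<in> steen_ideal p" if "x \<in> U'" for x
  proof -
    have "x \<in> spanned p (adm_words p k (M + 1))" using that by (simp add: U'_def)
    then obtain y where y: "Poly_Mapping.keys y \<subseteq> adm_words p k (M + 1)" "x - y \<in> steen_ideal p"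
      by (rule spannedE)
    have "adm_words p k (M + 1) = {}"
      using adm_words_lead[OF p e] unfolding k_def M_def by (fastforce simp: adm_words_def)
    then have "y = 0" using y(1) by simp
    then show ?thesis using y(2) by simp
  qed
  have V: "x \<in> spanned p (adm_words p j 0)" if "x \<in> V" for x
    using that homog_spanned[OF p] unfolding V_def by simp
  have aW: "fmul ?a b \<in> spanned p (adm_words p (k + j) M)" if "b \<in> spanned p (adm_words p j 0)" for b
    using that
  proof (rule spanned_lmul)
    fix w assume "w \<in> adm_words p j 0"
    then have w: "adm_word p w" "wdeg p w = j" by (auto simp: adm_words_def)
    show "frag_of (lead c e @ w) \<in> spanned p (adm_words p (k + j) M)"
      by (rule spanned_mono[OF adm_words_mono lead_mult_spanned[OF p e w(1), of c, folded k_def M_def, unfolded w(2)]]) simp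
  qed
  have aW': "fmul ?a b \<in> spanned p (adm_words p (k + j) (M + 1))" if "b \<in> spanned p (adm_words p j (c + 1))" for b
    using that
  proof (rule spanned_lmul)
    fix w assume "w \<in> adm_words p j (c + 1)"
    then have w: "adm_word p w" "wdeg p w = j" "\<not> lead_val p w \<le> c" by (auto simp: adm_words_def)
    show "frag_of (lead c e @ w) \<in> spanned p (adm_words p (k + j) (M + 1))"
      using lead_mult_spanned[OF p e w(1), of c, folded k_def M_def] w(2,3) by simp
  qed
  have fmulW: "fmul a b \<in> W" if "a \<in> U" "b \<in> V" for a b
  proof -
    obtain n where n: "a - frag_cmul n ?a \<in> steen_ideal p" using U[OF \<open>a \<in> U\<close>] ..
    have "fmul a b - frag_cmul n (fmul ?a b) \<in> steen_ideal p"
      using steen_ideal.rmul[OF n, of b] by (simp add: fmul_diff_left fmul_cmul_left)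
    then have "fmul a b \<in> spanned p (adm_words p (k + j) M)"
      by (rule spanned_cong) (rule spanned_cmul[OF aW[OF V[OF that(2)]]])
    then show ?thesis using that homog_fmul unfolding W_def U_def V_def by auto
  qed
  have W_diff: "x - y \<in> W" if "x \<in> W" "y \<in> W" for x y
    using that unfolding W_def by (auto intro: homog_diff spanned_diff)
  have W'_diff: "x - y \<in> W'" if "x \<in> W'" "y \<in> W'" for x y
    using that unfolding W'_def by (auto intro: homog_diff spanned_diff)
  have W_0: "0 \<in> W" and W'_0: "0 \<in> W'"
    unfolding W_def W'_def by (auto intro: homog_zero spanned_zero)
  have 1: "tmul s \<in> W" if "Poly_Mapping.keys s \<subseteq> U \<times> V" for s
    using that unfolding tmul_eq
    by (induction s rule: frag_induction) (auto simp: frag_extend_diff W_0 W_diff fmulW)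
  have 2: "tmul s \<in> W'" if "s \<in> ?T" for s
    using that
  proof (induction rule: tens_rel.induct)
    case (subl a b)
    have "fmul a b \<in> steen_ideal p" by (rule steen_ideal.rmul[OF U'[OF subl(1)]])
    then show ?case
      using subl homog_fmul unfolding W'_def U_def V_def by (auto simp: tmul_eq intro: spanned_ideal)
  next
    case (subr a b)
    obtain n where n: "a - frag_cmul n ?a \<in> steen_ideal p" using U[OF subr(1)] ..
    have "fmul a b - frag_cmul n (fmul ?a b) \<in> steen_ideal p"
      using steen_ideal.rmul[OF n, of b] by (simp add: fmul_diff_left fmul_cmul_left)
    then have "fmul a b \<in> spanned p (adm_words p (k + j) (M + 1))"
      by (rule spanned_cong) (rule spanned_cmul[OF aW'], use subr(2) V'_def in simp)
    then show ?case
      using subr homog_fmul unfolding W'_def U_def V_def by (auto simp: tmul_eq)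
  next
    case (add x y)
    then show ?case
      using W'_diff[of "tmul x" "0 - tmul y"] W'_diff[OF W'_0, of "tmul y"]
      by (simp add: tmul_eq frag_extend_add)
  next
    case (cmul x c)
    then show ?case unfolding W'_def
      by (auto simp: tmul_eq frag_extend_cmul intro: homog_cmul spanned_cmul)
  qed (simp_all add: tmul_eq frag_extend_diff fmul_add_left fmul_add_right W'_0)
  have 3: "\<exists>s. Poly_Mapping.keys s \<subseteq> U \<times> V \<and> w - tmul s \<in> W'" if w: "w \<in> W" for w
  proof -
    have "w \<in> spanned p (adm_words p (k + j) M)" using w by (simp add: W_def)
    then obtain y where y: "Poly_Mapping.keys y \<subseteq> adm_words p (k + j) M" "w - y \<in> steen_ideal p"
      by (rule spannedE)
    let ?S = "{v. \<exists>b. wdeg p b = j \<and> v = lead c e @ b}"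
    \<comment> \<open>Words with leading value equal to M begin with \<open>lead c e\<close>; all
      others lie in the next filtration step.\<close>
    have "adm_words p (k + j) M \<subseteq> ?S \<union> adm_words p (k + j) (M + 1)"
    proof
      fix v assume v: "v \<in> adm_words p (k + j) M"
      have "adm_word p v" using v by (simp add: adm_words_def)
      then obtain a e' b where b: "e' \<le> 1" "v = lead a e' @ b" "lead_val p v = p * a + e'"
        by (rule adm_word_lead_cases)
      show "v \<in> ?S \<union> adm_words p (k + j) (M + 1)"
      proof (cases "lead_val p v = M")
        case True
        then have "a = c" "e' = e"
          using mult_add_small_inject[OF p2 e(1) b(1)] b(3) unfolding M_def by auto
        then show ?thesis using v b(2) unfolding adm_words_def k_def by auto
      next
        case False
        then show ?thesis using v by (auto simp: adm_words_def)
      qed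
    qed
    then have "Poly_Mapping.keys y \<subseteq> ?S \<union> adm_words p (k + j) (M + 1)" using y(1) by blast
    then obtain d r where dr: "Poly_Mapping.keys d \<subseteq> ?S" "Poly_Mapping.keys r \<subseteq> adm_words p (k + j) (M + 1)" "d + r = y"
      by (rule frag_split)
    have "\<exists>s. Poly_Mapping.keys s \<subseteq> U \<times> V \<and> tmul s = d"
      using dr(1)
    proof (induction d rule: frag_induction)
      case zero
      show ?case by (rule exI[of _ 0]) (simp add: tmul_eq)
    next
      case (one v)
      then obtain b where b: "wdeg p b = j" "v = lead c e @ b" by blast
      then have "frag_of b \<in> V" using homog_frag_of[of p b] unfolding V_def by simp
      then show ?case
        using aU b(2) by (intro exI[of _ "frag_of (?a, frag_of b)"]) (simp add: tmul_eq fmul_frag_of)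
    next
      case (diff d1 d2)
      then obtain s1 s2 where "Poly_Mapping.keys s1 \<subseteq> U \<times> V" "tmul s1 = d1" "Poly_Mapping.keys s2 \<subseteq> U \<times> V" "tmul s2 = d2"
        by blast
      then show ?case using keys_diff[of s1 s2]
        by (intro exI[of _ "s1 - s2"]) (auto simp: tmul_eq frag_extend_diff)
    qed
    then obtain s where s: "Poly_Mapping.keys s \<subseteq> U \<times> V" "tmul s = d" by blast
    have "w - tmul s - r \<in> steen_ideal p" using y(2) s(2) dr(3) by (simp add: diff_diff_eq)
    then have "w - tmul s \<in> spanned p (adm_words p (k + j) (M + 1))" by (rule spannedI[OF dr(2)])
    then show ?thesis
      using s(1) w 1[OF s(1)] unfolding W'_def W_def by (auto intro: homog_diff)
  qed
  have T: "\<exists>b\<in>V. s - frag_of (?a, b) \<in> ?T" if "Poly_Mapping.keys s \<subseteq> U \<times> V" for s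
    using that
  proof (induction s rule: frag_induction)
    case zero
    have "0 \<in> V" "0 \<in> V'" unfolding V_def V'_def by (auto intro: homog_zero spanned_zero)
    then show ?case
      using tens_rel.subr[OF aU, of 0 V' V U'] tens_rel_diff[OF tens_rel.zero] by blast
  next
    case (one q)
    obtain a b where q: "q = (a, b)" by (cases q)
    with one have ab: "a \<in> U" "b \<in> V" by auto
    obtain n where n: "a - frag_cmul n ?a \<in> steen_ideal p" using U[OF ab(1)] ..
    have mU: "frag_cmul m ?a \<in> U" for m
      using aU unfolding U_def by (auto intro: homog_cmul spanned_cmul)
    have mV: "frag_cmul m b \<in> V" for m
      using ab(2) unfolding V_def by (auto intro: homog_cmul)
    have uU: "a - frag_cmul n ?a \<in> U" "a - frag_cmul n ?a \<in> U'"
      using ab(1) mU[of n] n unfolding U_def U'_def by (auto intro: homog_diff spanned_ideal)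
    have "frag_of (frag_cmul n ?a + (a - frag_cmul n ?a), b) - frag_of (frag_cmul n ?a, b) - frag_of (a - frag_cmul n ?a, b) \<in> ?T"
      by (rule tens_rel.addl[OF mU uU(1) ab(2)])
    moreover have "frag_of (a - frag_cmul n ?a, b) \<in> ?T"
      by (rule tens_rel.subl[OF uU(2,1) ab(2)])
    ultimately have t1: "frag_of (a, b) - frag_of (frag_cmul n ?a, b) \<in> ?T"
      using tens_rel.add by fastforce
    have t2: "frag_of (frag_cmul n ?a, b) - frag_cmul n (frag_of (frag_cmul 1 ?a, b)) \<in> ?T"
      by (rule additive_frag_cmul) (auto simp: frag_cmul_distrib intro: tens_rel.addl[OF mU mU ab(2)] tens_rel_diff)
    have t3: "frag_of (?a, frag_cmul n b) - frag_cmul n (frag_of (?a, frag_cmul 1 b)) \<in> ?T"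
      by (rule additive_frag_cmul) (auto simp: frag_cmul_distrib intro: tens_rel.addr[OF aU mV mV] tens_rel_diff)
    \<comment> \<open>Here f, g, h and x stand for a \<otimes> b, n ?a \<otimes> b, ?a \<otimes> n b
      and n (?a \<otimes> b).\<close>
    have "(f - g) + (g - x) - (h - x) = f - h" for f g h x :: "falg \<times> falg \<Rightarrow>\<^sub>0 int"
      by simp
    then have "frag_of (a, b) - frag_of (?a, frag_cmul n b) \<in> ?T"
      using tens_rel_diff[OF tens_rel.add[OF t1 t2] t3] by (simp only: frag_cmul_one)
    then show ?case unfolding q using mV by blast
  next
    case (diff s1 s2)
    then obtain b1 b2 where b: "b1 \<in> V" "s1 - frag_of (?a, b1) \<in> ?T" "b2 \<in> V" "s2 - frag_of (?a, b2) \<in> ?T" by blast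
    have bV: "b1 - b2 \<in> V" using b(1,3) unfolding V_def by (auto intro: homog_diff)
    have "frag_of (?a, (b1 - b2) + b2) - frag_of (?a, b1 - b2) - frag_of (?a, b2) \<in> ?T"
      by (rule tens_rel.addr[OF aU bV b(3)])
    from tens_rel.add[OF tens_rel_diff[OF b(2,4)] this]
    have "s1 - s2 - frag_of (?a, b1 - b2) \<in> ?T" by (simp add: algebra_simps)
    then show ?case using bV by blast
  qed
  have 4: "s \<in> ?T" if s: "Poly_Mapping.keys s \<subseteq> U \<times> V" "tmul s \<in> W'" for s
  proof -
    obtain b where b: "b \<in> V" "s - frag_of (?a, b) \<in> ?T" using T[OF s(1)] ..
    have "tmul s - fmul ?a b \<in> W'" using 2[OF b(2)] by (simp add: tmul_eq frag_extend_diff)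
    from W'_diff[OF s(2) this] have ab: "fmul ?a b \<in> spanned p (adm_words p (k + j) (M + 1))"
      by (simp add: W'_def)
    obtain z where z: "Poly_Mapping.keys z \<subseteq> adm_words p j 0" "b - z \<in> steen_ideal p"
      using V[OF b(1)] by (rule spannedE)
    \<comment> \<open>The part r with leading value above c represents an element of the second
      filtration step; what has to be shown is that d vanishes modulo p.\<close>
    have "Poly_Mapping.keys z \<subseteq> {w \<in> adm_words p j 0. lead_val p w \<le> c} \<union> adm_words p j (c + 1)" using z(1) by (auto simp: adm_words_def)
    then obtain d r where dr: "Poly_Mapping.keys d \<subseteq> {w \<in> adm_words p j 0. lead_val p w \<le> c}"
      "Poly_Mapping.keys r \<subseteq> adm_words p j (c + 1)" "d + r = z"
      by (rule frag_split)
    have d: "d = (b - r) - (b - z)" using dr(3) by (simp add: algebra_simps)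
    have "fmul ?a d = fmul ?a b - fmul ?a r - fmul ?a (b - z)"
      unfolding d fmul_diff_right ..
    moreover have "fmul ?a b - fmul ?a r - fmul ?a (b - z) \<in> spanned p (adm_words p (k + j) (M + 1))"
      by (intro spanned_diff ab aW' spanned_keys[OF dr(2)] spanned_ideal steen_ideal.lmul z(2))
    ultimately have "fmul ?a d \<in> spanned p (adm_words p (k + j) (M + 1))" by (simp only:)
    then obtain y where y: "Poly_Mapping.keys y \<subseteq> adm_words p (k + j) (M + 1)" "fmul ?a d - y \<in> steen_ideal p"
      by (rule spannedE)
    have kd: "Poly_Mapping.keys (fmul ?a d) \<subseteq> {lead c e @ w | w. w \<in> Poly_Mapping.keys d}"
      unfolding fmul_frag_of_left using keys_frag_extend[of "\<lambda>v. frag_of (lead c e @ v)" d] by auto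
    have "Poly_Mapping.keys (fmul ?a d) \<subseteq> {w. adm_word p w}"
    proof
      fix v assume "v \<in> Poly_Mapping.keys (fmul ?a d)"
      then obtain w where w: "v = lead c e @ w" "w \<in> Poly_Mapping.keys d" using kd by blast
      then have "adm_word p w" "lead_val p w \<le> c" using dr(1) by (auto simp: adm_words_def)
      then show "v \<in> {w. adm_word p w}" using lead w(1) by simp
    qed
    then have "Poly_Mapping.keys (fmul ?a d - y) \<subseteq> {w. adm_word p w}"
      using keys_diff[of "fmul ?a d" y] y(1) by (auto simp: adm_words_def)
    from adm_word_independent[OF p this y(2)]
    have dv: "int p dvd Poly_Mapping.lookup (fmul ?a d) v - Poly_Mapping.lookup y v" for v
      by (simp add: lookup_minus)
    \<comment> \<open>Prefixing a fixed word is injective, so coefficients are carried over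
      unchanged.\<close>
    have lk: "Poly_Mapping.lookup (fmul ?a x) (lead c e @ v) = Poly_Mapping.lookup x v" for x v
      unfolding fmul_frag_of_left using subset_UNIV
      by (induction x rule: frag_induction) (simp_all add: frag_extend_diff lookup_minus lookup_single when_def)
    have "int p dvd Poly_Mapping.lookup d v" for v
    proof (cases "v \<in> Poly_Mapping.keys d")
      case True
      \<comment> \<open>The words of y have leading value at least M + 1, so this one is not among
        them and its coefficient must be divisible by p.\<close>
      then have "lead_val p (lead c e @ v) = M" using dr(1) lead[of v c] unfolding M_def by (auto simp: adm_words_def)
      then have "lead c e @ v \<notin> Poly_Mapping.keys y" using y(1) by (auto simp: adm_words_def)
      then have "Poly_Mapping.lookup y (lead c e @ v) = 0" by (simp add: in_keys_iff)
      then show ?thesis using dv[of "lead c e @ v"] lk by simp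
    qed (simp add: in_keys_iff)
    then have "d \<in> steen_ideal p" by (rule ideal_dvd)
    from steen_ideal.add[OF z(2) this] have "b - r \<in> steen_ideal p" unfolding dr(3)[symmetric] by simp
    then have "b \<in> V'" using b(1) spannedI[OF dr(2)] unfolding V'_def V_def by auto
    then have "frag_of (?a, b) \<in> ?T" using tens_rel.subr[OF aU] b(1) by blast
    from tens_rel.add[OF b(2) this] show ?thesis by simp
  qed
  show ?thesis
    using 1 2 3 4 by (intro conjI allI ballI impI)
qed

theorem theorem2p2:
  fixes p i j \<epsilon> :: nat
  assumes "prime p" and "\<epsilon> \<le> 1"
  defines "n \<equiv> 2 * int i + int \<epsilon>"
      and "k \<equiv> 2 * i * (p - 1) + \<epsilon>"
  defines "U \<equiv> Fdeg p n k" and "U' \<equiv> Fdeg p (n + 1) k"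
      and "V \<equiv> Adeg p j" and "V' \<equiv> Fdeg p (n - int j + 1) j"
      and "W \<equiv> Fdeg p (n - int j) (k + j)" and "W' \<equiv> Fdeg p (n - int j + 1) (k + j)"
  shows "(\<forall>s. Poly_Mapping.keys s \<subseteq> U \<times> V \<longrightarrow> tmul s \<in> W)
       \<and> (\<forall>s\<in>tens_rel U U' V V'. tmul s \<in> W')
       \<and> (\<forall>w\<in>W. \<exists>s. Poly_Mapping.keys s \<subseteq> U \<times> V \<and> w - tmul s \<in> W')
       \<and> (\<forall>s. Poly_Mapping.keys s \<subseteq> U \<times> V \<longrightarrow> tmul s \<in> W' \<longrightarrow> s \<in> tens_rel U U' V V')"
proof -
  \<comment> \<open>For p = 2 the monomial of degree 2i + \<epsilon> is Sq^(2i+\<epsilon>), so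
    \<epsilon> is absorbed into the exponent.\<close>
  define c where "c = (if p = 2 then 2 * i + \<epsilon> else i)"
  define e where "e = (if p = 2 then 0 else \<epsilon>)"
  define M where "M = p * c + e"
  have p2: "2 \<le> p" using assms(1) by (simp add: prime_ge_2_nat)
  have e: "e \<le> 1" "p = 2 \<longrightarrow> e = 0" using assms(2) by (auto simp: e_def)
  have k: "k = wdeg p (lead c e)"
    by (simp add: k_def wdeg_lead c_def e_def pdeg_def)
  \<comment> \<open>Excess n in degree k corresponds to leading value M. Raising the degree by j and
    lowering the excess by j keeps the sum, so M serves the target as well.\<close>
  have nk: "n + int k = word_exc_scale p * int M"
    using p2 by (cases p) (simp_all add: M_def n_def k_def c_def e_def word_exc_scale_def algebra_simps)
  have exM: "n \<le> word_exc p w \<longleftrightarrow> M \<le> lead_val p w" "n + 1 \<le> word_exc p w \<longleftrightarrow> M + 1 \<le> lead_val p w" if "wdeg p w = k" for w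
    using that nk by (auto simp: word_exc_def word_exc_scale_def)
  have MW: "n - int j \<le> word_exc p w \<longleftrightarrow> M \<le> lead_val p w" "n - int j + 1 \<le> word_exc p w \<longleftrightarrow> M + 1 \<le> lead_val p w"
    if "wdeg p w = k + j" for w
    using that nk by (auto simp: word_exc_def word_exc_scale_def)
  \<comment> \<open>For odd p the bound reads 2 m \<ge> 2 i + \<epsilon> + 1, which is m \<ge> i + 1
    for both values of \<epsilon>.\<close>
  have MV: "n - int j + 1 \<le> word_exc p w \<longleftrightarrow> c + 1 \<le> lead_val p w" if "wdeg p w = j" for w
    using that assms(2) by (auto simp: word_exc_def word_exc_scale_def n_def c_def)
  have "U = {x. homog p k x \<and> x \<in> spanned p (adm_words p k M)}"
    "U' = {x. homog p k x \<and> x \<in> spanned p (adm_words p k (M + 1))}"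
    "V = {x. homog p j x}"
    "V' = {x. homog p j x \<and> x \<in> spanned p (adm_words p j (c + 1))}"
    "W = {x. homog p (k + j) x \<and> x \<in> spanned p (adm_words p (k + j) M)}"
    "W' = {x. homog p (k + j) x \<and> x \<in> spanned p (adm_words p (k + j) (M + 1))}"
    unfolding U_def U'_def V_def V'_def W_def W'_def Fdeg_eq[OF assms(1)] Adeg_def adm_words_def
    using exM MW MV by (simp_all cong: conj_cong)
  then show ?thesis
    using lead_tensor_iso[OF assms(1) e, of c j, folded k M_def] by simp
qed

end
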